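(* Consider $\mathbb{CP}^n$ with the Fubini–Study metric. Then Green's function of the Laplace–Beltrami operator is $G:(\mathbb{CP}^n\times\mathbb{CP}^n)\setminus\mathrm{Diag}_2(\mathbb{CP}^n)\to\mathbb{R}$, $$G(\xi,\eta)=-\frac{1}{2n\cdot\operatorname{vol}(\mathbb{CP}^n)}\left(\log(\sin(r(\xi,\eta)))-\sum_{j=1}^{n-1}\frac{1}{2j\sin^{2j}(r(\xi,\eta))}\right),$$ where $r(\xi,\eta)=\arccos\sqrt{\frac{\langle\xi,\eta\rangle_H\langle\eta,\xi\rangle_H}{\langle\xi,\xi\rangle_H\langle\eta,\eta\rangle_H}}$ is the geodesic distance and $\langle\cdot,\cdot\rangle_H$ is the Hermitian inner product on $\mathbb{C}^{n+1}$.
   Context: $\mathrm{Diag}_2(M)=\{(p,p):p\in M\}$. The Fubini–Study metric is normalized so that $\operatorname{diam}(\mathbb{CP}^n)=\pi/2$ and $\operatorname{vol}(\mathbb{CP}^n)=\pi^n/n!$. For a compact Riemannian manifold $(M,g)$ with volume measure $d\mu$ and Laplace–Beltrami operator $\Delta f=-\frac{1}{\sqrt{|\det g|}}\sum_{i,j}\partial_{x_j}\big(g^{ij}\sqrt{|\det g|}\,\partial_{x_i}f\big)$, a Green's function is a function $G:(M\times M)\setminus\mathrm{Diag}_2(M)\to\mathbb{R}$ that is smooth, symmetric ($G(p,q)=G(q,p)$), has $\int_M G(p,q)\,d\mu(q)$ independent of $p$, and satisfies $\phi(p)=\frac{1}{\operatorname{vol}(M)}\int_M\phi\,d\mu+\int_M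 G(p,q)\Delta\phi(q)\,d\mu(q)$ for all $\phi\in C^2(M,\mathbb{R})$. *)

theory Defs
  imports "HOL-Analysis.Analysis"
begin

(* CP^n is modelled by homogeneous coordinates: nonzero vectors in complex^('n option)
   (so n = CARD('n), n+1 = CARD('n option)), two vectors representing the same point
   iff they are proportional.  Functions on CP^n are functions on nonzero vectors that
   are invariant under nonzero complex scaling. *)

definition herm :: "complex^'k \<Rightarrow> complex^'k \<Rightarrow> complex" where
  "herm u v = (\<Sum>k\<in>UNIV. u$k * cnj (v$k))"

definition fs_dist :: "complex^'k \<Rightarrow> complex^'k \<Rightarrow> real" where
  "fs_dist \<xi> \<eta> = arccos (sqrt (Re ((herm \<xi> \<eta> * herm \<eta> \<xi>) / (herm \<xi> \<xi> * herm \<eta> \<eta>))))"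

fun Ck :: "nat \<Rightarrow> 'a::euclidean_space set \<Rightarrow> ('a \<Rightarrow> real) \<Rightarrow> bool" where
  "Ck 0 S f = continuous_on S f"
| "Ck (Suc k) S f = (f differentiable_on S \<and>
      (\<forall>v. Ck k S (\<lambda>x. frechet_derivative f (at x) v)))"

definition fs_C2 :: "(complex^'k \<Rightarrow> real) \<Rightarrow> bool" where
  "fs_C2 \<phi> \<longleftrightarrow> (\<forall>\<xi> c. \<xi> \<noteq> 0 \<and> c \<noteq> 0 \<longrightarrow> \<phi> (c *s \<xi>) = \<phi> \<xi>) \<and> Ck 2 {\<xi>. \<xi> \<noteq> 0} \<phi>"

definition offdiag :: "((complex^'k) \<times> (complex^'k)) set" where
  "offdiag = {(p, q). p \<noteq> 0 \<and> q \<noteq> 0 \<and> (\<forall>c. q \<noteq> c *s p)}"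

definition ccoord :: "real^('n::finite \<times> bool) \<Rightarrow> complex^'n" where
  "ccoord x = (\<chi> a. Complex (x$(a,True)) (x$(a,False)))"

definition chart :: "real^('n::finite \<times> bool) \<Rightarrow> complex^('n option)" where
  "chart x = (\<chi> k. case k of None \<Rightarrow> 1 | Some a \<Rightarrow> ccoord x $ a)"

text \<open>complex tangent vector corresponding to the real coordinate direction i\<close>
definition cdir :: "'n::finite \<times> bool \<Rightarrow> complex^'n" where
  "cdir i = (\<chi> a. if a = fst i then (if snd i then 1 else \<i>) else 0)"

text \<open>Fubini--Study metric (diameter pi/2) in the chart:
  g(u,v) = Re( <u,v>/(1+|z|^2) - <u,z><z,v>/(1+|z|^2)^2 ).\<close>
definition fs_metric :: "real^('n::finite \<times> bool) \<Rightarrow> real^('n \<times> bool)^('n \<times> bool)" where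
  "fs_metric x = (\<chi> i j. let z = ccoord x; s = 1 + Re (herm z z) in
      Re (herm (cdir i) (cdir j) / of_real s - herm (cdir i) z * herm z (cdir j) / of_real (s\<^sup>2)))"

definition vol_density :: "real^('n::finite \<times> bool) \<Rightarrow> real" where
  "vol_density x = sqrt \<bar>det (fs_metric x)\<bar>"

definition partial :: "'c::finite \<Rightarrow> (real^'c \<Rightarrow> real) \<Rightarrow> real^'c \<Rightarrow> real" where
  "partial i h x = deriv (\<lambda>t. h (x + t *\<^sub>R axis i 1)) 0"

text \<open>Laplace--Beltrami operator in local coordinates (paper's sign convention).\<close>
definition fs_laplacian :: "(real^('n::finite \<times> bool) \<Rightarrow> real) \<Rightarrow> real^('n \<times> bool) \<Rightarrow> real" where
  "fs_laplacian f x = - (1 / vol_density x) *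
     (\<Sum>i\<in>UNIV. \<Sum>j\<in>UNIV. partial j (\<lambda>y. matrix_inv (fs_metric y) $ i $ j * vol_density y * partial i f y) x)"

text \<open>Integration over CP^n with respect to the Riemannian volume measure
  (computed in the chart U_0, whose complement is a null set).\<close>
definition fs_integrable :: "(complex^('n::finite option) \<Rightarrow> real) \<Rightarrow> bool" where
  "fs_integrable f \<longleftrightarrow> integrable lborel (\<lambda>x::real^('n \<times> bool). f (chart x) * vol_density x)"

definition fs_integral :: "(complex^('n::finite option) \<Rightarrow> real) \<Rightarrow> real" where
  "fs_integral f = integral\<^sup>L lborel (\<lambda>x::real^('n \<times> bool). f (chart x) * vol_density x)"

definition fs_vol :: "'n::finite itself \<Rightarrow> real" where
  "fs_vol _ = fs_integral (\<lambda>_::complex^('n option). 1)"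

definition fs_lap_at :: "(complex^('n::finite option) \<Rightarrow> real) \<Rightarrow> real^('n \<times> bool) \<Rightarrow> real" where
  "fs_lap_at \<phi> x = fs_laplacian (\<lambda>y. \<phi> (chart y)) x"

definition is_green_FS :: "(complex^('n::finite option) \<Rightarrow> complex^('n option) \<Rightarrow> real) \<Rightarrow> bool" where
  "is_green_FS G \<longleftrightarrow>
     (\<forall>p q c d. (p, q) \<in> offdiag \<and> c \<noteq> 0 \<and> d \<noteq> 0 \<longrightarrow> G (c *s p) (d *s q) = G p q) \<and>
     (\<forall>k. Ck k offdiag (\<lambda>(p, q). G p q)) \<and>
     (\<forall>p q. (p, q) \<in> offdiag \<longrightarrow> G p q = G q p) \<and>
     (\<exists>C. \<forall>p. p \<noteq> 0 \<longrightarrow> fs_integrable (G p) \<and> fs_integral (G p) = C) \<and>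
     (\<forall>\<phi>. fs_C2 \<phi> \<longrightarrow> (\<forall>p. p \<noteq> 0 \<longrightarrow>
        integrable lborel (\<lambda>x. G p (chart x) * fs_lap_at \<phi> x * vol_density x) \<and>
        \<phi> p = fs_integral \<phi> / fs_vol TYPE('n)
              + integral\<^sup>L lborel (\<lambda>x. G p (chart x) * fs_lap_at \<phi> x * vol_density x)))"

end

(* The Green function depends on the overlap t = |<p,q>|^2 / (|p|^2 |q|^2) = cos^2 r only.  A function
   on projective space is a function on C^(n+1) - {0} invariant under scaling, and its Fubini-Study
   Laplacian is, up to the sign convention, |xi|^2 times its Euclidean Laplacian.  Integrating an
   invariant function against a compactly supported radial weight recovers, up to a constant, its
   integral over projective space, so the symmetry of the Laplacian comes from translation
   invariance of Lebesgue measure, with no boundary terms.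

   On functions F(t) the Laplacian is L F = 4 (t (1 - t) F'' + (1 - (n+1) t) F').  Writing the
   candidate as a multiple of P(1 - t), the regularization P(1 + eps - t) is smooth up to the pole
   t = 1, and L of it equals -2 n plus an explicit nonnegative kernel which concentrates at t = 1 and
   has total mass 2 n vol.  Letting eps tend to 0 gives the representation formula.  The mass is
   found by testing with the constant function, the integrability of the limit by testing with t. *)

theory Submission
  imports Defs
begin

section \<open>Iterated differentiability\<close>

text \<open>Origin of the profile: L F = 4 (1-t)^(1-n) (t (1-t)^n F')'. Solving L F = -2n with
  regularity at t = 0 forces t (1-t)^n F' = ((1-t)^n - 1) / 2, so F' is minus half the geometric sum
  of (1-t)^(-j), j = 1..n; integration in s = 1 - t = sin^2 r gives \<open>green_profile\<close>.
  The right-hand side is a nonzero constant because on a closed manifold a point mass must be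
  balanced by a uniform density, and the mass 2n vol dictates the factor in front. Two obstacles
  shape the proof. The profile blows up at the pole, so the symmetry of the Laplacian does not apply
  to it. And all integrals live in one fixed chart while the pole is arbitrary, so nothing can be
  computed in polar coordinates around it. Mass and integrability are therefore extracted from the
  symmetry itself, with functions of t as test functions. The same device shows that the integral of
  G does not depend on the pole: the moments of t obey a recursion in which p does not
  occur.\<close>

lemma Ck_cong:
  assumes S: "open S" and fg: "\<And>x. x \<in> S \<Longrightarrow> f x = g x" and f: "Ck k S f"
  shows "Ck k S g"
  using fg f
proof (induction k arbitrary: f g)
  case 0
  then show ?case by (metis Ck.simps(1) continuous_on_cong)
next
  case (Suc k)
  have der: "(g has_derivative f') (at x)" if "x \<in> S" "(f has_derivative f') (at x)" for x f'
    using that Suc.prems(1) has_derivative_transform_within_open S by blast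
  have d: "f differentiable (at x)" if "x \<in> S" for x
    using Suc.prems(2) S that by (simp add: differentiable_on_eq_differentiable_at)
  have eq: "frechet_derivative f (at x) = frechet_derivative g (at x)" if "x \<in> S" for x
    using der[OF that] d[OF that] frechet_derivative_at frechet_derivative_works by blast
  have "g differentiable_on S"
    using der d S frechet_derivative_works by (metis differentiableI differentiable_on_eq_differentiable_at)
  moreover have "Ck k S (\<lambda>x. frechet_derivative g (at x) v)" for v
  proof (rule Suc.IH)
    show "frechet_derivative f (at x) v = frechet_derivative g (at x) v" if "x \<in> S" for x
      using eq[OF that] by simp
    show "Ck k S (\<lambda>x. frechet_derivative f (at x) v)"
      using Suc.prems(2) by simp
  qed
  ultimately show ?case by simp
qed

text \<open>\<open>frechet_derivative\<close> is a choice, awkward to unfold. On an open set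
  derivatives are unique and depend only on nearby values, so any explicit derivative can stand in
  for it; the closure rules below use this rule.\<close>

lemma Ck_SucI:
  assumes S: "open S" and der: "\<And>x. x \<in> S \<Longrightarrow> (f has_derivative f' x) (at x)"
    and f': "\<And>v. Ck k S (\<lambda>x. f' x v)"
  shows "Ck (Suc k) S f"
proof -
  have "f differentiable_on S"
    using der S by (auto simp: differentiable_on_eq_differentiable_at differentiable_def)
  moreover have "Ck k S (\<lambda>x. frechet_derivative f (at x) v)" for v
  proof (rule Ck_cong[OF S _ f'[of v]])
    show "f' x v = frechet_derivative f (at x) v" if "x \<in> S" for x
      using der[OF that] frechet_derivative_at by metis
  qed
  ultimately show ?thesis by simp
qed

lemma Ck_SucD:
  assumes "open S" "Ck (Suc k) S f" "x \<in> S"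
  shows "(f has_derivative frechet_derivative f (at x)) (at x)"
  using assms by (simp add: differentiable_on_eq_differentiable_at frechet_derivative_works)

lemma Ck_mono_Suc: "Ck (Suc k) S f \<Longrightarrow> Ck k S f"
  by (induction k arbitrary: f) (auto simp: differentiable_imp_continuous_on)

lemma Ck_const: "Ck k S (\<lambda>x. c)"
proof (induction k arbitrary: c)
  case (Suc k)
  show ?case using Suc[of 0] by (simp add: frechet_derivative_const)
qed simp

lemma Ck_bounded_linear:
  assumes S: "open S" and f: "bounded_linear f"
  shows "Ck k S f"
proof (cases k)
  case 0
  then show ?thesis using f by (simp add: linear_continuous_on)
next
  case (Suc m)
  show ?thesis unfolding Suc
    by (rule Ck_SucI[OF S, of _ "\<lambda>_. f"]) (use f in \<open>auto simp: bounded_linear_imp_has_derivative Ck_const\<close>)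
qed

lemma Ck_add:
  assumes S: "open S" and "Ck k S f" "Ck k S g"
  shows "Ck k S (\<lambda>x. f x + g x)"
  using assms(2,3)
proof (induction k arbitrary: f g)
  case 0
  then show ?case by (simp add: continuous_on_add)
next
  case (Suc k)
  show ?case
  proof (rule Ck_SucI[OF S, of _ "\<lambda>x v. frechet_derivative f (at x) v + frechet_derivative g (at x) v"])
    show "((\<lambda>x. f x + g x) has_derivative (\<lambda>v. frechet_derivative f (at x) v + frechet_derivative g (at x) v)) (at x)"
      if "x \<in> S" for x
      using Suc.prems that S by (intro has_derivative_add Ck_SucD)
  qed (use Suc in auto)
qed

lemma Ck_mult:
  assumes S: "open S" and "Ck k S f" "Ck k S g"
  shows "Ck k S (\<lambda>x. f x * g x)"
  using assms(2,3)
proof (induction k arbitrary: f g)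
  case 0
  then show ?case by (simp add: continuous_on_mult)
next
  case (Suc k)
  show ?case
  proof (rule Ck_SucI[OF S, of _ "\<lambda>x v. f x * frechet_derivative g (at x) v + frechet_derivative f (at x) v * g x"])
    show "((\<lambda>x. f x * g x) has_derivative (\<lambda>v. f x * frechet_derivative g (at x) v + frechet_derivative f (at x) v * g x)) (at x)"
      if "x \<in> S" for x
      using Suc.prems that S by (intro has_derivative_mult Ck_SucD)
    show "Ck k S (\<lambda>x. f x * frechet_derivative g (at x) v + frechet_derivative f (at x) v * g x)" for v
      using Suc.prems Suc.prems[THEN Ck_mono_Suc] by (intro Ck_add[OF S] Suc.IH) simp_all
  qed
qed

text \<open>The derivative -f'/f^2 contains the inverse itself, but one order lower, so the
  induction closes with \<open>Ck_mult\<close>.\<close>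

lemma Ck_inverse:
  assumes S: "open S" and "Ck k S f" and nz: "\<And>x. x \<in> S \<Longrightarrow> f x \<noteq> 0"
  shows "Ck k S (\<lambda>x. inverse (f x))"
  using assms(2)
proof (induction k)
  case 0
  then show ?case using nz by (auto intro!: continuous_on_inverse)
next
  case (Suc k)
  note c = Suc.IH[OF Ck_mono_Suc[OF Suc.prems]]
  show ?case
  proof (rule Ck_SucI[OF S, of _ "\<lambda>x v. (- 1) * (inverse (f x) * frechet_derivative f (at x) v * inverse (f x))"])
    show "((\<lambda>x. inverse (f x)) has_derivative (\<lambda>v. (- 1) * (inverse (f x) * frechet_derivative f (at x) v * inverse (f x)))) (at x)"
      if "x \<in> S" for x
      using Deriv.has_derivative_inverse[OF nz[OF that] Ck_SucD[OF S Suc.prems that]] by simp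
    show "Ck k S (\<lambda>x. (- 1) * (inverse (f x) * frechet_derivative f (at x) v * inverse (f x)))" for v
      using Suc.prems c by (intro Ck_mult[OF S] Ck_const) auto
  qed
qed

lemma Ck_ln:
  assumes S: "open S" and f: "Ck k S f" and pos: "\<And>x. x \<in> S \<Longrightarrow> f x > 0"
  shows "Ck k S (\<lambda>x. ln (f x))"
proof (cases k)
  case 0
  then show ?thesis using f pos by (force intro!: continuous_on_ln)
next
  case (Suc m)
  have f': "Ck (Suc m) S f" using f Suc by simp
  have "Ck m S (\<lambda>x. inverse (f x))"
    using pos by (intro Ck_inverse[OF S Ck_mono_Suc[OF f']]) force
  then show ?thesis unfolding Suc
    using f' pos
    by (intro Ck_SucI[OF S, of _ "\<lambda>x v. frechet_derivative f (at x) v * inverse (f x)"])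
      (auto intro!: Ck_mult[OF S] derivative_eq_intros Ck_SucD[OF S f'] simp: divide_inverse simp del: inverse_eq_divide)
qed

lemma Ck_sum:
  assumes "open S" "\<And>i. i \<in> I \<Longrightarrow> Ck k S (f i)"
  shows "Ck k S (\<lambda>x. \<Sum>i\<in>I. f i x)"
  using assms(2)
  by (induction I rule: infinite_finite_induct) (auto intro!: Ck_const Ck_add[OF \<open>open S\<close>])

lemma Ck_power:
  assumes "open S" "Ck k S f"
  shows "Ck k S (\<lambda>x. f x ^ m)"
  by (induction m) (auto intro!: Ck_const Ck_mult assms)

lemma Ck_cmult:
  assumes "open S" "Ck k S f"
  shows "Ck k S (\<lambda>x. c * f x)"
  using assms by (intro Ck_mult Ck_const)

lemma Ck_diff:
  assumes "open S" "Ck k S f" "Ck k S g"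
  shows "Ck k S (\<lambda>x. f x - g x)"
  using Ck_add[OF assms(1,2) Ck_cmult[OF assms(1,3), of "-1"]] by simp

section \<open>Hermitian product and overlap\<close>

lemma inner_eq_Re_herm: "u \<bullet> v = Re (herm u v)"
  by (simp add: inner_vec_def herm_def inner_complex_def)

lemma herm_commute: "herm v u = cnj (herm u v)"
  by (simp add: herm_def mult.commute)

lemma herm_self: "herm u u = of_real ((norm u)\<^sup>2)"
proof -
  have "Im (herm u u) = 0"
    using herm_commute[of u u] by (metis complex_cnj_cancel_iff Reals_cnj_iff complex_is_Real_iff)
  then show ?thesis
    by (simp add: complex_eq_iff dot_square_norm flip: inner_eq_Re_herm)
qed

lemma herm_add_left: "herm (u + v) w = herm u w + herm v w"
  by (simp add: herm_def sum.distrib ring_distribs)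

lemma herm_scale_left: "herm (c *s u) v = c * herm u v"
  by (simp add: herm_def sum_distrib_left mult_ac)

lemma herm_scale_right: "herm u (c *s v) = cnj c * herm u v"
  by (simp add: herm_def sum_distrib_left mult_ac)

lemma of_real_cmod_power2: "(complex_of_real (cmod z))\<^sup>2 = z * cnj z"
  by (simp only: complex_norm_square flip: of_real_power)

lemma norm_scale_complex: "norm (c *s u) = cmod c * norm (u::complex^'k)"
proof -
  have "complex_of_real ((norm (c *s u))\<^sup>2) = of_real ((cmod c * norm u)\<^sup>2)"
    unfolding herm_self[symmetric] herm_scale_left herm_scale_right
    by (simp add: herm_self power_mult_distrib of_real_cmod_power2 mult.commute[of "cnj c"] flip: mult.assoc)
  then show ?thesis by (simp add: power2_eq_iff_nonneg del: of_real_power)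
qed

text \<open>Pythagoras for the component of \<open>q\<close> orthogonal to the complex line of
  \<open>p\<close>. It is the exact defect in the Cauchy-Schwarz inequality: its sign gives
  \<open>herm_Cauchy_Schwarz\<close>, its positivity off that line gives
  \<open>overlap_lt_1\<close>.\<close>

lemma herm_projection:
  fixes p q :: "complex^'k"
  assumes "p \<noteq> 0"
  shows "(norm (q - (herm q p / of_real ((norm p)\<^sup>2)) *s p))\<^sup>2 * (norm p)\<^sup>2
    = (norm p)\<^sup>2 * (norm q)\<^sup>2 - (cmod (herm p q))\<^sup>2"
proof -
  define c where "c = - herm q p / of_real ((norm p)\<^sup>2)"
  have d: "q - (herm q p / of_real ((norm p)\<^sup>2)) *s p = q + c *s p"
    by (simp add: c_def vec_eq_iff)
  have c: "c * of_real ((norm p)\<^sup>2) = - herm q p"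
    using assms by (simp add: c_def)
  have r: "herm p (q + v) = herm p q + herm p v" "herm q (q + v) = herm q q + herm q v" for v
    by (simp_all add: herm_def ring_distribs sum.distrib)
  have "complex_of_real ((norm (q + c *s p))\<^sup>2 * (norm p)\<^sup>2)
      = herm (q + c *s p) (q + c *s p) * of_real ((norm p)\<^sup>2)"
    unfolding herm_self by (simp only: of_real_mult)
  also have "\<dots> = herm q q * of_real ((norm p)\<^sup>2) + c * of_real ((norm p)\<^sup>2) * herm p q
        + cnj (c * of_real ((norm p)\<^sup>2)) * herm q p
        + c * of_real ((norm p)\<^sup>2) * cnj (c * of_real ((norm p)\<^sup>2))"
    by (simp add: herm_add_left herm_scale_left herm_scale_right r herm_self[of p] algebra_simps power2_eq_square)
  also have "\<dots> = of_real ((norm p)\<^sup>2 * (norm q)\<^sup>2 - (cmod (herm p q))\<^sup>2)"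
    unfolding c by (simp add: herm_self herm_commute[of q p] of_real_cmod_power2 algebra_simps)
  finally show ?thesis unfolding d of_real_eq_iff .
qed

lemma herm_Cauchy_Schwarz: "cmod (herm p q) \<le> norm p * norm q"
proof (cases "p = 0")
  case False
  have "(cmod (herm p q))\<^sup>2 \<le> (norm p * norm q)\<^sup>2"
    using herm_projection[OF False, of q] by (simp add: power_mult_distrib) (metis diff_ge_0_iff_ge zero_le_mult_iff zero_le_power2)
  then show ?thesis by (simp add: power2_le_iff_abs_le)
qed (simp add: herm_def)

definition overlap :: "complex^'k \<Rightarrow> complex^'k \<Rightarrow> real" where
  "overlap p q = (cmod (herm p q) / (norm p * norm q))\<^sup>2"

lemma overlap_nonneg: "0 \<le> overlap p q"
  by (simp add: overlap_def)

lemma overlap_le_1: "overlap p q \<le> 1"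
proof -
  have "cmod (herm p q) / (norm p * norm q) \<le> 1"
    using herm_Cauchy_Schwarz[of p q] by (auto simp: divide_le_eq_1 zero_less_mult_iff)
  then show ?thesis unfolding overlap_def by (intro power_le_one) auto
qed

lemma overlap_commute: "overlap p q = overlap q p"
  by (simp add: overlap_def herm_commute[of p q] mult.commute)

lemma overlap_scale:
  "c \<noteq> 0 \<Longrightarrow> overlap (c *s p) q = overlap p q" "c \<noteq> 0 \<Longrightarrow> overlap p (c *s q) = overlap p q"
  by (simp_all add: overlap_def herm_scale_left herm_scale_right norm_mult norm_scale_complex)

lemma overlap_lt_1:
  assumes "(p, q) \<in> offdiag"
  shows "overlap p q < 1"
proof -
  have nz: "p \<noteq> 0" "q \<noteq> 0" "q - (herm q p / of_real ((norm p)\<^sup>2)) *s p \<noteq> 0"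
    using assms by (auto simp: offdiag_def)
  then have "(norm p)\<^sup>2 * (norm q)\<^sup>2 - (cmod (herm p q))\<^sup>2 > 0"
    unfolding herm_projection[OF nz(1), symmetric] by simp
  then show ?thesis using nz by (simp add: overlap_def power_divide power_mult_distrib)
qed

lemma overlap_eq_1D:
  assumes "p \<noteq> 0" "q \<noteq> 0" "overlap p q = 1"
  obtains c where "q = c *s p"
proof -
  have "(p, q) \<notin> offdiag" using overlap_lt_1 assms by force
  then show ?thesis using assms that by (auto simp: offdiag_def)
qed

text \<open>Equality in Cauchy-Schwarz characterizes proportional vectors. Written as a strict
  inequality between continuous functions, the domain of G is visibly open.\<close>

lemma offdiag_iff: "(p, q) \<in> offdiag \<longleftrightarrow> (cmod (herm p q))\<^sup>2 < (norm p)\<^sup>2 * (norm q)\<^sup>2"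
proof
  assume "(p, q) \<in> offdiag"
  moreover from this have "p \<noteq> 0" "q \<noteq> 0" by (auto simp: offdiag_def)
  ultimately show "(cmod (herm p q))\<^sup>2 < (norm p)\<^sup>2 * (norm q)\<^sup>2"
    using overlap_lt_1[of p q] by (simp add: overlap_def power_divide power_mult_distrib)
next
  assume "(cmod (herm p q))\<^sup>2 < (norm p)\<^sup>2 * (norm q)\<^sup>2"
  moreover have "(cmod (herm p (c *s p)))\<^sup>2 = (norm p)\<^sup>2 * (norm (c *s p))\<^sup>2" for c
    unfolding herm_scale_right norm_mult herm_self norm_scale_complex power_mult_distrib
    by (simp add: norm_power norm_mult power2_eq_square)
  ultimately show "(p, q) \<in> offdiag" by (auto simp: offdiag_def)
qed

lemma open_offdiag: "open (offdiag :: ((complex^'k) \<times> (complex^'k)) set)"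
proof -
  have "offdiag = {x :: (complex^'k) \<times> (complex^'k).
      (cmod (herm (fst x) (snd x)))\<^sup>2 < (norm (fst x))\<^sup>2 * (norm (snd x))\<^sup>2}"
    by (auto simp: offdiag_iff)
  also have "open \<dots>"
    unfolding herm_def by (intro open_Collect_less continuous_intros)
  finally show ?thesis .
qed

section \<open>The candidate as a function of the overlap\<close>

lemma sin_fs_dist: "sin (fs_dist \<xi> \<eta>) = sqrt (1 - overlap \<xi> \<eta>)"
proof -
  have "(herm \<xi> \<eta> * herm \<eta> \<xi>) / (herm \<xi> \<xi> * herm \<eta> \<eta>) = complex_of_real (overlap \<xi> \<eta>)"
    unfolding herm_self herm_commute[of \<eta> \<xi>] overlap_def power_divide of_real_divide complex_norm_square
    by (simp add: power_mult_distrib)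
  then have "fs_dist \<xi> \<eta> = arccos (sqrt (overlap \<xi> \<eta>))" by (simp add: fs_dist_def)
  moreover have "sqrt (overlap \<xi> \<eta>) \<le> 1" "-1 \<le> sqrt (overlap \<xi> \<eta>)"
    using overlap_le_1 overlap_nonneg[of \<xi> \<eta>] by (auto intro: order_trans[of _ 0])
  ultimately show ?thesis by (simp add: sin_arccos overlap_nonneg)
qed

text \<open>Here \<open>s\<close> is sin^2 r = 1 - t: the halved logarithm is ln (sin r), and the
  powers of \<open>s\<close> are the even powers of the sine.\<close>

definition green_profile :: "nat \<Rightarrow> real \<Rightarrow> real" where
  "green_profile n s = ln s / 2 - (\<Sum>j = 1..n - 1. 1 / (2 * real j * s ^ j))"

lemma green_profile_sin:
  "ln (sin (fs_dist \<xi> \<eta>)) - (\<Sum>j = 1..n - 1. 1 / (2 * real j * sin (fs_dist \<xi> \<eta>) ^ (2 * j)))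
   = green_profile n (1 - overlap \<xi> \<eta>)"
proof -
  have s: "0 \<le> 1 - overlap \<xi> \<eta>" using overlap_le_1 by simp
  \<comment> \<open>On the diagonal both sides are 0 because \<open>ln 0 = 0\<close>, so the
    translation to \<open>green_profile\<close> is an unconditional rewrite.\<close>
  then have "ln (sqrt (1 - overlap \<xi> \<eta>)) = ln (1 - overlap \<xi> \<eta>) / 2"
    by (cases "overlap \<xi> \<eta> = 1") (auto simp: ln_sqrt)
  with s show ?thesis by (simp add: green_profile_def sin_fs_dist power_mult)
qed

text \<open>In real coordinates |<p,q>|^2, |p|^2 and |q|^2 are polynomials in bounded linear
  functionals. So \<open>1 - overlap p q\<close> is rational with nonvanishing denominator, and
  positive off the diagonal; the closure rules for \<open>Ck\<close> do the rest.\<close>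

lemma Ck_green_profile_overlap:
  "Ck k offdiag (\<lambda>(p, q :: complex^'k). green_profile n (1 - overlap p q))"
proof -
  let ?S = "offdiag :: ((complex^'k) \<times> (complex^'k)) set"
  let ?h = "\<lambda>x::(complex^'k) \<times> (complex^'k).
    (\<Sum>k\<in>UNIV. Re (fst x $ k) * Re (snd x $ k) + Im (fst x $ k) * Im (snd x $ k))^2
    + (\<Sum>k\<in>UNIV. Im (fst x $ k) * Re (snd x $ k) - Re (fst x $ k) * Im (snd x $ k))^2"
  let ?P = "\<lambda>x::(complex^'k) \<times> (complex^'k). (\<Sum>k\<in>UNIV. (Re (fst x $ k))^2 + (Im (fst x $ k))^2)"
  let ?Q = "\<lambda>x::(complex^'k) \<times> (complex^'k). (\<Sum>k\<in>UNIV. (Re (snd x $ k))^2 + (Im (snd x $ k))^2)"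
  let ?s = "\<lambda>x. 1 - ?h x * inverse (?P x * ?Q x)"
  have h: "?h (p, q) = (cmod (herm p q))\<^sup>2" for p q
    by (simp add: cmod_power2 herm_def)
  have N: "(\<Sum>k\<in>UNIV. (Re (p $ k))^2 + (Im (p $ k))^2) = (norm p)\<^sup>2" for p :: "complex^'k"
    unfolding power2_norm_eq_inner by (simp add: inner_vec_def inner_complex_def power2_eq_square)
  have P: "?P (p, q) = (norm p)\<^sup>2" "?Q (p, q) = (norm q)\<^sup>2" for p q
    using N[of p] N[of q] by simp_all
  have s: "?s (p, q) = 1 - overlap p q" for p q
    unfolding h P by (simp add: overlap_def power_divide power_mult_distrib divide_inverse power_inverse)
  note S = open_offdiag[where 'k = 'k]
  have bl: "bounded_linear (\<lambda>x::(complex^'k) \<times> (complex^'k). Re (fst x $ i))"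
    "bounded_linear (\<lambda>x::(complex^'k) \<times> (complex^'k). Im (fst x $ i))"
    "bounded_linear (\<lambda>x::(complex^'k) \<times> (complex^'k). Re (snd x $ i))"
    "bounded_linear (\<lambda>x::(complex^'k) \<times> (complex^'k). Im (snd x $ i))" for i
    by (intro bounded_linear_intros bounded_linear_compose[OF bounded_linear_Re]
        bounded_linear_compose[OF bounded_linear_Im] bounded_linear_compose[OF bounded_linear_vec_nth])+
  note C = bl[THEN Ck_bounded_linear[OF S]]
  have nz: "?P x * ?Q x \<noteq> 0" if "x \<in> ?S" for x
    using that by (cases x) (use P in \<open>auto simp: offdiag_def\<close>)
  have pos: "?s x > 0" if "x \<in> ?S" for x
  proof (cases x)
    case (Pair p q)
    then show ?thesis using that overlap_lt_1[of p q] s[of p q] by simp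
  qed
  have Cs: "Ck k ?S ?s"
    by (intro Ck_diff Ck_mult Ck_const Ck_inverse Ck_add Ck_power Ck_sum C S nz)
  have nz': "2 * real j * ?s x ^ j \<noteq> 0" if "x \<in> ?S" "j \<in> {1..n-1}" for x j
    using pos[OF that(1)] that(2) by (simp only: mult_eq_0_iff power_eq_0_iff) simp
  have "Ck k ?S (\<lambda>x. (1/2) * ln (?s x) - (\<Sum>j = 1..n - 1. inverse (2 * real j * ?s x ^ j)))"
    by (intro Ck_diff Ck_cmult Ck_ln Ck_sum Ck_inverse Ck_power Cs S nz' pos)
  then show ?thesis
  proof (rule Ck_cong[OF S, rotated])
    fix x :: "(complex^'k) \<times> (complex^'k)"
    show "(1/2) * ln (?s x) - (\<Sum>j = 1..n - 1. inverse (2 * real j * ?s x ^ j))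
      = (case x of (p, q) \<Rightarrow> green_profile n (1 - overlap p q))"
      by (cases x) (simp only: s prod.case green_profile_def, simp add: inverse_eq_divide)
  qed
qed

section \<open>Scaling-invariant functions of class C2\<close>

lemma sum_Basis_complex_vec:
  "(\<Sum>b\<in>(Basis :: (complex^'k) set). g b) = (\<Sum>k\<in>UNIV. g (axis k 1) + g (axis k \<i>))"
proof -
  have eq: "(Basis :: (complex^'k) set) = (\<lambda>(k, u). axis k u) ` (UNIV \<times> {1, \<i>})"
    by (auto simp: Basis_vec_def Basis_complex_def)
  have inj: "inj_on (\<lambda>(k, u). axis k u :: complex^'k) (UNIV \<times> {1, \<i>})"
    by (auto simp: inj_on_def axis_eq_axis)
  have "(\<Sum>b\<in>(Basis :: (complex^'k) set). g b) = (\<Sum>(k, u)\<in>UNIV \<times> {1, \<i>}. g (axis k u))"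
    unfolding eq by (subst sum.reindex[OF inj]) (simp add: case_prod_unfold)
  also have "\<dots> = (\<Sum>k\<in>UNIV. \<Sum>u\<in>{1, \<i>}. g (axis k u))"
    by (simp only: sum.cartesian_product)
  finally show ?thesis by simp
qed

lemma bounded_linear_scale_complex: "bounded_linear (\<lambda>v. c *s (v :: complex^'k))"
  by (rule linear_conv_bounded_linear[THEN iffD1])
    (auto intro!: linearI simp: vec_eq_iff algebra_simps)

lemma scale_complex_nz: "c \<noteq> 0 \<Longrightarrow> \<xi> \<noteq> 0 \<Longrightarrow> c *s (\<xi> :: complex^'k) \<noteq> 0"
  by (metis norm_eq_zero norm_scale_complex no_zero_divisors)

text \<open>The derivatives are parameters, so that both arbitrary \<open>fs_C2\<close> functions
  and functions of the overlap with their explicit formulas are instances. In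
  \<open>H \<xi> v w\<close> the derivative along \<open>v\<close> is taken first and
  \<open>w\<close> is the direction of the second differentiation.\<close>

locale projective_C2 =
  fixes f :: "complex^'k \<Rightarrow> real" and D :: "complex^'k \<Rightarrow> complex^'k \<Rightarrow> real"
    and H :: "complex^'k \<Rightarrow> complex^'k \<Rightarrow> complex^'k \<Rightarrow> real"
  assumes invariant: "\<lbrakk>\<xi> \<noteq> 0; c \<noteq> 0\<rbrakk> \<Longrightarrow> f (c *s \<xi>) = f \<xi>"
    and deriv: "\<xi> \<noteq> 0 \<Longrightarrow> (f has_derivative D \<xi>) (at \<xi>)"
    and deriv2: "\<xi> \<noteq> 0 \<Longrightarrow> ((\<lambda>\<eta>. D \<eta> v) has_derivative H \<xi> v) (at \<xi>)"
    and cont2: "continuous_on (- {0}) (\<lambda>\<xi>. H \<xi> v w)"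
begin

lemma linear_D: "\<xi> \<noteq> 0 \<Longrightarrow> linear (D \<xi>)"
  using deriv has_derivative_linear by blast

lemma linear_H: "\<xi> \<noteq> 0 \<Longrightarrow> linear (H \<xi> v)"
  using deriv2 has_derivative_linear by blast

text \<open>Linearity in \<open>w\<close> comes with \<open>has_derivative\<close>; linearity in
  \<open>v\<close> is inherited from \<open>D\<close> at all points near \<open>\<xi>\<close>, by
  uniqueness of the derivative.\<close>

lemma linear_H': 
  assumes "\<xi> \<noteq> 0" shows "linear (\<lambda>v. H \<xi> v w)"
proof (rule linearI)
  have ev: "\<forall>\<^sub>F \<eta> in nhds \<xi>. \<eta> \<noteq> 0" using assms by (rule t1_space_nhds)
  show "H \<xi> (u + v) w = H \<xi> u w + H \<xi> v w" for u v
  proof -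
    have "((\<lambda>\<eta>. D \<eta> u + D \<eta> v) has_derivative (\<lambda>w. H \<xi> u w + H \<xi> v w)) (at \<xi>)"
      using assms by (intro has_derivative_add deriv2)
    then have "((\<lambda>\<eta>. D \<eta> (u + v)) has_derivative (\<lambda>w. H \<xi> u w + H \<xi> v w)) (at \<xi>)"
      by (rule has_derivative_transform_within_open[where s = "- {0}"])
        (use assms in \<open>auto simp: linear_add linear_D\<close>)
    from fun_cong[OF has_derivative_unique[OF this deriv2[OF assms]], of w] show ?thesis by simp
  qed
  show "H \<xi> (r *\<^sub>R v) w = r *\<^sub>R H \<xi> v w" for r v
  proof -
    have "((\<lambda>\<eta>. r *\<^sub>R D \<eta> v) has_derivative (\<lambda>w. r *\<^sub>R H \<xi> v w)) (at \<xi>)"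
      using assms by (intro has_derivative_scaleR_right deriv2)
    then have "((\<lambda>\<eta>. D \<eta> (r *\<^sub>R v)) has_derivative (\<lambda>w. r *\<^sub>R H \<xi> v w)) (at \<xi>)"
      by (rule has_derivative_transform_within_open[where s = "- {0}"])
        (use assms in \<open>auto simp: linear_scale linear_D\<close>)
    from fun_cong[OF has_derivative_unique[OF this deriv2[OF assms]], of w] show ?thesis by simp
  qed
qed

lemma D_scale:
  assumes "\<xi> \<noteq> 0" "c \<noteq> 0" shows "D (c *s \<xi>) (c *s v) = D \<xi> v"
proof -
  have "((\<lambda>\<eta>. f (c *s \<eta>)) has_derivative (\<lambda>v. D (c *s \<xi>) (c *s v))) (at \<xi>)"
    by (rule has_derivative_compose[OF bounded_linear_imp_has_derivative[OF bounded_linear_scale_complex]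
        deriv[OF scale_complex_nz[OF assms(2,1)]]])
  then have "(f has_derivative (\<lambda>v. D (c *s \<xi>) (c *s v))) (at \<xi>)"
    by (rule has_derivative_transform_within_open[where s = "- {0}"]) (use assms invariant in auto)
  from fun_cong[OF has_derivative_unique[OF this deriv[OF assms(1)]], of v] show ?thesis by simp
qed

lemma H_scale:
  assumes "\<xi> \<noteq> 0" "c \<noteq> 0" shows "H (c *s \<xi>) (c *s v) (c *s w) = H \<xi> v w"
proof -
  have "((\<lambda>\<eta>. D (c *s \<eta>) (c *s v)) has_derivative (\<lambda>w. H (c *s \<xi>) (c *s v) (c *s w))) (at \<xi>)"
    by (rule has_derivative_compose[OF bounded_linear_imp_has_derivative[OF bounded_linear_scale_complex]
        deriv2[OF scale_complex_nz[OF assms(2,1)]]])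
  then have "((\<lambda>\<eta>. D \<eta> v) has_derivative (\<lambda>w. H (c *s \<xi>) (c *s v) (c *s w))) (at \<xi>)"
    by (rule has_derivative_transform_within_open[where s = "- {0}"]) (use assms D_scale in auto)
  from fun_cong[OF has_derivative_unique[OF this deriv2[OF assms(1)]], of w] show ?thesis by simp
qed

text \<open>\<open>f\<close> is constant along the curve (1 + t c) xi, which stays on the complex
  line of xi and avoids the origin for small t.\<close>

lemma D_radial:
  assumes "\<xi> \<noteq> 0" shows "D \<xi> (c *s \<xi>) = 0"
proof -
  let ?\<gamma> = "\<lambda>t. (1 + of_real t * c) *s \<xi>"
  have \<gamma>: "?\<gamma> t = \<xi> + t *\<^sub>R (c *s \<xi>)" for t
    by (simp add: vec_eq_iff algebra_simps scaleR_conv_of_real[where 'a = complex])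
  have d: "((\<lambda>t. \<xi> + t *\<^sub>R (c *s \<xi>)) has_derivative (\<lambda>t. t *\<^sub>R (c *s \<xi>))) (at 0)"
    by (auto intro!: derivative_eq_intros)
  have A: "((\<lambda>t. f (\<xi> + t *\<^sub>R (c *s \<xi>))) has_derivative (\<lambda>t. D \<xi> (t *\<^sub>R (c *s \<xi>)))) (at 0)"
    using has_derivative_compose[OF d, of f "D \<xi>"] deriv[OF assms] by simp
  have "((\<lambda>t::real. f \<xi>) has_derivative (\<lambda>t. D \<xi> (t *\<^sub>R (c *s \<xi>)))) (at 0)"
  proof -
    have "open {t::real. 1 + of_real t * c \<noteq> 0}"
      by (intro open_Collect_neq continuous_intros)
    moreover have "f (\<xi> + t *\<^sub>R (c *s \<xi>)) = f \<xi>" if "1 + of_real t * c \<noteq> 0" for t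
      using invariant[OF assms that] unfolding \<gamma> .
    ultimately show ?thesis using A
      by (elim has_derivative_transform_within_open) auto
  qed
  then have "(\<lambda>t. D \<xi> (t *\<^sub>R (c *s \<xi>))) = (\<lambda>t. 0)"
    using has_derivative_unique[OF _ has_derivative_const] by blast
  from fun_cong[OF this, of 1] show ?thesis by simp
qed

text \<open>Differentiating the homogeneity relations \<open>D \<xi> (c *s \<xi>) = 0\<close> and
  \<open>D (c *s \<xi>) (c *s v) = D \<xi> v\<close> gives both slots of \<open>H\<close> in radial directions;
  this replaces the symmetry of second derivatives.\<close>

lemma H_radial_left:
  assumes "\<xi> \<noteq> 0" shows "H \<xi> (c *s \<xi>) v = - D \<xi> (c *s v)"
proof -
  have d: "((\<lambda>t. \<xi> + t *\<^sub>R v) has_derivative (\<lambda>t. t *\<^sub>R v)) (at 0)"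
    by (auto intro!: derivative_eq_intros)
  have 1: "((\<lambda>t. D (\<xi> + t *\<^sub>R v) w) has_derivative (\<lambda>t. H \<xi> w (t *\<^sub>R v))) (at 0)" for w
    using has_derivative_compose[OF d, of "\<lambda>\<eta>. D \<eta> w"] deriv2[OF assms] by simp
  have A: "((\<lambda>t. D (\<xi> + t *\<^sub>R v) (c *s \<xi>) + t * D (\<xi> + t *\<^sub>R v) (c *s v)) has_derivative
      (\<lambda>t. H \<xi> (c *s \<xi>) (t *\<^sub>R v) + t * D \<xi> (c *s v))) (at 0)"
    by (rule derivative_eq_intros 1 refl)+ simp
  have "((\<lambda>t::real. 0::real) has_derivative (\<lambda>t. H \<xi> (c *s \<xi>) (t *\<^sub>R v) + t * D \<xi> (c *s v))) (at 0)"
  proof -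
    have "open {t::real. \<xi> + t *\<^sub>R v \<noteq> 0}"
      by (intro open_Collect_neq continuous_intros)
    moreover have "D (\<xi> + t *\<^sub>R v) (c *s \<xi>) + t * D (\<xi> + t *\<^sub>R v) (c *s v) = 0" if "\<xi> + t *\<^sub>R v \<noteq> 0" for t
    proof -
      have "c *s (\<xi> + t *\<^sub>R v) = c *s \<xi> + t *\<^sub>R (c *s v)"
        by (simp add: vec_eq_iff algebra_simps)
      then show ?thesis using D_radial[OF that, of c] linear_D[OF that]
        by (simp add: linear_add linear_scale)
    qed
    ultimately show ?thesis using A assms
      by (elim has_derivative_transform_within_open) auto
  qed
  then have "(\<lambda>t. H \<xi> (c *s \<xi>) (t *\<^sub>R v) + t * D \<xi> (c *s v)) = (\<lambda>t. 0)"
    using has_derivative_unique[OF _ has_derivative_const] by blast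
  from fun_cong[OF this, of 1] show ?thesis by simp
qed

lemma H_radial_right:
  assumes "\<xi> \<noteq> 0" shows "H \<xi> v (c *s \<xi>) = - D \<xi> (c *s v)"
proof -
  let ?z = "\<lambda>t. 1 + of_real t * c"
  have z: "?z t *s v = v + t *\<^sub>R (c *s v)" for t and v :: "complex^'k"
    by (simp add: vec_eq_iff algebra_simps scaleR_conv_of_real[where 'a = complex])
  have d: "((\<lambda>t. \<xi> + t *\<^sub>R (c *s \<xi>)) has_derivative (\<lambda>t. t *\<^sub>R (c *s \<xi>))) (at 0)"
    by (auto intro!: derivative_eq_intros)
  have 1: "((\<lambda>t. D (\<xi> + t *\<^sub>R (c *s \<xi>)) w) has_derivative (\<lambda>t. H \<xi> w (t *\<^sub>R (c *s \<xi>)))) (at 0)" for w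
    using has_derivative_compose[OF d, of "\<lambda>\<eta>. D \<eta> w"] deriv2[OF assms] by simp
  have A: "((\<lambda>t. D (\<xi> + t *\<^sub>R (c *s \<xi>)) v + t * D (\<xi> + t *\<^sub>R (c *s \<xi>)) (c *s v)) has_derivative
      (\<lambda>t. H \<xi> v (t *\<^sub>R (c *s \<xi>)) + t * D \<xi> (c *s v))) (at 0)"
    by (rule derivative_eq_intros 1 refl)+ simp
  have "((\<lambda>t::real. D \<xi> v) has_derivative (\<lambda>t. H \<xi> v (t *\<^sub>R (c *s \<xi>)) + t * D \<xi> (c *s v))) (at 0)"
  proof -
    have "open {t::real. ?z t \<noteq> 0}"
      by (intro open_Collect_neq continuous_intros)
    moreover have "D (\<xi> + t *\<^sub>R (c *s \<xi>)) v + t * D (\<xi> + t *\<^sub>R (c *s \<xi>)) (c *s v) = D \<xi> v" if "?z t \<noteq> 0" for t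
    proof -
      have "?z t *s \<xi> \<noteq> 0" using that assms by (rule scale_complex_nz)
      then have "D (?z t *s \<xi>) (?z t *s v) = D (?z t *s \<xi>) v + t * D (?z t *s \<xi>) (c *s v)"
        unfolding z[of _ v] using linear_D by (simp add: linear_add linear_scale)
      then show ?thesis using D_scale[OF assms that, of v] by (simp only: z)
    qed
    ultimately show ?thesis using A
      by (elim has_derivative_transform_within_open) auto
  qed
  then have "(\<lambda>t. H \<xi> v (t *\<^sub>R (c *s \<xi>)) + t * D \<xi> (c *s v)) = (\<lambda>t. 0)"
    using has_derivative_unique[OF _ has_derivative_const] by blast
  from fun_cong[OF this, of 1] show ?thesis by simp
qed

text \<open>The Fubini-Study length of a vector orthogonal to the complex line of xi is its
  Euclidean length divided by |xi|, whence the factor. The directions xi and i xi add nothing to the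
  trace, so the full Euclidean trace can be used. The sign is opposite to that of
  \<open>fs_laplacian\<close>.\<close>

definition lap :: "complex^'k \<Rightarrow> real" where
  "lap \<xi> = (norm \<xi>)\<^sup>2 * (\<Sum>b\<in>Basis. H \<xi> b b)"

text \<open>Multiplication by \<open>c\<close> acts on each plane spanned by \<open>axis k 1\<close>
  and \<open>axis k \<i>\<close> as a rotation times |c|. In the trace over the plane the mixed
  terms cancel, and the factor |c|^2 is absorbed by the squared norm.\<close>

lemma lap_scale:
  assumes "\<xi> \<noteq> 0" "c \<noteq> 0" shows "lap (c *s \<xi>) = lap \<xi>"
proof -
  let ?\<eta> = "c *s \<xi>"
  have nz: "?\<eta> \<noteq> 0" using assms by (simp add: scale_complex_nz)
  note L = linear_H[OF nz] linear_H'[OF nz]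
  have "H \<xi> (axis k 1) (axis k 1) + H \<xi> (axis k \<i>) (axis k \<i>)
      = (cmod c)\<^sup>2 * (H ?\<eta> (axis k 1) (axis k 1) + H ?\<eta> (axis k \<i>) (axis k \<i>))" for k
  proof -
    have a: "c *s axis k 1 = Re c *\<^sub>R axis k 1 + Im c *\<^sub>R axis k \<i>"
      "c *s axis k \<i> = (- Im c) *\<^sub>R axis k 1 + Re c *\<^sub>R axis k \<i>" for k :: 'k
      by (auto simp: vec_eq_iff axis_def complex_eq_iff)
    have b: "H ?\<eta> (r *\<^sub>R u + s *\<^sub>R v) (r *\<^sub>R u + s *\<^sub>R v) =
       r * r * H ?\<eta> u u + r * s * (H ?\<eta> u v + H ?\<eta> v u) + s * s * H ?\<eta> v v" for r s u v
      by (simp add: L[THEN linear_add] L[THEN linear_scale] algebra_simps)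
    show ?thesis
      unfolding H_scale[OF assms, symmetric] a b cmod_power2 by (simp add: algebra_simps power2_eq_square)
  qed
  then show ?thesis
    unfolding lap_def norm_scale_complex power_mult_distrib sum_Basis_complex_vec
    by (simp add: sum_distrib_left mult_ac)
qed

lemma continuous_on_D: "continuous_on (- {0}) (\<lambda>\<xi>. D \<xi> v)"
  by (intro continuous_at_imp_continuous_on) (use deriv2 has_derivative_continuous in blast)

lemma continuous_on_f: "continuous_on (- {0}) f"
  by (intro continuous_at_imp_continuous_on) (use deriv has_derivative_continuous in blast)

lemma continuous_on_lap: "continuous_on (- {0}) lap"
  unfolding lap_def by (intro continuous_intros cont2)

end

lemma projective_C2_frechet:
  assumes "fs_C2 f"
  shows "projective_C2 f (\<lambda>\<xi>. frechet_derivative f (at \<xi>))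
     (\<lambda>\<xi> v. frechet_derivative (\<lambda>\<eta>. frechet_derivative f (at \<eta>) v) (at \<xi>))"
proof
  have S: "open {\<xi>::complex^'a. \<xi> \<noteq> 0}" "{\<xi>::complex^'a. \<xi> \<noteq> 0} = - {0}"
    by (auto simp: open_delete Collect_neg_eq)
  have c: "Ck (Suc (Suc 0)) {\<xi>. \<xi> \<noteq> 0} f" using assms by (simp add: fs_C2_def numeral_2_eq_2)
  then have c': "Ck (Suc 0) {\<xi>. \<xi> \<noteq> 0} (\<lambda>\<eta>. frechet_derivative f (at \<eta>) v)" for v by simp
  show "f (c *s \<xi>) = f \<xi>" if "\<xi> \<noteq> 0" "c \<noteq> 0" for \<xi> c
    using assms that by (simp add: fs_C2_def)
  show "(f has_derivative frechet_derivative f (at \<xi>)) (at \<xi>)" if "\<xi> \<noteq> 0" for \<xi>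
    using Ck_SucD[OF S(1) c] that by simp
  show "((\<lambda>\<eta>. frechet_derivative f (at \<eta>) v) has_derivative
      frechet_derivative (\<lambda>\<eta>. frechet_derivative f (at \<eta>) v) (at \<xi>)) (at \<xi>)" if "\<xi> \<noteq> 0" for \<xi> v
    using Ck_SucD[OF S(1) c'] that by simp
  show "continuous_on (- {0}) (\<lambda>\<xi>. frechet_derivative (\<lambda>\<eta>. frechet_derivative f (at \<eta>) v) (at \<xi>) w)" for v w
    using c'[of v] unfolding S(2) by simp
qed

section \<open>The Fubini--Study metric in the affine chart\<close>

text \<open>Multiplication by i in the real coordinates of \<open>ccoord\<close>, where
  \<open>True\<close> marks real parts and \<open>False\<close> imaginary parts.\<close>

definition rot :: "real^('n::finite \<times> bool) \<Rightarrow> real^('n \<times> bool)" where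
  "rot x = (\<chi> i. if snd i then - x $ (fst i, False) else x $ (fst i, True))"

lemma sum_UNIV_prod_bool:
  "(\<Sum>i\<in>(UNIV :: ('n::finite \<times> bool) set). g i) = (\<Sum>a\<in>UNIV. g (a, True) + g (a, False))"
proof -
  have "(\<Sum>i\<in>(UNIV :: ('n \<times> bool) set). g i) = (\<Sum>a\<in>UNIV. \<Sum>b\<in>UNIV. g (a, b))"
    by (simp add: sum.cartesian_product flip: UNIV_Times_UNIV)
  then show ?thesis by (simp add: UNIV_bool add.commute)
qed

lemma linear_rot: "linear rot"
  by (rule linearI) (auto simp: rot_def vec_eq_iff)

lemma rot_rot: "rot (rot x) = - x"
  by (auto simp: rot_def vec_eq_iff)

lemma inner_rot_self: "x \<bullet> rot x = 0"
  by (simp add: inner_vec_def sum_UNIV_prod_bool rot_def)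

lemma inner_rot_rot: "rot x \<bullet> rot y = x \<bullet> y"
  by (simp add: inner_vec_def sum_UNIV_prod_bool rot_def add.commute)

lemma norm_rot: "norm (rot x) = norm x"
  by (simp add: norm_eq_sqrt_inner inner_rot_rot)

lemma herm_ccoord_self: "herm (ccoord x) (ccoord x) = of_real ((norm x)\<^sup>2)"
proof -
  have "(norm (ccoord x))\<^sup>2 = (norm x)\<^sup>2"
    unfolding power2_norm_eq_inner
    by (simp add: inner_vec_def sum_UNIV_prod_bool ccoord_def inner_complex_def)
  then show ?thesis by (simp only: herm_self)
qed

lemma herm_cdir: "herm (cdir i) (ccoord x) = Complex (x $ i) (rot x $ i)"
proof -
  obtain a b where i: "i = (a, b)" by fastforce
  have "herm (cdir i) (ccoord x) = (if b then 1 else \<i>) * cnj (ccoord x $ a)"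
    by (simp add: herm_def cdir_def i if_distrib[of "\<lambda>u. u * _"] cong: if_cong)
  then show ?thesis by (simp add: i ccoord_def rot_def complex_eq_iff)
qed

lemma Re_herm_cdir_cdir: "Re (herm (cdir i) (cdir j)) = (if i = j then 1 else 0)"
proof -
  obtain a b c d where ij: "i = (a, b)" "j = (c, d)" by fastforce
  have "herm (cdir i) (cdir j) = (if b then 1 else \<i>) * cnj (cdir j $ a)"
    by (simp add: herm_def cdir_def[of "(a, b)"] ij(1) if_distrib[of "\<lambda>u. u * _"] cong: if_cong)
  then show ?thesis by (simp add: ij cdir_def)
qed

lemma fs_metric_nth:
  fixes x :: "real^('n::finite \<times> bool)"
  defines "s \<equiv> 1 + (norm x)\<^sup>2"
  shows "fs_metric x $ i $ j = (if i = j then 1 else 0) / s - (x $ i * x $ j + rot x $ i * rot x $ j) / s\<^sup>2"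
proof -
  have "Re (herm (cdir i) (ccoord x) * herm (ccoord x) (cdir j)) = x $ i * x $ j + rot x $ i * rot x $ j"
    by (simp add: herm_commute[of "ccoord x" "cdir j"] herm_cdir)
  then show ?thesis
    unfolding fs_metric_def Let_def herm_ccoord_self
    by (simp add: s_def[symmetric] Re_herm_cdir_cdir del: times_complex.sel flip: of_real_power)
qed

text \<open>With s = 1 + |x|^2, the metric is 1/s^2 on the real plane of \<open>x\<close> and
  \<open>rot x\<close> and 1/s on its orthogonal complement. The inverse must therefore be s^2 = s
  (1 + |x|^2) on that plane and s elsewhere.\<close>

definition fs_cometric :: "real^('n::finite \<times> bool) \<Rightarrow> real^('n \<times> bool)^('n \<times> bool)" where
  "fs_cometric x = (\<chi> i j. (1 + (norm x)\<^sup>2) * ((if i = j then 1 else 0) + x $ i * x $ j + rot x $ i * rot x $ j))"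

lemma matrix_inv_fs_metric: "matrix_inv (fs_metric x) = fs_cometric x"
proof -
  define s where "s = 1 + (norm x)\<^sup>2"
  have s: "s > 0" by (simp add: s_def add_pos_nonneg)
  have xx: "(\<Sum>k\<in>UNIV. x $ k * x $ k) = s - 1" "(\<Sum>k\<in>UNIV. rot x $ k * rot x $ k) = s - 1"
    "(\<Sum>k\<in>UNIV. x $ k * rot x $ k) = 0" "(\<Sum>k\<in>UNIV. rot x $ k * x $ k) = 0"
    using inner_rot_self[of x] inner_rot_rot[of x x]
    by (simp_all add: s_def power2_norm_eq_inner inner_vec_def mult.commute)
  have "fs_metric x ** fs_cometric x = mat 1"
  proof -
    have "(\<Sum>k\<in>UNIV. fs_metric x $ i $ k * fs_cometric x $ k $ j) = (if i = j then 1 else 0)" for i j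
    proof -
      let ?d = "\<lambda>i j. if i = j then 1 else 0 :: real"
      have "fs_metric x $ i $ k * fs_cometric x $ k $ j =
        ?d i k * ?d k j + ?d i k * x $ k * x $ j + ?d i k * rot x $ k * rot x $ j
        - (x $ i * x $ k * ?d k j + rot x $ i * rot x $ k * ?d k j
        + x $ i * x $ j * (x $ k * x $ k) + x $ i * rot x $ j * (x $ k * rot x $ k)
        + rot x $ i * x $ j * (rot x $ k * x $ k) + rot x $ i * rot x $ j * (rot x $ k * rot x $ k)) / s" for k
        using s unfolding fs_metric_nth fs_cometric_def s_def[symmetric]
        by (simp add: field_simps power2_eq_square)
      then have "(\<Sum>k\<in>UNIV. fs_metric x $ i $ k * fs_cometric x $ k $ j)
        = ?d i j + x $ i * x $ j + rot x $ i * rot x $ j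
        - (x $ i * x $ j + rot x $ i * rot x $ j
        + x $ i * x $ j * (s - 1) + rot x $ i * rot x $ j * (s - 1)) / s"
        by (simp add: sum.distrib sum_subtractf sum_divide_distrib[symmetric] sum_distrib_left[symmetric] xx
            if_distrib[of "\<lambda>u. u * _"] if_distrib[of "\<lambda>u. _ * u"] cong: if_cong)
      also have "\<dots> = ?d i j" using s by (simp add: field_simps)
      finally show ?thesis .
    qed
    then show ?thesis by (simp add: matrix_matrix_mult_def mat_def vec_eq_iff)
  qed
  then have AB: "fs_metric x ** fs_cometric x = mat 1" "fs_cometric x ** fs_metric x = mat 1"
    using matrix_left_right_inverse by blast+
  then have "fs_metric x ** matrix_inv (fs_metric x) = mat 1"
    unfolding matrix_inv_def
    by (rule someI2[where P = "\<lambda>A. fs_metric x ** A = mat 1 \<and> A ** fs_metric x = mat 1", OF conjI]) auto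
  then have "fs_cometric x ** (fs_metric x ** matrix_inv (fs_metric x)) = fs_cometric x" by simp
  then show ?thesis unfolding matrix_mul_assoc AB by simp
qed

text \<open>An orthogonal map taking \<open>v\<close> to a coordinate axis conjugates this rank-one
  perturbation of the identity to a diagonal matrix with a single nontrivial entry.\<close>

lemma det_rank_one:
  fixes v :: "real^'m"
  shows "det (\<chi> i j. (if i = j then 1 else 0) - a * (v $ i * v $ j)) = 1 - a * (norm v)\<^sup>2"
proof -
  obtain k :: 'm where True by simp
  have "norm v *\<^sub>R axis k 1 = (axis k (norm v) :: real^'m)"
    by (simp add: axis_def vec_eq_iff)
  then have "norm v = norm (axis k (norm v) :: real^'m)"
    by (metis norm_axis_1 norm_scaleR abs_norm_cancel mult.right_neutral)
  then obtain f where f: "orthogonal_transformation f" "f v = axis k (norm v)"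
    using orthogonal_transformation_exists by blast
  define R where "R = matrix f"
  have R: "orthogonal_matrix R" using f(1) unfolding R_def by (simp add: orthogonal_transformation_matrix)
  then have RR: "R ** transpose R = mat 1" by (simp add: orthogonal_matrix_def)
  have Rv: "R *v v = axis k (norm v)"
    using f unfolding R_def by (simp add: matrix_works orthogonal_transformation_linear)
  let ?M = "(\<chi> i j. (if i = j then 1 else 0) - a * (v $ i * v $ j)) :: real^'m^'m"
  let ?N = "(\<chi> i j. (if i = j then 1 else 0) - a * ((R *v v) $ i * (R *v v) $ j)) :: real^'m^'m"
  have M: "(\<chi> i j. (if i = j then 1 else 0) - a * (u $ i * u $ j)) *v w = w - (a * (u \<bullet> w)) *\<^sub>R u"
    for u w :: "real^'m"
  proof -
    have "(\<Sum>j\<in>UNIV. ((if i = j then 1 else 0) - a * (u $ i * u $ j)) * w $ j) = w $ i - a * (u \<bullet> w) * u $ i" for i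
    proof -
      have "((if i = j then 1 else 0) - a * (u $ i * u $ j)) * w $ j
          = (if i = j then w $ j else 0) - (a * u $ i) * (u $ j * w $ j)" for j
        by (simp add: algebra_simps)
      then show ?thesis
        by (simp only: sum_subtractf sum_distrib_left[symmetric]) (simp add: inner_vec_def)
    qed
    then show ?thesis by (simp add: vec_eq_iff matrix_vector_mult_def)
  qed
  have "R ** ?M = ?N ** R"
  proof (rule matrix_eq[THEN iffD2, rule_format])
    fix w
    have "(R *v v) \<bullet> (R *v w) = v \<bullet> w"
      using f(1) unfolding R_def by (simp add: orthogonal_transformation_def matrix_works)
    then show "(R ** ?M) *v w = (?N ** R) *v w"
      unfolding matrix_vector_mul_assoc[symmetric] M
      by (simp add: matrix_vector_mult_diff_distrib matrix_vector_mult_scaleR)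
  qed
  from arg_cong[OF this, of det] have "det R * det ?M = det ?N * det R" by (simp only: det_mul)
  moreover have "det R \<noteq> 0" using det_orthogonal_matrix[OF R] by auto
  moreover have "det ?N = (\<Prod>i\<in>UNIV. ?N $ i $ i)"
    unfolding Rv by (rule det_diagonal) (auto simp: axis_def)
  moreover have "\<dots> = (\<Prod>i\<in>UNIV. if i = k then 1 - a * (norm v)\<^sup>2 else 1)"
    unfolding Rv by (rule prod.cong) (auto simp: axis_def power2_eq_square)
  ultimately show ?thesis by simp
qed

text \<open>Since \<open>x\<close> and \<open>rot x\<close> are orthogonal, s times the metric
  factors into two rank-one perturbations, each of determinant 1 - |x|^2/s = 1/s. The scalar 1/s in
  real dimension 2n contributes s^(-2n), and the square root of the product is s^(-n-1).\<close>

lemma vol_density_eq: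
  fixes x :: "real^('n::finite \<times> bool)"
  shows "vol_density x = 1 / (1 + (norm x)\<^sup>2) ^ Suc (CARD('n))"
proof -
  define s where "s = 1 + (norm x)\<^sup>2"
  have s: "s > 0" by (simp add: s_def add_pos_nonneg)
  let ?A = "\<lambda>v::real^('n \<times> bool). (\<chi> i j. (if i = j then 1 else 0) - (1 / s) * (v $ i * v $ j)) :: real^('n \<times> bool)^('n \<times> bool)"
  have "(\<Sum>k\<in>UNIV. ?A x $ i $ k * ?A (rot x) $ k $ j) = s * fs_metric x $ i $ j" for i j
  proof -
    have "?A x $ i $ k * ?A (rot x) $ k $ j = (if i = k then 1 else 0) * (if k = j then 1 else 0)
      - (if i = k then 1 else 0) * (1/s) * (rot x $ k * rot x $ j)
      - (if k = j then 1 else 0) * (1/s) * (x $ i * x $ k) + (x $ i * rot x $ j / s\<^sup>2) * (x $ k * rot x $ k)" for k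
      by (simp add: algebra_simps power2_eq_square)
    moreover have "(\<Sum>k\<in>UNIV. x $ k * rot x $ k) = 0"
      using inner_rot_self[of x] by (simp add: inner_vec_def)
    ultimately have "(\<Sum>k\<in>UNIV. ?A x $ i $ k * ?A (rot x) $ k $ j)
       = (if i = j then 1 else 0) - (1/s) * (rot x $ i * rot x $ j) - (1/s) * (x $ i * x $ j)"
      by (simp add: sum.distrib sum_subtractf sum_distrib_left[symmetric] sum_divide_distrib[symmetric]
          if_distrib[of "\<lambda>u. u * _"] if_distrib[of "\<lambda>u. _ * u"] cong: if_cong)
    also have "\<dots> = s * fs_metric x $ i $ j"
      using s unfolding fs_metric_nth s_def[symmetric] by (simp add: field_simps power2_eq_square)
    finally show ?thesis .
  qed
  then have "fs_metric x = mat (1 / s) ** (?A x ** ?A (rot x))"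
    using s by (simp add: vec_eq_iff matrix_matrix_mult_def mat_def if_distrib[of "\<lambda>u. u * _"] cong: if_cong)
  then have "det (fs_metric x) = det (mat (1 / s) :: real^('n \<times> bool)^('n \<times> bool)) * (det (?A x) * det (?A (rot x)))"
    by (simp only: det_mul)
  also have "det (mat (1 / s) :: real^('n \<times> bool)^('n \<times> bool)) = (1 / s) ^ (2 * CARD('n))"
    by (subst det_diagonal) (simp_all add: mat_def mult.commute)
  also have "det (?A x) * det (?A (rot x)) = (1 / s)\<^sup>2"
    unfolding det_rank_one norm_rot using s by (simp add: s_def field_simps power2_eq_square)
  also have "(1 / s) ^ (2 * CARD('n)) * (1 / s)\<^sup>2 = (1 / s ^ Suc (CARD('n)))\<^sup>2"
    by (simp add: power_mult power_divide power2_eq_square power_mult_distrib)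
  finally show ?thesis using s by (simp add: vol_density_def s_def)
qed

section \<open>The Laplacian in the affine chart\<close>

definition chart_lin :: "real^('n::finite \<times> bool) \<Rightarrow> complex^('n option)" where
  "chart_lin x = (\<chi> k. case k of None \<Rightarrow> 0 | Some a \<Rightarrow> ccoord x $ a)"

lemma chart_eq: "chart x = axis None 1 + chart_lin x"
  by (auto simp: chart_def chart_lin_def vec_eq_iff axis_def split: option.split)

lemma linear_chart_lin: "linear chart_lin"
  by (rule linearI) (auto simp: chart_lin_def ccoord_def vec_eq_iff complex_eq_iff split: option.split)

lemma chart_lin_rot: "chart_lin (rot x) = \<i> *s chart_lin x"
  by (auto simp: chart_lin_def ccoord_def rot_def vec_eq_iff complex_eq_iff split: option.split)

lemma chart_lin_axis:
  "chart_lin (axis (a, True) 1) = axis (Some a) 1" "chart_lin (axis (a, False) 1) = axis (Some a) \<i>"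
  by (auto simp: chart_lin_def ccoord_def vec_eq_iff axis_def complex_eq_iff split: option.split)

lemma sum_UNIV_option: "(\<Sum>k\<in>(UNIV :: 'n::finite option set). g k) = g None + (\<Sum>a\<in>UNIV. g (Some a))"
  by (simp add: UNIV_option_conv sum.reindex)

lemma norm_chart: "(norm (chart x))\<^sup>2 = 1 + (norm x)\<^sup>2"
  unfolding power2_norm_eq_inner
  by (simp add: inner_vec_def sum_UNIV_option chart_def sum_UNIV_prod_bool ccoord_def inner_complex_def)

lemma chart_nonzero: "chart x \<noteq> 0"
  using norm_chart[of x] by (metis norm_zero zero_neq_one add_nonneg_eq_0_iff zero_le_power2 zero_le_one zero_power2)

lemma has_derivative_chart: "(chart has_derivative chart_lin) (at x)"
  unfolding chart_eq[abs_def]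
  by (auto intro!: derivative_eq_intros linear_imp_has_derivative linear_chart_lin)

lemma has_real_derivative_line:
  assumes "(g has_derivative g') (at \<xi>)"
  shows "((\<lambda>t. g (\<xi> + t *\<^sub>R v)) has_real_derivative g' v) (at 0)"
proof -
  have d: "((\<lambda>t. \<xi> + t *\<^sub>R v) has_derivative (\<lambda>t. t *\<^sub>R v)) (at 0)"
    by (auto intro!: derivative_eq_intros)
  have "((\<lambda>t. g (\<xi> + t *\<^sub>R v)) has_derivative (\<lambda>t. g' (t *\<^sub>R v))) (at 0)"
    using has_derivative_compose[OF d, of g g'] assms by simp
  moreover have "(\<lambda>t. g' (t *\<^sub>R v)) = (*) (g' v)"
    by (rule ext) (simp add: linear_scale[OF has_derivative_linear[OF assms]] mult.commute)
  ultimately show ?thesis by (simp only: has_field_derivative_def)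
qed

lemma partial_eq:
  assumes "(h has_derivative h') (at x)"
  shows "partial i h x = h' (axis i 1)"
  unfolding partial_def using has_real_derivative_line[OF assms] by (rule DERIV_imp_deriv)

lemma linear_eq_sum_axis:
  fixes x :: "real^'m" and F :: "real^'m \<Rightarrow> 'b::real_vector"
  assumes "linear F" shows "F x = (\<Sum>i\<in>UNIV. (x $ i) *\<^sub>R F (axis i 1))"
proof -
  have "x = (\<Sum>i\<in>UNIV. (x $ i) *\<^sub>R axis i 1)"
    using basis_expansion[of x] by (simp add: scalar_mult_eq_scaleR)
  then have "F x = F (\<Sum>i\<in>UNIV. (x $ i) *\<^sub>R axis i 1)" by simp
  also have "\<dots> = (\<Sum>i\<in>UNIV. (x $ i) *\<^sub>R F (axis i 1))"
    by (simp only: linear_sum[OF assms] linear_scale[OF assms])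
  finally show ?thesis .
qed

text \<open>The summand is the derivative along \<open>j\<close> of cometric times volume density,
  that is of (delta + x x + rot x rot x) / s^n. Its vanishing divergence means that the Laplacian
  has no first-order part in this chart. Both halves of the sum equal 2n x_i / s^n.\<close>

lemma divergence_fs_cometric:
  fixes x :: "real^('n::finite \<times> bool)"
  defines "s \<equiv> 1 + (norm x)\<^sup>2"
  defines "\<delta> \<equiv> \<lambda>i j. if i = j then 1 else 0 :: real"
  shows "(\<Sum>j\<in>UNIV. (\<delta> j i * x $ j + x $ i * \<delta> j j + rot (axis j 1) $ i * rot x $ j + rot x $ i * rot (axis j 1) $ j) / s ^ CARD('n)
      - real CARD('n) * (\<delta> i j + x $ i * x $ j + rot x $ i * rot x $ j) * (2 * x $ j) / s ^ Suc CARD('n)) = 0"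
proof -
  have s: "s > 0" by (simp add: s_def add_pos_nonneg)
  have xx: "(\<Sum>k\<in>UNIV. x $ k * x $ k) = s - 1" "(\<Sum>k\<in>UNIV. rot x $ k * x $ k) = 0"
    using inner_rot_self[of x]
    by (simp_all add: s_def power2_norm_eq_inner inner_vec_def mult.commute)
  have r1: "(\<Sum>j\<in>UNIV. rot (axis j 1) $ i * rot x $ j) = - x $ i"
    using arg_cong[OF linear_eq_sum_axis[OF linear_rot, of "rot x"], of "\<lambda>v. v $ i"]
    by (simp add: rot_rot mult.commute)
  have r2: "rot (axis j 1) $ j = 0" for j :: "'n \<times> bool"
    by (cases j) (auto simp: rot_def axis_def)
  have "(\<Sum>j\<in>UNIV. \<delta> j i * x $ j + x $ i * \<delta> j j + rot (axis j 1) $ i * rot x $ j + rot x $ i * rot (axis j 1) $ j)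
      = 2 * real CARD('n) * x $ i"
    by (simp add: sum.distrib r1 r2 \<delta>_def if_distrib[of "\<lambda>u. u * _"] cong: if_cong)
  moreover have "(\<Sum>j\<in>UNIV. real CARD('n) * (\<delta> i j + x $ i * x $ j + rot x $ i * rot x $ j) * (2 * x $ j))
      = 2 * real CARD('n) * (s * x $ i)"
  proof -
    have "real CARD('n) * (\<delta> i j + x $ i * x $ j + rot x $ i * rot x $ j) * (2 * x $ j)
      = (if i = j then 2 * real CARD('n) * x $ j else 0) + (2 * real CARD('n) * x $ i) * (x $ j * x $ j)
       + (2 * real CARD('n) * rot x $ i) * (rot x $ j * x $ j)" for j
      by (simp add: \<delta>_def algebra_simps)
    then show ?thesis
      by (simp only: sum.distrib sum_distrib_left[symmetric] xx) (simp add: algebra_simps)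
  qed
  ultimately show ?thesis
    using s by (simp add: sum_subtractf sum_divide_distrib[symmetric])
qed

text \<open>Without first-order part, the chart Laplacian is the trace of \<open>H\<close> over the
  chart directions plus its values on \<open>x\<close> and \<open>rot x\<close>. The radial
  relations for \<open>H\<close> identify these two extra values with the two basis directions of
  homogeneous coordinates that the chart lacks.\<close>

lemma fs_lap_at_eq:
  fixes f :: "complex^('n::finite option) \<Rightarrow> real"
  assumes "projective_C2 f D H"
  shows "fs_lap_at f x = - projective_C2.lap H (chart x)"
proof -
  interpret projective_C2 f D H by fact
  let ?n = "CARD('n)" and ?\<xi> = "chart x" and ?L = "chart_lin"
  define e where "e i = (axis i 1 :: real^('n \<times> bool))" for i
  define s where "s y = 1 + (norm y)\<^sup>2" for y :: "real^('n \<times> bool)"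
  define \<delta> where "\<delta> i j = (if i = j then 1 else 0 :: real)" for i j :: "'n \<times> bool"
  define c where "c i j y = (\<delta> i j + y $ i * y $ j + rot y $ i * rot y $ j) / s y ^ ?n" for i j and y :: "real^('n \<times> bool)"
  define c' where "c' i j v = (v $ i * x $ j + x $ i * v $ j + rot v $ i * rot x $ j + rot x $ i * rot v $ j) / s x ^ ?n
      - real ?n * (\<delta> i j + x $ i * x $ j + rot x $ i * rot x $ j) * (2 * (x \<bullet> v)) / s x ^ Suc ?n" for i j v
  define B where "B u v = H ?\<xi> (?L u) (?L v)" for u v
  have s: "s y > 0" for y by (simp add: s_def add_pos_nonneg)
  have dc: "(c i j has_derivative c' i j) (at x)" for i j
  proof -
    have r: "((\<lambda>y. rot y $ i) has_derivative (\<lambda>v. rot v $ i)) (at x)" for i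
      by (intro linear_imp_has_derivative) (simp add: linear_iff linear_add[OF linear_rot] linear_scale[OF linear_rot])
    have v: "((\<lambda>y. y $ i) has_derivative (\<lambda>v. v $ i)) (at x)" for i
      by (intro linear_imp_has_derivative) (simp add: linear_iff)
    have ds: "((\<lambda>y. s y ^ ?n) has_derivative (\<lambda>v. real ?n * (2 * (x \<bullet> v)) * s x ^ (?n - 1))) (at x)"
      unfolding s_def power2_norm_eq_inner
      by (rule derivative_eq_intros refl)+ (simp add: inner_commute)
    have p: "s x ^ ?n = s x * s x ^ (?n - 1)"
      by (rule power_eq_if[THEN trans]) simp
    have num: "((\<lambda>y. \<delta> i j + y $ i * y $ j + rot y $ i * rot y $ j) has_derivative
        (\<lambda>v. v $ i * x $ j + x $ i * v $ j + rot v $ i * rot x $ j + rot x $ i * rot v $ j)) (at x)"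
      by (rule has_derivative_eq_rhs, (rule derivative_eq_intros r v refl)+) auto
    have nz: "s x ^ ?n \<noteq> 0" using s[of x] by simp
    show ?thesis
      unfolding c_def c'_def
      by (rule has_derivative_eq_rhs[OF has_derivative_divide[OF num ds nz]])
        (use s[of x] in \<open>intro ext; simp add: p field_simps\<close>)
  qed
  have dD: "((\<lambda>y. D (chart y) v) has_derivative (\<lambda>w. H ?\<xi> v (?L w))) (at x)" for v
    by (rule has_derivative_compose[OF has_derivative_chart deriv2[OF chart_nonzero]])
  have pf: "partial i (\<lambda>y. f (chart y)) y = D (chart y) (?L (e i))" for i y
    unfolding e_def by (rule partial_eq[OF has_derivative_compose[OF has_derivative_chart deriv[OF chart_nonzero]]])
  have g: "matrix_inv (fs_metric y) $ i $ j * vol_density y * partial i (\<lambda>y. f (chart y)) y = c i j y * D (chart y) (?L (e i))" for i j y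
    using s[of y] unfolding matrix_inv_fs_metric vol_density_eq pf
    by (simp add: fs_cometric_def c_def \<delta>_def s_def)
  have "partial j (\<lambda>y. c i j y * D (chart y) (?L (e i))) x = c i j x * B (e i) (e j) + c' i j (e j) * D ?\<xi> (?L (e i))" for i j
    unfolding B_def by (subst partial_eq[OF has_derivative_mult[OF dc dD]]) (simp add: e_def)
  then have "fs_lap_at f x = - (1 / vol_density x) *
     (\<Sum>i\<in>UNIV. \<Sum>j\<in>UNIV. c i j x * B (e i) (e j) + c' i j (e j) * D ?\<xi> (?L (e i)))"
    unfolding fs_lap_at_def fs_laplacian_def g by simp
  also have "(\<Sum>i\<in>UNIV. \<Sum>j\<in>UNIV. c i j x * B (e i) (e j) + c' i j (e j) * D ?\<xi> (?L (e i)))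
     = (\<Sum>i\<in>UNIV. \<Sum>j\<in>UNIV. c i j x * B (e i) (e j))"
  proof -
    have ax: "axis j (1::real) $ i = (if j = i then 1 else 0)" for i j :: "'n \<times> bool"
      by (simp add: axis_def)
    have "(\<Sum>j\<in>UNIV. c' i j (e j)) = 0" for i
      using divergence_fs_cometric[of i x] by (simp add: c'_def e_def s_def \<delta>_def inner_axis ax cong: if_cong)
    then show ?thesis by (simp add: sum.distrib sum_distrib_right[symmetric])
  qed
  also have "\<dots> = ((\<Sum>i\<in>UNIV. B (e i) (e i)) + B x x + B (rot x) (rot x)) / s x ^ ?n"
  proof -
    have lin: "linear (B u)" "linear (\<lambda>u. B u v)" for u v
      unfolding B_def using linear_compose[OF linear_chart_lin linear_H[OF chart_nonzero]]
        linear_compose[OF linear_chart_lin linear_H'[OF chart_nonzero]] by (simp_all add: o_def)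
    have BB: "B u u = (\<Sum>i\<in>UNIV. \<Sum>j\<in>UNIV. u $ i * u $ j * B (e i) (e j))" for u
      using linear_eq_sum_axis[OF lin(2), of u u] linear_eq_sum_axis[OF lin(1), of _ u]
      by (simp add: e_def sum_distrib_left mult_ac)
    have "c i j x * B (e i) (e j) = ((if i = j then B (e i) (e j) else 0) + x $ i * x $ j * B (e i) (e j) + rot x $ i * rot x $ j * B (e i) (e j)) / s x ^ ?n" for i j
      by (simp add: c_def \<delta>_def algebra_simps)
    then show ?thesis unfolding BB[of x] BB[of "rot x"]
      by (simp add: sum.distrib sum_divide_distrib[symmetric])
  qed
  also have "- (1 / vol_density x) * (((\<Sum>i\<in>UNIV. B (e i) (e i)) + B x x + B (rot x) (rot x)) / s x ^ ?n)
     = - s x * ((\<Sum>i\<in>UNIV. B (e i) (e i)) + B x x + B (rot x) (rot x))"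
    using s[of x] unfolding vol_density_eq s_def[symmetric] by (simp add: field_simps)
  also have "(\<Sum>i\<in>UNIV. B (e i) (e i)) + B x x + B (rot x) (rot x) = (\<Sum>b\<in>Basis. H ?\<xi> b b)"
  proof -
    note nz = chart_nonzero[of x]
    note L = linear_H[OF nz] linear_H'[OF nz]
    \<comment> \<open>The missing basis vectors are a (chart x - chart_lin x) for a = 1 and a = i.
      Expanding \<open>H\<close> there leaves its value on a chart_lin x plus a first-order term in
      the direction a^2 chart_lin x; as a^2 is 1 and -1, the first-order terms cancel.\<close>
    have e0: "axis None 1 = ?\<xi> - ?L x" "axis None \<i> = \<i> *s ?\<xi> - \<i> *s ?L x"
      by (auto simp: chart_eq vec_eq_iff axis_def algebra_simps)
    have H: "H ?\<xi> (a *s ?\<xi> - a *s ?L x) (a *s ?\<xi> - a *s ?L x) = 2 * D ?\<xi> ((a * a) *s ?L x) + H ?\<xi> (a *s ?L x) (a *s ?L x)" for a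
      using linear_diff[OF L(1)] linear_diff[OF L(2)] H_radial_left[OF nz] H_radial_right[OF nz] D_radial[OF nz]
        linear_diff[OF linear_D[OF nz]]
      by (simp add: vector_smult_assoc)
    have "H ?\<xi> (axis None 1) (axis None 1) + H ?\<xi> (axis None \<i>) (axis None \<i>) = B x x + B (rot x) (rot x)"
      using H[of 1] H[of \<i>] linear_neg[OF linear_D[OF nz], of "?L x"] unfolding e0 B_def chart_lin_rot by simp
    then show ?thesis
      by (simp add: sum_Basis_complex_vec sum_UNIV_option sum_UNIV_prod_bool B_def e_def chart_lin_axis)
  qed
  finally show ?thesis by (simp add: lap_def norm_chart s_def algebra_simps)
qed

section \<open>Homogeneous coordinates and Lebesgue measure\<close>

lemma nn_integral_lborel_translate:
  fixes f :: "'a::euclidean_space \<Rightarrow> ennreal"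
  assumes [measurable]: "f \<in> borel_measurable borel"
  shows "(\<integral>\<^sup>+x. f (c + x) \<partial>lborel) = (\<integral>\<^sup>+x. f x \<partial>lborel)"
  by (subst (2) lborel_distr_plus[of c, symmetric]) (simp add: nn_integral_distr)

text \<open>Uniqueness of Haar measure: both sides are compared through the double integral of
  \<open>f (T x) * indicator (ball 0 1) (y - T x)\<close>.\<close>
lemma nn_integral_lborel_isometry:
  fixes T :: "'a::euclidean_space \<Rightarrow> 'a" and f :: "'a \<Rightarrow> ennreal"
  assumes lin: "linear T" and iso: "\<And>x. norm (T x) = norm x"
    and [measurable]: "f \<in> borel_measurable borel"
  shows "(\<integral>\<^sup>+x. f (T x) \<partial>lborel) = (\<integral>\<^sup>+x. f x \<partial>lborel)"
proof -
  have [measurable]: "T \<in> borel_measurable borel"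
    using lin by (intro borel_measurable_continuous_onI linear_continuous_on) (simp add: linear_conv_bounded_linear)
  have "inj T"
    using iso unfolding linear_injective_0[OF lin] by (metis norm_eq_zero)
  then have surj: "surj T" using lin linear_injective_imp_surjective by blast
  define g :: "'a \<Rightarrow> ennreal" where "g = indicator (ball 0 1)"
  have [measurable]: "g \<in> borel_measurable borel" unfolding g_def by (intro borel_measurable_indicator borel_open open_ball)
  define b where "b = (\<integral>\<^sup>+x. g x \<partial>lborel)"
  have b: "b \<noteq> 0" "b \<noteq> top"
    using emeasure_lborel_ball_finite[of "0 :: 'a" 1] content_ball_pos[of 1 "0 :: 'a"]
    by (auto simp: b_def g_def measure_def less_top)
  have "(\<integral>\<^sup>+x. f (T x) \<partial>lborel) * b = (\<integral>\<^sup>+x. \<integral>\<^sup>+y. f (T x) * g y \<partial>lborel \<partial>lborel)"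
    by (simp add: nn_integral_cmult nn_integral_multc b_def)
  also have "\<dots> = (\<integral>\<^sup>+x. \<integral>\<^sup>+y. f (T x) * g (- T x + y) \<partial>lborel \<partial>lborel)"
    by (intro nn_integral_cong nn_integral_lborel_translate[symmetric]) simp
  also have "\<dots> = (\<integral>\<^sup>+y. \<integral>\<^sup>+x. f (T x) * g (- T x + y) \<partial>lborel \<partial>lborel)"
    by (rule lborel_pair.Fubini') simp
  also have "\<dots> = (\<integral>\<^sup>+y. \<integral>\<^sup>+x. f (T x + y) * g (- T x) \<partial>lborel \<partial>lborel)"
  proof (rule nn_integral_cong)
    fix y
    \<comment> \<open>Translating the source by a preimage of \<open>y\<close> shifts
      \<open>T x\<close> by \<open>y\<close>, which moves \<open>y\<close> from the argument of
      \<open>g\<close> to that of \<open>f\<close>.\<close>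
    obtain v where v: "T v = y" using surj by (metis surjD)
    have "(\<integral>\<^sup>+x. f (T x) * g (- T x + y) \<partial>lborel) = (\<integral>\<^sup>+x. f (T (v + x)) * g (- T (v + x) + y) \<partial>lborel)"
      by (rule nn_integral_lborel_translate[symmetric]) simp
    then show "(\<integral>\<^sup>+x. f (T x) * g (- T x + y) \<partial>lborel) = (\<integral>\<^sup>+x. f (T x + y) * g (- T x) \<partial>lborel)"
      by (simp add: linear_add[OF lin] v add.commute)
  qed
  also have "\<dots> = (\<integral>\<^sup>+x. \<integral>\<^sup>+y. f (T x + y) * g (- T x) \<partial>lborel \<partial>lborel)"
    by (rule lborel_pair.Fubini') simp
  also have "\<dots> = (\<integral>\<^sup>+x. (\<integral>\<^sup>+y. f y \<partial>lborel) * g x \<partial>lborel)"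
  proof (rule nn_integral_cong)
    fix x
    have "g (- T x) = g x" using iso by (simp add: g_def indicator_def)
    then show "(\<integral>\<^sup>+y. f (T x + y) * g (- T x) \<partial>lborel) = (\<integral>\<^sup>+y. f y \<partial>lborel) * g x"
      by (simp add: nn_integral_multc nn_integral_lborel_translate)
  qed
  also have "\<dots> = (\<integral>\<^sup>+x. f x \<partial>lborel) * b"
    by (simp add: nn_integral_cmult b_def)
  finally have eq: "(\<integral>\<^sup>+x. f (T x) \<partial>lborel) * b = (\<integral>\<^sup>+x. f x \<partial>lborel) * b" .
  have "x * b / b = x" for x using b by (simp add: ennreal_mult_divide_eq)
  from this[of "\<integral>\<^sup>+x. f (T x) \<partial>lborel"] this[of "\<integral>\<^sup>+x. f x \<partial>lborel"] show ?thesis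
    unfolding eq by simp
qed

lemma nn_integral_lborel_scaleR:
  fixes f :: "'a::euclidean_space \<Rightarrow> ennreal"
  assumes [measurable]: "f \<in> borel_measurable borel" and "r \<noteq> 0"
  shows "(\<integral>\<^sup>+x. f x \<partial>lborel) = ennreal (\<bar>r\<bar> ^ DIM('a)) * (\<integral>\<^sup>+x. f (r *\<^sub>R x) \<partial>lborel)"
  by (subst lborel_affine[OF assms(2), of 0])
    (simp add: nn_integral_density nn_integral_distr nn_integral_cmult)

definition cmul_rv :: "complex \<Rightarrow> real^('n::finite \<times> bool) \<Rightarrow> real^('n \<times> bool)" where
  "cmul_rv w y = Re w *\<^sub>R y + Im w *\<^sub>R rot y"

lemma chart_lin_cmul_rv: "chart_lin (cmul_rv w y) = w *s chart_lin y"
proof -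
  have "chart_lin (cmul_rv w y) = Re w *\<^sub>R chart_lin y + Im w *\<^sub>R (\<i> *s chart_lin y)"
    by (simp add: cmul_rv_def linear_add[OF linear_chart_lin] linear_scale[OF linear_chart_lin] chart_lin_rot)
  also have "\<dots> = w *s chart_lin y" by (simp add: vec_eq_iff complex_eq_iff)
  finally show ?thesis .
qed

lemma linear_cmul_rv: "linear (cmul_rv w)"
  by (rule linearI) (simp_all add: cmul_rv_def linear_add[OF linear_rot] linear_scale[OF linear_rot] algebra_simps)

lemma norm_cmul_rv: "norm (cmul_rv w x) = cmod w * norm x"
proof -
  have "cmul_rv w x \<bullet> cmul_rv w x = ((Re w)\<^sup>2 + (Im w)\<^sup>2) * (x \<bullet> x)"
    using inner_rot_self[of x]
    by (simp add: cmul_rv_def inner_add_left inner_add_right inner_rot_rot inner_commute[of "rot x" x] power2_eq_square algebra_simps)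
  then have "(norm (cmul_rv w x))\<^sup>2 = (cmod w * norm x)\<^sup>2"
    by (simp add: power2_norm_eq_inner[of "cmul_rv w x"] cmod_power2 power_mult_distrib power2_norm_eq_inner[of x])
  then show ?thesis by (simp add: power2_eq_iff_nonneg)
qed

lemma nn_integral_cmul_rv:
  fixes f :: "real^('n::finite \<times> bool) \<Rightarrow> ennreal"
  assumes [measurable]: "f \<in> borel_measurable borel" and "w \<noteq> 0"
  shows "(\<integral>\<^sup>+x. f x \<partial>lborel) = ennreal (cmod w ^ (2 * CARD('n))) * (\<integral>\<^sup>+x. f (cmul_rv w x) \<partial>lborel)"
proof -
  define u where "u = w / of_real (cmod w)"
  have u: "cmod u = 1" "w = of_real (cmod w) * u" using assms(2) by (auto simp: u_def norm_divide)
  have [measurable]: "(cmul_rv u :: real^('n \<times> bool) \<Rightarrow> _) \<in> borel_measurable borel"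
    using linear_cmul_rv
    by (intro borel_measurable_continuous_onI linear_continuous_on) (simp add: linear_conv_bounded_linear)
  have "(\<integral>\<^sup>+x. f x \<partial>lborel) = ennreal (\<bar>cmod w\<bar> ^ DIM(real^('n \<times> bool))) * (\<integral>\<^sup>+x. f (cmod w *\<^sub>R x) \<partial>lborel)"
    using assms by (intro nn_integral_lborel_scaleR) auto
  also have "(\<integral>\<^sup>+x. f (cmod w *\<^sub>R x) \<partial>lborel) = (\<integral>\<^sup>+x. f (cmod w *\<^sub>R cmul_rv u x) \<partial>lborel)"
    by (rule nn_integral_lborel_isometry[where f = "\<lambda>x. f (cmod w *\<^sub>R x)" and T = "cmul_rv u", symmetric])
      (simp_all add: norm_cmul_rv linear_cmul_rv u(1))
  also have "(\<lambda>x::real^('n \<times> bool). cmod w *\<^sub>R cmul_rv u x) = cmul_rv w"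
    using assms(2) by (simp add: cmul_rv_def fun_eq_iff scaleR_add_right u_def)
  finally show ?thesis by (simp add: mult.commute)
qed

text \<open>Splits off the coordinate \<open>None\<close>, so that Fubini on the product can
  integrate it separately: it becomes the scaling factor \<open>w\<close> of
  \<open>lift_scale\<close>. Being an isometry, \<open>lift\<close> keeps radial weights
  radial.\<close>

definition lift :: "complex \<times> (real^('n::finite \<times> bool)) \<Rightarrow> complex^('n option)" where
  "lift e = fst e *s axis None 1 + chart_lin (snd e)"

lemma linear_lift: "linear lift"
  by (rule linearI)
    (auto simp: lift_def linear_add[OF linear_chart_lin] linear_scale[OF linear_chart_lin] vec_eq_iff algebra_simps)

lemma norm_lift: "norm (lift e) = norm e"
proof -
  have "(norm (lift e))\<^sup>2 = (norm (fst e))\<^sup>2 + (norm (snd e))\<^sup>2"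
    unfolding power2_norm_eq_inner
    by (simp add: inner_vec_def sum_UNIV_option lift_def chart_lin_def axis_def sum_UNIV_prod_bool ccoord_def inner_complex_def)
  then show ?thesis
    by (metis norm_ge_zero norm_prod_def real_sqrt_unique)
qed

lemma lift_scale: "lift (w, cmul_rv w x) = w *s chart x"
  by (simp add: lift_def chart_lin_cmul_rv chart_eq vector_add_ldistrib)

lemma continuous_on_linear_fin: "linear (F :: 'a::euclidean_space \<Rightarrow> 'b::real_normed_vector) \<Longrightarrow> continuous_on S F"
  by (intro linear_continuous_on) (simp add: linear_conv_bounded_linear)

lemma lift_eq_0_iff: "lift e = 0 \<longleftrightarrow> e = 0"
  by (metis norm_eq_zero norm_lift)

lemma continuous_on_lift_compose: "continuous_on (- {0}) g \<Longrightarrow> continuous_on (- {0}) (\<lambda>e. g (lift e))"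
proof (rule continuous_on_compose2[OF _ continuous_on_linear_fin[OF linear_lift]])
  show "lift ` (- {0 :: complex \<times> (real^('n::finite \<times> bool))}) \<subseteq> - {0}"
  proof
    fix \<xi> assume "\<xi> \<in> lift ` (- {0 :: complex \<times> (real^('n::finite \<times> bool))})"
    then obtain e where "\<xi> = lift e" "e \<noteq> 0" by (elim imageE) simp
    then show "\<xi> \<in> - {0}" using lift_eq_0_iff[of e] by simp
  qed
qed

lemma measurable_lift [measurable]: "lift \<in> borel_measurable borel"
  by (intro borel_measurable_continuous_onI continuous_on_linear_fin linear_lift)

lemma continuous_on_chart: "continuous_on S chart"
  unfolding chart_eq[abs_def] by (intro continuous_intros continuous_on_linear_fin linear_chart_lin)

lemma measurable_chart [measurable]: "chart \<in> borel_measurable borel"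
  by (intro borel_measurable_continuous_onI continuous_on_chart)

lemma vol_density_pos: "vol_density x > 0"
  by (simp add: vol_density_eq add_pos_nonneg)

lemma measurable_vol_density [measurable]: "vol_density \<in> borel_measurable borel"
  unfolding vol_density_eq[abs_def] by measurable

text \<open>The substitution \<open>\<xi> = w *s chart x\<close> turns an integral of a scaling-invariant function
  against a radial weight over the whole of \<open>complex^('n option)\<close> into an integral over projective space.\<close>
lemma nn_integral_lift:
  fixes f :: "complex^('n::finite option) \<Rightarrow> ennreal" and W :: "real \<Rightarrow> ennreal"
  assumes [measurable]: "f \<in> borel_measurable borel" "W \<in> borel_measurable borel"
    and inv: "\<And>\<xi> c. \<xi> \<noteq> 0 \<Longrightarrow> c \<noteq> 0 \<Longrightarrow> f (c *s \<xi>) = f \<xi>"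
  shows "(\<integral>\<^sup>+e. f (lift e) * W ((norm e)\<^sup>2) \<partial>lborel)
    = (\<integral>\<^sup>+w. ennreal (cmod w ^ (2 * CARD('n))) * W ((cmod w)\<^sup>2) \<partial>lborel) *
      (\<integral>\<^sup>+x. f (chart x) * ennreal (vol_density x) \<partial>lborel)"
proof -
  let ?n = "CARD('n)"
  have "(\<integral>\<^sup>+e. f (lift e) * W ((norm e)\<^sup>2) \<partial>lborel) =
     (\<integral>\<^sup>+e. f (lift e) * W ((norm e)\<^sup>2) \<partial>(lborel \<Otimes>\<^sub>M lborel))"
    by (simp only: lborel_prod)
  also have "\<dots> = (\<integral>\<^sup>+w. \<integral>\<^sup>+y. f (lift (w, y)) * W ((norm (w, y))\<^sup>2) \<partial>lborel \<partial>lborel)"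
  proof (rule lborel.nn_integral_fst[symmetric])
    show "(\<lambda>e::complex \<times> (real^('n \<times> bool)). f (lift e) * W ((norm e)\<^sup>2)) \<in> borel_measurable (lborel \<Otimes>\<^sub>M lborel)"
      unfolding lborel_prod by measurable
  qed
  also have "\<dots> = (\<integral>\<^sup>+w. \<integral>\<^sup>+x. f (chart x) * (ennreal (cmod w ^ (2 * ?n)) * W ((cmod w)\<^sup>2 * (1 + (norm x)\<^sup>2))) \<partial>lborel \<partial>lborel)"
  proof (rule nn_integral_cong_AE)
    have "AE w in lborel. w \<noteq> (0::complex)" by (rule AE_lborel_singleton)
    then show "AE w in lborel. (\<integral>\<^sup>+y. f (lift (w, y)) * W ((norm (w, y))\<^sup>2) \<partial>lborel) =
       (\<integral>\<^sup>+x. f (chart x) * (ennreal (cmod w ^ (2 * ?n)) * W ((cmod w)\<^sup>2 * (1 + (norm x)\<^sup>2))) \<partial>lborel)"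
    proof eventually_elim
      case (elim w)
      have [measurable]: "(\<lambda>y. lift (w, y :: real^('n \<times> bool))) \<in> borel_measurable borel"
        by (intro borel_measurable_continuous_onI continuous_on_compose2[OF continuous_on_linear_fin[OF linear_lift, of UNIV]]
            continuous_intros) auto
      have nrm: "norm (w, cmul_rv w x) = cmod w * norm (chart x)" for x :: "real^('n \<times> bool)"
        by (metis norm_lift lift_scale norm_scale_complex)
      have "(\<integral>\<^sup>+y. f (lift (w, y)) * W ((norm (w, y))\<^sup>2) \<partial>lborel)
         = ennreal (cmod w ^ (2 * ?n)) * (\<integral>\<^sup>+x. f (lift (w, cmul_rv w x)) * W ((norm (w, cmul_rv w x))\<^sup>2) \<partial>lborel)"
        by (rule nn_integral_cmul_rv[OF _ elim, of "\<lambda>y. f (lift (w, y)) * W ((norm (w, y))\<^sup>2)"]) (simp add: norm_Pair)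
      also have "\<dots> = (\<integral>\<^sup>+x. ennreal (cmod w ^ (2 * ?n)) * (f (chart x) * W ((cmod w)\<^sup>2 * (1 + (norm x)\<^sup>2))) \<partial>lborel)"
        by (subst nn_integral_cmult) (simp_all add: nrm lift_scale inv[OF chart_nonzero elim] power_mult_distrib norm_chart)
      finally show ?case by (simp add: mult_ac)
    qed
  qed
  also have "\<dots> = (\<integral>\<^sup>+x. \<integral>\<^sup>+w. f (chart x) * (ennreal (cmod w ^ (2 * ?n)) * W ((cmod w)\<^sup>2 * (1 + (norm x)\<^sup>2))) \<partial>lborel \<partial>lborel)"
    by (rule lborel_pair.Fubini') simp
  also have "\<dots> = (\<integral>\<^sup>+x. (\<integral>\<^sup>+w. ennreal (cmod w ^ (2 * ?n)) * W ((cmod w)\<^sup>2) \<partial>lborel) * (f (chart x) * ennreal (vol_density x)) \<partial>lborel)"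
  proof (rule nn_integral_cong)
    fix x :: "real^('n \<times> bool)"
    define s where "s = 1 + (norm x)\<^sup>2"
    have s: "s > 0" by (simp add: s_def add_pos_nonneg)
    \<comment> \<open>Rescaling w by 1/sqrt s yields 1/s from the two real dimensions and 1/s^n from
      the power of |w|. The product is exactly \<open>vol_density x\<close>, which is how the
      Fubini-Study measure arises.\<close>
    have "(\<integral>\<^sup>+w. ennreal (cmod w ^ (2 * ?n)) * W ((cmod w)\<^sup>2 * s) \<partial>lborel)
      = ennreal (\<bar>1 / sqrt s\<bar> ^ DIM(complex)) * (\<integral>\<^sup>+w. ennreal (cmod ((1 / sqrt s) *\<^sub>R w) ^ (2 * ?n)) * W ((cmod ((1 / sqrt s) *\<^sub>R w))\<^sup>2 * s) \<partial>lborel)"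
      using s by (intro nn_integral_lborel_scaleR) auto
    also have "(\<lambda>w. ennreal (cmod ((1 / sqrt s) *\<^sub>R w) ^ (2 * ?n)) * W ((cmod ((1 / sqrt s) *\<^sub>R w))\<^sup>2 * s))
      = (\<lambda>w. ennreal (1 / s ^ ?n) * (ennreal (cmod w ^ (2 * ?n)) * W ((cmod w)\<^sup>2)))"
      using s by (simp add: fun_eq_iff power_mult_distrib power_mult power_divide mult.assoc[symmetric] divide_simps
          flip: ennreal_mult)
    also have "(\<integral>\<^sup>+w. ennreal (1 / s ^ ?n) * (ennreal (cmod w ^ (2 * ?n)) * W ((cmod w)\<^sup>2)) \<partial>lborel)
      = ennreal (1 / s ^ ?n) * (\<integral>\<^sup>+w. ennreal (cmod w ^ (2 * ?n)) * W ((cmod w)\<^sup>2) \<partial>lborel)"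
      by (rule nn_integral_cmult) simp
    also have "ennreal (\<bar>1 / sqrt s\<bar> ^ DIM(complex)) * (ennreal (1 / s ^ ?n) * X) = ennreal (vol_density x) * X" for X
      using s unfolding vol_density_eq s_def[symmetric]
      by (simp add: power_divide mult.assoc[symmetric] flip: ennreal_mult)
    finally have "(\<integral>\<^sup>+w. ennreal (cmod w ^ (2 * ?n)) * W ((cmod w)\<^sup>2 * s) \<partial>lborel)
      = ennreal (vol_density x) * (\<integral>\<^sup>+w. ennreal (cmod w ^ (2 * ?n)) * W ((cmod w)\<^sup>2) \<partial>lborel)" .
    then show "(\<integral>\<^sup>+w. f (chart x) * (ennreal (cmod w ^ (2 * ?n)) * W ((cmod w)\<^sup>2 * (1 + (norm x)\<^sup>2))) \<partial>lborel)
      = (\<integral>\<^sup>+w. ennreal (cmod w ^ (2 * ?n)) * W ((cmod w)\<^sup>2) \<partial>lborel) * (f (chart x) * ennreal (vol_density x))"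
      unfolding s_def[symmetric] by (subst nn_integral_cmult) (auto simp: mult_ac)
  qed
  also have "\<dots> = (\<integral>\<^sup>+w. ennreal (cmod w ^ (2 * ?n)) * W ((cmod w)\<^sup>2) \<partial>lborel) *
      (\<integral>\<^sup>+x. f (chart x) * ennreal (vol_density x) \<partial>lborel)"
    by (rule nn_integral_cmult) simp
  finally show ?thesis .
qed

section \<open>Compactly supported radial weights\<close>

lemma integrable_compact_support:
  fixes u :: "'a::euclidean_space \<Rightarrow> real"
  assumes "continuous_on UNIV u" and "\<And>x. norm x > R \<Longrightarrow> u x = 0"
  shows "integrable lborel u"
proof -
  have "integrable lborel (\<lambda>x. indicator (cball 0 R) x *\<^sub>R u x)"
    using assms(1) by (intro borel_integrable_compact) (auto intro: continuous_on_subset)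
  moreover have "(\<lambda>x. indicator (cball 0 R) x *\<^sub>R u x) = u"
    using assms(2) by (auto simp: indicator_def fun_eq_iff)
  ultimately show ?thesis by simp
qed

text \<open>Translation invariance makes the difference quotients integrate to zero;
  dominated convergence passes to the derivative.\<close>
lemma integral_directional_derivative_eq_0:
  fixes u u' :: "'a::euclidean_space \<Rightarrow> real"
  assumes der: "\<And>x. ((\<lambda>t. u (x + t *\<^sub>R b)) has_real_derivative u' x) (at 0)"
    and cont: "continuous_on UNIV u" "continuous_on UNIV u'"
    and supp: "\<And>x. norm x > R \<Longrightarrow> u x = 0"
  shows "integrable lborel u'" "(\<integral>x. u' x \<partial>lborel) = 0"
proof -
  have [measurable]: "u \<in> borel_measurable borel" "u' \<in> borel_measurable borel"
    using cont by (auto intro: borel_measurable_continuous_onI)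
  have der': "((\<lambda>t. u (x + t *\<^sub>R b)) has_real_derivative u' (x + a *\<^sub>R b)) (at a)" for x a
  proof -
    have "u (x + a *\<^sub>R b + t *\<^sub>R b) = u (x + (t + a) *\<^sub>R b)" for t
      by (simp add: scaleR_add_left add_ac)
    then show ?thesis
      using der[of "x + a *\<^sub>R b"] DERIV_shift[of "\<lambda>t. u (x + t *\<^sub>R b)" _ 0 a] by simp
  qed
  have int_u: "integrable lborel u" using cont(1) supp by (rule integrable_compact_support)
  have trans: "integrable lborel (\<lambda>x. u (x + c))" "(\<integral>x. u (x + c) \<partial>lborel) = (\<integral>x. u x \<partial>lborel)" for c
  proof -
    have "integrable (distr lborel borel ((+) c)) u" unfolding lborel_distr_plus by (rule int_u)
    then show "integrable lborel (\<lambda>x. u (x + c))"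
      by (simp add: integrable_distr_eq add.commute)
    have "(\<integral>x. u x \<partial>distr lborel borel ((+) c)) = (\<integral>x. u (x + c) \<partial>lborel)"
      by (simp add: integral_distr add.commute)
    then show "(\<integral>x. u (x + c) \<partial>lborel) = (\<integral>x. u x \<partial>lborel)"
      unfolding lborel_distr_plus by (rule sym)
  qed
  define q where "q n x = (u (x + (1 / real (Suc n)) *\<^sub>R b) - u x) / (1 / real (Suc n))" for n x
  have qint: "integrable lborel (q n)" "(\<integral>x. q n x \<partial>lborel) = 0" for n
    using trans int_u unfolding q_def by (auto simp: integral_divide_zero[symmetric])
  have lim: "(\<lambda>n. q n x) \<longlonglongrightarrow> u' x" for x
  proof -
    have "((\<lambda>t. (u (x + t *\<^sub>R b) - u x) / t) \<longlongrightarrow> u' x) (at 0)"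
      using der[of x] by (simp add: has_field_derivative_iff)
    moreover have "filterlim (\<lambda>n. 1 / real (Suc n)) (at 0) sequentially"
      using LIMSEQ_Suc[OF lim_1_over_n] by (auto simp: filterlim_at)
    ultimately show ?thesis unfolding q_def by (rule filterlim_compose)
  qed
  \<comment> \<open>If |x| > R + |b|, both points of the difference quotient lie outside the
    support. Otherwise x and every x + z b with z between 0 and 1 lie within radius R + 2
    |b|.\<close>
  define B where "B = cball (0::'a) (R + 2 * norm b)"
  obtain M where M: "\<And>x. x \<in> B \<Longrightarrow> \<bar>u' x\<bar> \<le> M"
  proof -
    have "compact (u' ` B)"
      unfolding B_def using cont(2) by (intro compact_continuous_image) (auto intro: continuous_on_subset)
    then show ?thesis
      using that compact_imp_bounded[of "u' ` B"] by (auto simp: bounded_iff)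
  qed
  have bound: "norm (q n x) \<le> indicator B x * \<bar>M\<bar>" for n x
  proof -
    define h where "h = 1 / real (Suc n)"
    have h: "0 < h" "h \<le> 1" by (auto simp: h_def)
    have q_h: "q n x = (u (x + h *\<^sub>R b) - u x) / h" unfolding q_def h_def ..
    \<comment> \<open>The mean value theorem makes the quotient a value of \<open>u'\<close>, so the
      bound of \<open>u'\<close> on the compact ball dominates all quotients at once.\<close>
    obtain z where z: "0 < z" "z < h" "u (x + h *\<^sub>R b) - u (x + 0 *\<^sub>R b) = (h - 0) * u' (x + z *\<^sub>R b)"
      using MVT2[OF h(1), of "\<lambda>t. u (x + t *\<^sub>R b)" "\<lambda>a. u' (x + a *\<^sub>R b)"] der' by blast
    then have q: "q n x = u' (x + z *\<^sub>R b)" using h by (simp add: q_h)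
    have nb: "norm (t *\<^sub>R b) \<le> norm b" if "0 \<le> t" "t \<le> 1" for t
      using that by (simp add: mult_left_le_one_le)
    show ?thesis
    proof (cases "norm x > R + norm b")
      case True
      have "norm (x + h *\<^sub>R b) \<ge> norm x - norm (h *\<^sub>R b)" by (metis norm_diff_ineq)
      then have "R < norm (x + h *\<^sub>R b)" "R < norm x"
        using True nb[of h] h norm_ge_zero[of b] by linarith+
      then have "u (x + h *\<^sub>R b) = 0" "u x = 0" by (simp_all add: supp)
      then have "q n x = 0" by (simp add: q_h)
      then show ?thesis by simp
    next
      case False
      have "norm (x + z *\<^sub>R b) \<le> R + 2 * norm b"
        using False nb[of z] z h norm_triangle_ineq[of x "z *\<^sub>R b"] by linarith
      moreover have "norm x \<le> R + 2 * norm b" using False norm_ge_zero[of b] by linarith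
      ultimately have "x + z *\<^sub>R b \<in> B" "x \<in> B" by (auto simp: B_def)
      then show ?thesis using M[of "x + z *\<^sub>R b"] by (simp add: q)
    qed
  qed
  have dom: "integrable lborel (\<lambda>x. indicator B x * \<bar>M\<bar>)"
    unfolding B_def using emeasure_lborel_cball_finite[of "0 :: 'a" "R + 2 * norm b"]
    by (intro integrable_mult_left integrable_real_indicator) auto
  have [measurable]: "q n \<in> borel_measurable lborel" for n unfolding q_def by simp
  show "integrable lborel u'"
    using lim bound by (intro integrable_dominated_convergence[OF _ _ dom, of u' q]) auto
  have "(\<lambda>n. \<integral>x. q n x \<partial>lborel) \<longlonglongrightarrow> (\<integral>x. u' x \<partial>lborel)"
    using lim bound by (intro integral_dominated_convergence[OF _ _ dom]) auto
  then show "(\<integral>x. u' x \<partial>lborel) = 0"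
    using qint(2) by (simp add: LIMSEQ_const_iff)
qed

definition pos_sq :: "real \<Rightarrow> real" where "pos_sq x = (max 0 x)\<^sup>2"

lemma has_derivative_pos_sq: "(pos_sq has_real_derivative 2 * max 0 x) (at x)"
proof (cases x "0::real" rule: linorder_cases)
  case less
  have "((\<lambda>x. 0) has_real_derivative 2 * max 0 x) (at x)" using less by simp
  then show ?thesis
    by (rule has_field_derivative_transform_within_open[of _ _ _ "{..<0}"]) (use less in \<open>auto simp: pos_sq_def\<close>)
next
  case greater
  have "((\<lambda>x. x\<^sup>2) has_real_derivative 2 * max 0 x) (at x)"
    using greater by (auto intro!: derivative_eq_intros)
  then show ?thesis
    by (rule has_field_derivative_transform_within_open[of _ _ _ "{0<..}"]) (use greater in \<open>auto simp: pos_sq_def\<close>)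
next
  case equal
  have "((\<lambda>h. pos_sq h / h) \<longlongrightarrow> 0) (at 0)"
  proof (rule Lim_null_comparison)
    show "\<forall>\<^sub>F h in at 0. norm (pos_sq h / h) \<le> \<bar>h\<bar>"
      by (auto simp: eventually_at_filter pos_sq_def max_def power2_eq_square)
    show "((\<lambda>h. \<bar>h\<bar>) \<longlongrightarrow> 0) (at (0::real))"
      by (intro tendsto_rabs_zero tendsto_ident_at)
  qed
  then show ?thesis by (simp add: equal has_field_derivative_iff pos_sq_def)
qed

text \<open>A bump on [1, 4], evaluated at squared norms and hence supported in the shell between
  radii 1 and 2, away from the singular origin. The squared ramps make it continuously
  differentiable, which is the regularity required by
  \<open>integral_directional_derivative_eq_0\<close>.\<close>

definition cutoff :: "real \<Rightarrow> real" where "cutoff x = pos_sq (x - 1) * pos_sq (4 - x)"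
definition cutoff' :: "real \<Rightarrow> real" where
  "cutoff' x = 2 * max 0 (x - 1) * pos_sq (4 - x) - pos_sq (x - 1) * (2 * max 0 (4 - x))"

lemma has_derivative_cutoff: "(cutoff has_real_derivative cutoff' x) (at x)"
proof -
  have 1: "((\<lambda>x. pos_sq (x - 1)) has_real_derivative 2 * max 0 (x - 1) * 1) (at x)"
    by (rule DERIV_chain2[OF has_derivative_pos_sq]) (auto intro!: derivative_eq_intros)
  have 2: "((\<lambda>x. pos_sq (4 - x)) has_real_derivative 2 * max 0 (4 - x) * (-1)) (at x)"
    by (rule DERIV_chain2[OF has_derivative_pos_sq]) (auto intro!: derivative_eq_intros)
  show ?thesis
    unfolding cutoff_def[abs_def] cutoff'_def
    by (rule DERIV_cong[OF DERIV_mult[OF 1 2]]) (simp add: algebra_simps)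
qed

lemma cutoff_eq_0: "x \<le> 1 \<or> 4 \<le> x \<Longrightarrow> cutoff x = 0" "x \<le> 1 \<or> 4 \<le> x \<Longrightarrow> cutoff' x = 0"
  by (auto simp: cutoff_def cutoff'_def pos_sq_def)

lemma cutoff_nonneg: "0 \<le> cutoff x"
  by (simp add: cutoff_def pos_sq_def)

lemma continuous_on_cutoff: "continuous_on S cutoff" "continuous_on S cutoff'"
  unfolding cutoff_def cutoff'_def pos_sq_def by (intro continuous_intros)+

lemma continuous_on_cutoff_mult:
  fixes g :: "'a::euclidean_space \<Rightarrow> real"
  assumes g: "continuous_on (- {0}) g" and W: "continuous_on UNIV W" "\<And>x. x \<le> 1 \<Longrightarrow> W x = 0"
  shows "continuous_on UNIV (\<lambda>e. g e * W ((norm e)\<^sup>2))"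
proof -
  have "continuous_on (- {0}) (\<lambda>e. g e * W ((norm e)\<^sup>2))"
    by (intro continuous_intros g continuous_on_compose2[OF W(1)]) auto
  moreover have "continuous_on (ball 0 1) (\<lambda>e. g e * W ((norm e)\<^sup>2))"
  proof (rule continuous_on_eq)
    show "continuous_on (ball 0 1) (\<lambda>e::'a. 0::real)" by simp
    show "0 = g e * W ((norm e)\<^sup>2)" if "e \<in> ball 0 1" for e
      using that W(2)[of "(norm e)\<^sup>2"] by (simp add: power_le_one)
  qed
  ultimately have "continuous_on (- {0} \<union> ball 0 1) (\<lambda>e. g e * W ((norm e)\<^sup>2))"
    by (intro continuous_on_open_Un) auto
  moreover have "- {0} \<union> ball 0 1 = (UNIV :: 'a set)" by auto
  ultimately show ?thesis by simp
qed

text \<open>The division compensates the factor |xi|^2 in \<open>lap\<close>, see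
  \<open>weight_mult\<close>. On the support of \<open>cutoff\<close> the maximum is just
  \<open>x\<close>; it keeps the quotient continuous at 0.\<close>

definition weight :: "real \<Rightarrow> real" where "weight x = cutoff x / max 1 x"

lemma weight_eq_0: "x \<le> 1 \<or> 4 \<le> x \<Longrightarrow> weight x = 0"
  by (simp add: weight_def cutoff_eq_0)

lemma weight_nonneg: "0 \<le> weight x"
  by (simp add: weight_def cutoff_nonneg)

lemma weight_mult: "x * weight x = cutoff x"
  by (cases "x \<le> 1") (simp_all add: weight_def cutoff_eq_0)

lemma continuous_on_weight: "continuous_on S weight"
  unfolding weight_def by (intro continuous_intros continuous_on_cutoff) (auto simp: max_def)

lemma measurable_weight [measurable]: "weight \<in> borel_measurable borel"
  by (intro borel_measurable_continuous_onI continuous_on_weight)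

definition weight_mass :: "nat \<Rightarrow> ennreal" where
  "weight_mass n = (\<integral>\<^sup>+w. ennreal (cmod w ^ (2 * n)) * ennreal (weight ((cmod w)\<^sup>2)) \<partial>lborel)"

text \<open>The mass is the proportionality constant between weighted integrals over homogeneous
  coordinates and integrals over projective space. These two facts allow it to be cancelled.\<close>

lemma weight_mass_bounds: "weight_mass n \<noteq> 0" "weight_mass n \<noteq> top"
proof -
  define h where "h w = cmod w ^ (2 * n) * weight ((cmod w)\<^sup>2)" for w
  have cont: "continuous_on UNIV h"
    unfolding h_def by (intro continuous_intros continuous_on_compose2[OF continuous_on_weight[of UNIV]]) auto
  have zero: "h w = 0" if "norm w > 2" for w
    using that power_mono[of 2 "cmod w" 2] by (simp add: h_def weight_eq_0)
  have nonneg: "0 \<le> h w" for w by (simp add: h_def weight_nonneg)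
  have eq: "weight_mass n = (\<integral>\<^sup>+w. ennreal (h w) \<partial>lborel)"
    by (simp add: weight_mass_def h_def weight_nonneg ennreal_mult)
  have int: "integrable lborel h" using cont zero by (rule integrable_compact_support)
  then show "weight_mass n \<noteq> top"
    unfolding eq using nonneg by (simp add: nn_integral_eq_integral)
  show "weight_mass n \<noteq> 0"
  proof
    assume "weight_mass n = 0"
    then have "AE w in lborel. ennreal (h w) = 0"
      unfolding eq using int by (subst (asm) nn_integral_0_iff_AE) auto
    then have "AE w in lebesgue. w \<in> {w. h w = 0}"
      using nonneg by (intro AE_completion) (auto elim: eventually_mono)
    moreover have "closed {w. h w = 0}"
      using cont by (intro closed_Collect_eq) auto
    \<comment> \<open>A point of the open shell: its squared modulus 9/4 lies strictly between 1 and
      4, where the weight is positive.\<close>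
    ultimately have "(3/2 :: complex) \<in> {w. h w = 0}"
      using mem_closed_if_AE_lebesgue by blast
    then show False by (simp add: h_def weight_def cutoff_def pos_sq_def power2_eq_square)
  qed
qed

text \<open>The weighted integrand is continuous with compact support, hence integrable. The
  identity for nonnegative functions, applied to the absolute value, carries integrability over to
  projective space; applied to positive and negative parts, it carries the value.\<close>

lemma integral_lift:
  fixes F :: "complex^('n::finite option) \<Rightarrow> real"
  assumes cont: "continuous_on (- {0}) F"
    and inv: "\<And>\<xi> c. \<xi> \<noteq> 0 \<Longrightarrow> c \<noteq> 0 \<Longrightarrow> F (c *s \<xi>) = F \<xi>"
  shows "integrable lborel (\<lambda>x. F (chart x) * vol_density x)"
    "integrable lborel (\<lambda>e. F (lift e) * weight ((norm e)\<^sup>2))"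
    "(\<integral>e. F (lift e) * weight ((norm e)\<^sup>2) \<partial>lborel)
      = enn2real (weight_mass CARD('n)) * (\<integral>x. F (chart x) * vol_density x \<partial>lborel)"
proof -
  let ?n = "CARD('n)"
  \<comment> \<open>\<open>F\<close> is controlled only off the origin. Extension by zero makes it
    Borel and changes nothing on the image of the chart or where the weight is nonzero.\<close>
  define F0 where "F0 \<xi> = indicator (- {0}) \<xi> *\<^sub>R F \<xi>" for \<xi>
  have [measurable]: "F0 \<in> borel_measurable borel"
    unfolding F0_def using cont by (intro borel_measurable_continuous_on_indicator) auto
  have inv0: "F0 (c *s \<xi>) = F0 \<xi>" if "\<xi> \<noteq> 0" "c \<noteq> 0" for \<xi> c
    using that inv by (simp add: F0_def scale_complex_nz)
  have chart: "F (chart x) = F0 (chart x)" for x by (simp add: F0_def chart_nonzero)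
  have lift: "F (lift e) * weight ((norm e)\<^sup>2) = F0 (lift e) * weight ((norm e)\<^sup>2)" for e
    by (cases "e = 0") (simp_all add: weight_eq_0 F0_def lift_eq_0_iff)
  have key: "(\<integral>\<^sup>+e. ennreal (g (F0 (lift e))) * ennreal (weight ((norm e)\<^sup>2)) \<partial>lborel)
     = weight_mass ?n * (\<integral>\<^sup>+x. ennreal (g (F0 (chart x))) * ennreal (vol_density x) \<partial>lborel)"
    if [measurable]: "g \<in> borel_measurable borel" for g
    unfolding weight_mass_def
    by (rule nn_integral_lift[where f = "\<lambda>\<xi>. ennreal (g (F0 \<xi>))" and W = "\<lambda>x. ennreal (weight x)"]) (auto simp: inv0)
  have v: "0 \<le> vol_density x" for x :: "real^('n \<times> bool)" using vol_density_pos[of x] by simp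
  note em = ennreal_mult''[OF v] ennreal_mult''[OF weight_nonneg]
  from continuous_on_lift_compose[OF cont]
  have "continuous_on UNIV (\<lambda>e. F (lift e) * weight ((norm e)\<^sup>2))"
    by (intro continuous_on_cutoff_mult continuous_on_weight) (auto simp: weight_eq_0)
  then show int: "integrable lborel (\<lambda>e. F (lift e) * weight ((norm e)\<^sup>2))"
  proof (rule integrable_compact_support)
    show "F (lift e) * weight ((norm e)\<^sup>2) = 0" if "norm e > 2" for e
      using that power_mono[of 2 "norm e" 2] by (simp add: weight_eq_0)
  qed
  have "(\<integral>\<^sup>+e. ennreal \<bar>F0 (lift e)\<bar> * ennreal (weight ((norm e)\<^sup>2)) \<partial>lborel) < \<infinity>"
    using int unfolding integrable_iff_bounded lift
    by (simp add: abs_mult weight_nonneg em)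
  then have "(\<integral>\<^sup>+x. ennreal \<bar>F0 (chart x)\<bar> * ennreal (vol_density x) \<partial>lborel) < \<infinity>"
    using key[of abs] weight_mass_bounds[of ?n] by (auto simp: ennreal_mult_less_top)
  then show int': "integrable lborel (\<lambda>x. F (chart x) * vol_density x)"
    unfolding integrable_iff_bounded chart using v by (simp add: abs_mult em)
  show "(\<integral>e. F (lift e) * weight ((norm e)\<^sup>2) \<partial>lborel)
      = enn2real (weight_mass ?n) * (\<integral>x. F (chart x) * vol_density x \<partial>lborel)"
  proof -
    have 1: "ennreal (F (lift e) * weight ((norm e)\<^sup>2)) = ennreal (F0 (lift e)) * ennreal (weight ((norm e)\<^sup>2))"
      "ennreal (- (F (lift e) * weight ((norm e)\<^sup>2))) = ennreal (- F0 (lift e)) * ennreal (weight ((norm e)\<^sup>2))" for e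
      unfolding lift minus_mult_left by (rule em(2))+
    have 2: "ennreal (F (chart x) * vol_density x) = ennreal (F0 (chart x)) * ennreal (vol_density x)"
      "ennreal (- (F (chart x) * vol_density x)) = ennreal (- F0 (chart x)) * ennreal (vol_density x)" for x
      unfolding chart minus_mult_left by (rule em(1))+
    have "(\<integral>\<^sup>+e. ennreal (- F0 (lift e)) * ennreal (weight ((norm e)\<^sup>2)) \<partial>lborel)
       = weight_mass ?n * (\<integral>\<^sup>+x. ennreal (- F0 (chart x)) * ennreal (vol_density x) \<partial>lborel)"
      "(\<integral>\<^sup>+e. ennreal (F0 (lift e)) * ennreal (weight ((norm e)\<^sup>2)) \<partial>lborel)
       = weight_mass ?n * (\<integral>\<^sup>+x. ennreal (F0 (chart x)) * ennreal (vol_density x) \<partial>lborel)"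
      using key[of "\<lambda>x. x"] key[of uminus] by simp_all
    then show ?thesis
      unfolding real_lebesgue_integral_def[OF int] real_lebesgue_integral_def[OF int'] 1 2
      by (simp only: enn2real_mult right_diff_distrib)
  qed
qed

lemma sum_lift_Basis:
  fixes g :: "complex^('n::finite option) \<Rightarrow> real"
  shows "(\<Sum>b\<in>Basis. g (lift b)) = (\<Sum>b\<in>Basis. g b)"
proof -
  have l: "lift (1, 0) = axis None 1" "lift (\<i>, 0) = axis None \<i>" "lift (0, axis i 1) = chart_lin (axis i 1)" for i :: "'n \<times> bool"
    by (auto simp: lift_def linear_0[OF linear_chart_lin] vec_eq_iff axis_def)
  have eq: "(Basis :: (real^('n \<times> bool)) set) = range (\<lambda>i. axis i 1)"
    by (auto simp: Basis_vec_def)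
  have inj: "inj (\<lambda>i. axis i 1 :: real^('n \<times> bool))" by (auto simp: inj_on_def axis_eq_axis)
  have "(\<Sum>b\<in>(Basis :: (real^('n \<times> bool)) set). h b) = (\<Sum>i\<in>UNIV. h (axis i 1))"
    for h :: "real^('n \<times> bool) \<Rightarrow> real"
    unfolding eq sum.reindex[OF inj] o_def ..
  moreover have "(\<Sum>b\<in>(Basis :: (complex \<times> (real^('n \<times> bool))) set). g (lift b))
    = (\<Sum>u\<in>Basis. g (lift (u, 0))) + (\<Sum>v\<in>Basis. g (lift (0, v)))"
    unfolding Basis_prod_def
    by (subst sum.union_disjoint) (auto simp: sum.reindex inj_on_def)
  ultimately have "(\<Sum>b\<in>(Basis :: (complex \<times> (real^('n \<times> bool))) set). g (lift b))
    = g (lift (1, 0)) + g (lift (\<i>, 0)) + (\<Sum>i\<in>UNIV. g (lift (0, axis i 1)))"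
    by (simp add: Basis_complex_def)
  then show ?thesis
    unfolding l by (simp add: sum_Basis_complex_vec sum_UNIV_option sum_UNIV_prod_bool chart_lin_axis)
qed

section \<open>Symmetry of the Laplacian\<close>

text \<open>The vector field with components \<open>u b\<close> is (f1 grad f2 - f2 grad f1) times
  the radial cutoff. Its divergence has integral zero. Differentiating the cutoff produces only
  radial derivatives of \<open>f1\<close> and \<open>f2\<close>, which vanish by
  \<open>D_radial\<close>; what remains is the difference of the two integrands, times
  \<open>weight\<close>.\<close>

lemma green_symmetric:
  fixes f1 f2 :: "complex^('n::finite option) \<Rightarrow> real"
  assumes "projective_C2 f1 D1 H1" "projective_C2 f2 D2 H2"
  shows "(\<integral>x. f1 (chart x) * projective_C2.lap H2 (chart x) * vol_density x \<partial>lborel)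
    = (\<integral>x. f2 (chart x) * projective_C2.lap H1 (chart x) * vol_density x \<partial>lborel)"
proof -
  interpret p1: projective_C2 f1 D1 H1 by fact
  interpret p2: projective_C2 f2 D2 H2 by fact
  define A where "A b \<xi> = f1 \<xi> * D2 \<xi> b - f2 \<xi> * D1 \<xi> b" for b \<xi>
  define B where "B b \<xi> = f1 \<xi> * H2 \<xi> b b - f2 \<xi> * H1 \<xi> b b" for b \<xi>
  define F where "F \<xi> = f1 \<xi> * p2.lap \<xi> - f2 \<xi> * p1.lap \<xi>" for \<xi>
  define u where "u b e = A (lift b) (lift e) * cutoff ((norm e)\<^sup>2)"
    for b e :: "complex \<times> (real^('n \<times> bool))"
  define u' where "u' b e = B (lift b) (lift e) * cutoff ((norm e)\<^sup>2)
      + (A (lift b) (lift e) * (2 * (e \<bullet> b))) * cutoff' ((norm e)\<^sup>2)"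
    for b e :: "complex \<times> (real^('n \<times> bool))"
  have contA: "continuous_on (- {0}) (A b)" and contB: "continuous_on (- {0}) (B b)" for b
    unfolding A_def B_def
    by (intro continuous_intros p1.continuous_on_f p2.continuous_on_f p1.continuous_on_D p2.continuous_on_D p1.cont2 p2.cont2)+
  have contu: "continuous_on UNIV (u b)" for b
    unfolding u_def
    by (intro continuous_on_cutoff_mult continuous_on_cutoff continuous_on_lift_compose contA) (simp add: cutoff_eq_0)
  have contu': "continuous_on UNIV (u' b)" for b
    unfolding u'_def
    by (rule continuous_on_add; rule continuous_on_cutoff_mult)
      (intro continuous_intros continuous_on_cutoff continuous_on_lift_compose contA contB | simp add: cutoff_eq_0)+
  have supp: "u b e = 0" if "norm e > 2" for b e
    using that power_mono[of 2 "norm e" 2] by (simp add: u_def cutoff_eq_0)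
  have der: "((\<lambda>t. u b (e + t *\<^sub>R b)) has_real_derivative u' b e) (at 0)" for b e
  proof (cases "e = 0")
    \<comment> \<open>At the origin \<open>f1\<close> and \<open>f2\<close> may fail to be
      differentiable, but the cutoff vanishes on a whole neighbourhood.\<close>
    case True
    have "((\<lambda>t. 0) has_real_derivative u' b e) (at 0)"
      by (simp add: True u'_def cutoff_eq_0)
    moreover have "open {t. norm (t *\<^sub>R b) < 1}" by (intro open_Collect_less continuous_intros)
    ultimately show ?thesis
    proof (rule has_field_derivative_transform_within_open)
      fix t assume "t \<in> {t. norm (t *\<^sub>R b) < 1}"
      then have "(norm (t *\<^sub>R b))\<^sup>2 \<le> 1" by (simp only: mem_Collect_eq power_le_one norm_ge_zero less_imp_le)
      then show "0 = u b (e + t *\<^sub>R b)" by (simp add: u_def True cutoff_eq_0)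
    qed simp
  next
    case False
    then have nz: "lift e \<noteq> 0" by (simp add: lift_eq_0_iff)
    note 1 = has_real_derivative_line[OF p1.deriv[OF nz], of "lift b"] has_real_derivative_line[OF p2.deriv[OF nz], of "lift b"]
      has_real_derivative_line[OF p1.deriv2[OF nz], of "lift b" "lift b"] has_real_derivative_line[OF p2.deriv2[OF nz], of "lift b" "lift b"]
    have 2: "((\<lambda>t. A (lift b) (lift e + t *\<^sub>R lift b)) has_real_derivative B (lift b) (lift e)) (at 0)"
      unfolding A_def B_def
      by (rule DERIV_cong[OF DERIV_diff[OF DERIV_mult[OF 1(1,4)] DERIV_mult[OF 1(2,3)]]]) simp
    have "((\<lambda>t. (norm (e + t *\<^sub>R b))\<^sup>2) has_real_derivative 2 * (e \<bullet> b)) (at 0)"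
    proof -
      have eq: "(\<lambda>t. (norm (e + t *\<^sub>R b))\<^sup>2) = (\<lambda>t. e \<bullet> e + 2 * t * (e \<bullet> b) + t\<^sup>2 * (b \<bullet> b))"
        unfolding power2_norm_eq_inner
        by (simp add: inner_add_left inner_add_right inner_commute[of b e] power2_eq_square fun_eq_iff algebra_simps)
      show ?thesis unfolding eq by (auto intro!: derivative_eq_intros)
    qed
    from DERIV_chain2[OF _ this, of cutoff "cutoff' ((norm e)\<^sup>2)"] has_derivative_cutoff
    have 3: "((\<lambda>t. cutoff ((norm (e + t *\<^sub>R b))\<^sup>2)) has_real_derivative cutoff' ((norm e)\<^sup>2) * (2 * (e \<bullet> b))) (at 0)"
      by simp
    have l: "lift (e + t *\<^sub>R b) = lift e + t *\<^sub>R lift b" for t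
      by (simp add: linear_add[OF linear_lift] linear_scale[OF linear_lift])
    show ?thesis unfolding u_def u'_def l
      by (rule DERIV_cong[OF DERIV_mult[OF 2 3]]) simp
  qed
  note zero = integral_directional_derivative_eq_0[OF der contu contu' supp]
  have sum: "(\<Sum>b\<in>Basis. u' b e) = F (lift e) * weight ((norm e)\<^sup>2)" for e
  proof (cases "e = 0")
    case True
    then show ?thesis by (simp add: u'_def weight_eq_0 cutoff_eq_0)
  next
    case False
    then have nz: "lift e \<noteq> 0" by (simp add: lift_eq_0_iff)
    have rad: "(\<Sum>b\<in>Basis. (e \<bullet> b) * G (lift b)) = G (lift e)" if "linear G" for G :: "_ \<Rightarrow> real"
    proof -
      have L: "linear (\<lambda>b. G (lift b))" using linear_compose[OF linear_lift that] by (simp add: o_def)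
      have "G (lift (\<Sum>b\<in>Basis. (e \<bullet> b) *\<^sub>R b)) = (\<Sum>b\<in>Basis. (e \<bullet> b) *\<^sub>R G (lift b))"
        using linear_sum[OF L, of "\<lambda>b. (e \<bullet> b) *\<^sub>R b" Basis] by (simp only: linear_scale[OF L])
      then show ?thesis by (simp add: euclidean_representation)
    qed
    have "(\<Sum>b\<in>Basis. A (lift b) (lift e) * (2 * (e \<bullet> b))) =
       2 * (f1 (lift e) * (\<Sum>b\<in>Basis. (e \<bullet> b) * D2 (lift e) (lift b)) - f2 (lift e) * (\<Sum>b\<in>Basis. (e \<bullet> b) * D1 (lift e) (lift b)))"
      by (simp add: A_def sum_distrib_left sum_subtractf algebra_simps)
    also have "\<dots> = 0"
      unfolding rad[OF p1.linear_D[OF nz]] rad[OF p2.linear_D[OF nz]]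
      using p1.D_radial[OF nz, of 1] p2.D_radial[OF nz, of 1] by simp
    finally have "(\<Sum>b\<in>Basis. u' b e) = (\<Sum>b\<in>Basis. B (lift b) (lift e)) * cutoff ((norm e)\<^sup>2)"
      unfolding u'_def sum.distrib sum_distrib_right[symmetric] by simp
    also have "(\<Sum>b\<in>Basis. B (lift b) (lift e)) = (\<Sum>b\<in>Basis. B b (lift e))"
      by (rule sum_lift_Basis)
    also have "\<dots> * cutoff ((norm e)\<^sup>2) = F (lift e) * weight ((norm e)\<^sup>2)"
      unfolding weight_mult[symmetric]
      by (simp add: F_def p1.lap_def p2.lap_def B_def sum_subtractf norm_lift sum_distrib_left[symmetric] algebra_simps)
    finally show ?thesis .
  qed
  have Fi: "continuous_on (- {0}) F" "\<And>\<xi> c. \<xi> \<noteq> 0 \<Longrightarrow> c \<noteq> 0 \<Longrightarrow> F (c *s \<xi>) = F \<xi>"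
    unfolding F_def
    by (intro continuous_intros p1.continuous_on_f p2.continuous_on_f p1.continuous_on_lap p2.continuous_on_lap)
      (simp add: p1.invariant p2.invariant p1.lap_scale p2.lap_scale)
  have "(\<integral>e. F (lift e) * weight ((norm e)\<^sup>2) \<partial>lborel) = 0"
    unfolding sum[symmetric] using zero by (subst Bochner_Integration.integral_sum) auto
  then have "(\<integral>x. F (chart x) * vol_density x \<partial>lborel) = 0"
    using integral_lift(3)[OF Fi] weight_mass_bounds[of "CARD('n)"] by (simp add: enn2real_eq_0_iff)
  moreover have "integrable lborel (\<lambda>x. (f1 (chart x) * p2.lap (chart x)) * vol_density x)"
    "integrable lborel (\<lambda>x. (f2 (chart x) * p1.lap (chart x)) * vol_density x)"
    by (rule integral_lift(1); (intro continuous_intros p1.continuous_on_f p2.continuous_on_f p1.continuous_on_lap p2.continuous_on_lap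
          | simp add: p1.invariant p2.invariant p1.lap_scale p2.lap_scale))+
  ultimately show ?thesis by (simp add: F_def left_diff_distrib)
qed

section \<open>Functions of the overlap\<close>

lemma sum_Basis_inner_mult: "(\<Sum>b\<in>Basis. (x \<bullet> b) * (y \<bullet> b)) = x \<bullet> y"
  by (rule euclidean_inner[symmetric])

text \<open>The quotient rule for |<xi,p>|^2 / |xi|^2 with |p| = 1, the numerator being split along
  \<open>p\<close> and \<open>\<i> *s p\<close>. Keeping the quotient itself as
  \<open>overlap\<close> lets the second derivative follow by the same rule.\<close>

definition overlap_deriv :: "complex^'k \<Rightarrow> complex^'k \<Rightarrow> complex^'k \<Rightarrow> real" where
  "overlap_deriv p \<xi> v = 2 * ((\<xi> \<bullet> p) * (v \<bullet> p) + (\<xi> \<bullet> (\<i> *s p)) * (v \<bullet> (\<i> *s p)) - overlap p \<xi> * (\<xi> \<bullet> v)) / (\<xi> \<bullet> \<xi>)"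

definition overlap_deriv2 :: "complex^'k \<Rightarrow> complex^'k \<Rightarrow> complex^'k \<Rightarrow> complex^'k \<Rightarrow> real" where
  "overlap_deriv2 p \<xi> v w = 2 * ((w \<bullet> p) * (v \<bullet> p) + (w \<bullet> (\<i> *s p)) * (v \<bullet> (\<i> *s p))
      - overlap p \<xi> * (w \<bullet> v) - overlap_deriv p \<xi> w * (\<xi> \<bullet> v) - overlap_deriv p \<xi> v * (\<xi> \<bullet> w)) / (\<xi> \<bullet> \<xi>)"

context
  fixes p :: "complex^'k"
  assumes p: "norm p = 1"
begin

lemma inner_ii:
  "p \<bullet> p = 1" "(\<i> *s p) \<bullet> (\<i> *s p) = 1" "p \<bullet> (\<i> *s p) = 0" "(\<i> *s p) \<bullet> p = 0"
  using p by (simp_all add: inner_eq_Re_herm herm_scale_left herm_scale_right herm_self norm_scale_complex)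

lemma overlap_eq: "overlap p \<xi> = ((\<xi> \<bullet> p)\<^sup>2 + (\<xi> \<bullet> (\<i> *s p))\<^sup>2) / (\<xi> \<bullet> \<xi>)"
proof -
  have "(cmod (herm p \<xi>))\<^sup>2 = (\<xi> \<bullet> p)\<^sup>2 + (\<xi> \<bullet> (\<i> *s p))\<^sup>2"
    unfolding inner_eq_Re_herm herm_scale_right herm_commute[of \<xi> p] by (simp add: cmod_power2)
  then show ?thesis using p by (simp add: overlap_def power_divide dot_square_norm)
qed

lemma has_derivative_overlap:
  assumes "\<xi> \<noteq> 0" shows "(overlap p has_derivative overlap_deriv p \<xi>) (at \<xi>)"
proof -
  have num: "((\<lambda>\<xi>. (\<xi> \<bullet> p)\<^sup>2 + (\<xi> \<bullet> (\<i> *s p))\<^sup>2) has_derivative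
      (\<lambda>v. 2 * (\<xi> \<bullet> p) * (v \<bullet> p) + 2 * (\<xi> \<bullet> (\<i> *s p)) * (v \<bullet> (\<i> *s p)))) (at \<xi>)"
    by (auto intro!: derivative_eq_intros)
  have den: "((\<lambda>\<xi>. \<xi> \<bullet> \<xi>) has_derivative (\<lambda>v. 2 * (\<xi> \<bullet> v))) (at \<xi>)"
    by (auto intro!: derivative_eq_intros simp: inner_commute)
  have nz: "\<xi> \<bullet> \<xi> \<noteq> 0" using assms by simp
  show ?thesis
    unfolding overlap_eq[abs_def] overlap_deriv_def
    by (rule has_derivative_eq_rhs[OF has_derivative_divide[OF num den nz]])
      (use nz in \<open>simp add: fun_eq_iff field_simps\<close>)
qed

lemma has_derivative_overlap_deriv:
  assumes "\<xi> \<noteq> 0" shows "((\<lambda>\<eta>. overlap_deriv p \<eta> v) has_derivative overlap_deriv2 p \<xi> v) (at \<xi>)"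
proof -
  have num: "((\<lambda>\<eta>. 2 * ((\<eta> \<bullet> p) * (v \<bullet> p) + (\<eta> \<bullet> (\<i> *s p)) * (v \<bullet> (\<i> *s p)) - overlap p \<eta> * (\<eta> \<bullet> v))) has_derivative
      (\<lambda>w. 2 * ((w \<bullet> p) * (v \<bullet> p) + (w \<bullet> (\<i> *s p)) * (v \<bullet> (\<i> *s p))
        - overlap p \<xi> * (w \<bullet> v) - overlap_deriv p \<xi> w * (\<xi> \<bullet> v)))) (at \<xi>)"
    by (rule has_derivative_eq_rhs, (rule derivative_eq_intros has_derivative_overlap[OF assms] refl)+) (simp add: fun_eq_iff)
  have den: "((\<lambda>\<xi>. \<xi> \<bullet> \<xi>) has_derivative (\<lambda>v. 2 * (\<xi> \<bullet> v))) (at \<xi>)"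
    by (auto intro!: derivative_eq_intros simp: inner_commute)
  have nz: "\<xi> \<bullet> \<xi> \<noteq> 0" using assms by simp
  define N where "N = 2 * ((\<xi> \<bullet> p) * (v \<bullet> p) + (\<xi> \<bullet> (\<i> *s p)) * (v \<bullet> (\<i> *s p)) - overlap p \<xi> * (\<xi> \<bullet> v))"
  have d: "N = overlap_deriv p \<xi> v * (\<xi> \<bullet> \<xi>)"
    using nz by (simp add: overlap_deriv_def N_def)
  have eq: "(\<lambda>\<eta>. overlap_deriv p \<eta> v) = (\<lambda>\<eta>. 2 * ((\<eta> \<bullet> p) * (v \<bullet> p) + (\<eta> \<bullet> (\<i> *s p)) * (v \<bullet> (\<i> *s p)) - overlap p \<eta> * (\<eta> \<bullet> v)) / (\<eta> \<bullet> \<eta>))"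
    by (simp only: overlap_deriv_def)
  show ?thesis
    unfolding eq
  proof (rule has_derivative_eq_rhs[OF has_derivative_divide[OF num den nz, folded N_def]], rule ext)
    fix h
    show "- N * (inverse (\<xi> \<bullet> \<xi>) * (2 * (\<xi> \<bullet> h)) * inverse (\<xi> \<bullet> \<xi>)) +
        2 * ((h \<bullet> p) * (v \<bullet> p) + (h \<bullet> (\<i> *s p)) * (v \<bullet> (\<i> *s p)) - overlap p \<xi> * (h \<bullet> v)
          - overlap_deriv p \<xi> h * (\<xi> \<bullet> v)) / (\<xi> \<bullet> \<xi>) = overlap_deriv2 p \<xi> v h"
      unfolding d overlap_deriv2_def using nz by (simp add: field_simps)
  qed
qed

lemma continuous_on_overlap: "continuous_on (- {0}) (overlap p)"
  unfolding overlap_eq[abs_def] by (intro continuous_intros) auto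

lemma continuous_on_overlap_deriv: "continuous_on (- {0}) (\<lambda>\<xi>. overlap_deriv p \<xi> v)"
  unfolding overlap_deriv_def by (intro continuous_intros continuous_on_overlap) auto

lemma continuous_on_overlap_deriv2: "continuous_on (- {0}) (\<lambda>\<xi>. overlap_deriv2 p \<xi> v w)"
  unfolding overlap_deriv2_def by (intro continuous_intros continuous_on_overlap continuous_on_overlap_deriv) auto

text \<open>Chain rule, with the two invariants of the overlap: its squared gradient is 4 t (1-t) /
  |xi|^2 and its Euclidean Laplacian is 4 (1 - (n+1) t) / |xi|^2, where \<open>CARD('k)\<close> is n
  + 1. The overlap attains both 0 and 1, so \<open>F\<close> must be differentiable at the
  endpoints; the singular profile itself is thereby excluded.\<close>

lemma projective_C2_overlap:
  fixes F F' F'' :: "real \<Rightarrow> real"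
  assumes F: "\<And>t. t \<in> {0..1} \<Longrightarrow> (F has_real_derivative F' t) (at t)"
    and F': "\<And>t. t \<in> {0..1} \<Longrightarrow> (F' has_real_derivative F'' t) (at t)"
    and F'': "continuous_on {0..1} F''"
  defines "H \<equiv> \<lambda>\<xi> v w. F'' (overlap p \<xi>) * overlap_deriv p \<xi> w * overlap_deriv p \<xi> v + F' (overlap p \<xi>) * overlap_deriv2 p \<xi> v w"
  shows "projective_C2 (\<lambda>\<xi>. F (overlap p \<xi>)) (\<lambda>\<xi> v. F' (overlap p \<xi>) * overlap_deriv p \<xi> v) H"
    and "\<And>\<xi>. \<xi> \<noteq> 0 \<Longrightarrow> projective_C2.lap H \<xi> =
      4 * (overlap p \<xi> * (1 - overlap p \<xi>) * F'' (overlap p \<xi>) + (1 - real CARD('k) * overlap p \<xi>) * F' (overlap p \<xi>))"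
proof -
  have mem: "overlap p \<xi> \<in> {0..1}" for \<xi> using overlap_nonneg overlap_le_1 by auto
  have cF: "continuous_on {0..1} F'" using F' DERIV_isCont continuous_at_imp_continuous_on by blast
  have comp: "continuous_on (- {0}) (\<lambda>\<xi>. g (overlap p \<xi>))" if "continuous_on {0..1} g" for g :: "real \<Rightarrow> real"
    by (rule continuous_on_compose2[OF that continuous_on_overlap]) (use mem in auto)
  show pc: "projective_C2 (\<lambda>\<xi>. F (overlap p \<xi>)) (\<lambda>\<xi> v. F' (overlap p \<xi>) * overlap_deriv p \<xi> v) H"
  proof
    show "F (overlap p (c *s \<xi>)) = F (overlap p \<xi>)" if "c \<noteq> 0" for \<xi> c
      using that by (simp add: overlap_scale)
    fix \<xi> :: "complex^'k" assume \<xi>: "\<xi> \<noteq> 0"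
    have ch: "((\<lambda>\<eta>. g (overlap p \<eta>)) has_derivative (\<lambda>w. g' * overlap_deriv p \<xi> w)) (at \<xi>)"
      if "(g has_real_derivative g') (at (overlap p \<xi>))" for g g'
      using has_derivative_compose[OF has_derivative_overlap[OF \<xi>], of g "(*) g'"] that
      by (simp add: has_field_derivative_def)
    show "((\<lambda>\<xi>. F (overlap p \<xi>)) has_derivative (\<lambda>v. F' (overlap p \<xi>) * overlap_deriv p \<xi> v)) (at \<xi>)"
      by (rule ch[OF F[OF mem]])
    show "((\<lambda>\<eta>. F' (overlap p \<eta>) * overlap_deriv p \<eta> v) has_derivative H \<xi> v) (at \<xi>)" for v
      unfolding H_def
      by (rule has_derivative_eq_rhs[OF has_derivative_mult[OF ch[OF F'[OF mem]] has_derivative_overlap_deriv[OF \<xi>]]]) auto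
  next
    show "continuous_on (- {0}) (\<lambda>\<xi>. H \<xi> v w)" for v w
      unfolding H_def
      by (intro continuous_intros comp F'' cF continuous_on_overlap_deriv continuous_on_overlap_deriv2)
  qed
  fix \<xi> :: "complex^'k" assume \<xi>: "\<xi> \<noteq> 0"
  define t where "t = overlap p \<xi>"
  define r where "r = \<xi> \<bullet> \<xi>"
  \<comment> \<open>This is r/2 times the gradient of the overlap: the projection of xi to the
    complex line of \<open>p\<close>, corrected by t xi so as to be orthogonal to xi.\<close>
  define g where "g = (\<xi> \<bullet> p) *\<^sub>R p + (\<xi> \<bullet> (\<i> *s p)) *\<^sub>R (\<i> *s p) - t *\<^sub>R \<xi>"
  have r: "r > 0" using \<xi> by (simp add: r_def)
  have a: "(\<xi> \<bullet> p)\<^sup>2 + (\<xi> \<bullet> (\<i> *s p))\<^sup>2 = t * r"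
    using r by (simp add: t_def r_def overlap_eq)
  have d: "overlap_deriv p \<xi> v = (2 / r) * (g \<bullet> v)" for v
    by (simp add: overlap_deriv_def g_def t_def[symmetric] r_def[symmetric] inner_add_left inner_diff_left inner_commute[of v] algebra_simps
        diff_divide_distrib add_divide_distrib)
  have g\<xi>: "g \<bullet> \<xi> = 0"
    using a by (simp add: g_def inner_add_left inner_diff_left inner_commute[of p \<xi>] inner_commute[of "\<i> *s p" \<xi>]
        power2_eq_square r_def[symmetric])
  have gg: "g \<bullet> g = t * (1 - t) * r"
  proof -
    have "g \<bullet> g = ((\<xi> \<bullet> p)\<^sup>2 + (\<xi> \<bullet> (\<i> *s p))\<^sup>2) - t * ((\<xi> \<bullet> p)\<^sup>2 + (\<xi> \<bullet> (\<i> *s p))\<^sup>2) - t * (g \<bullet> \<xi>)"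
      by (subst (2) g_def) (simp add: g_def inner_add_left inner_diff_left inner_add_right inner_diff_right inner_ii
          inner_commute[of p \<xi>] inner_commute[of "\<i> *s p" \<xi>] power2_eq_square algebra_simps)
    then show ?thesis unfolding a g\<xi> by (simp add: algebra_simps)
  qed
  have s1: "(\<Sum>b\<in>Basis. overlap_deriv p \<xi> b * overlap_deriv p \<xi> b) = 4 * t * (1 - t) / r"
  proof -
    have "(\<Sum>b\<in>Basis. overlap_deriv p \<xi> b * overlap_deriv p \<xi> b) = (4 / r\<^sup>2) * (\<Sum>b\<in>Basis. (g \<bullet> b) * (g \<bullet> b))"
      unfolding d sum_distrib_left by (simp add: power2_eq_square mult_ac)
    then show ?thesis using r unfolding sum_Basis_inner_mult gg by (simp add: power2_eq_square)
  qed
  have s2: "(\<Sum>b\<in>Basis. overlap_deriv2 p \<xi> b b) = (4 - 4 * real CARD('k) * t) / r"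
  proof -
    have "overlap_deriv2 p \<xi> b b = (2 / r) * (((p \<bullet> b) * (p \<bullet> b) + ((\<i> *s p) \<bullet> b) * ((\<i> *s p) \<bullet> b))
        - t * (b \<bullet> b) - (4 / r) * ((g \<bullet> b) * (\<xi> \<bullet> b)))" for b
      unfolding overlap_deriv2_def d t_def[symmetric] r_def[symmetric]
      by (simp add: inner_commute[of b p] inner_commute[of b "\<i> *s p"] algebra_simps
          diff_divide_distrib add_divide_distrib)
    then have "(\<Sum>b\<in>Basis. overlap_deriv2 p \<xi> b b) = (2 / r) * ((p \<bullet> p + (\<i> *s p) \<bullet> (\<i> *s p))
        - t * (\<Sum>b\<in>(Basis :: (complex^'k) set). b \<bullet> b) - (4 / r) * (g \<bullet> \<xi>))"
      by (simp only: sum_distrib_left[symmetric] sum_subtractf sum.distrib sum_Basis_inner_mult)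
    moreover have "(\<Sum>b\<in>(Basis :: (complex^'k) set). b \<bullet> b) = 2 * real CARD('k)"
      by (simp add: inner_Basis)
    ultimately show ?thesis by (simp add: inner_ii g\<xi> algebra_simps diff_divide_distrib)
  qed
  have "projective_C2.lap H \<xi> = r * (\<Sum>b\<in>Basis. H \<xi> b b)"
    by (simp add: projective_C2.lap_def[OF pc] r_def dot_square_norm)
  also have "(\<Sum>b\<in>Basis. H \<xi> b b) = F'' t * (4 * t * (1 - t) / r) + F' t * ((4 - 4 * real CARD('k) * t) / r)"
    unfolding H_def t_def[symmetric] sum.distrib
    by (simp add: mult.assoc sum_distrib_left[symmetric] s1 s2)
  also have "r * \<dots> = F'' t * (4 * t * (1 - t)) + F' t * (4 - 4 * real CARD('k) * t)"
    using r by (simp add: distrib_left)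
  finally show "projective_C2.lap H \<xi> =
      4 * (overlap p \<xi> * (1 - overlap p \<xi>) * F'' (overlap p \<xi>) + (1 - real CARD('k) * overlap p \<xi>) * F' (overlap p \<xi>))"
    unfolding t_def[symmetric] by (simp add: algebra_simps)
qed

end

section \<open>The radial differential equation of the profile\<close>

lemma has_derivative_green_profile:
  assumes "s > 0" "n \<ge> 1"
  shows "(green_profile n has_real_derivative (\<Sum>j = 1..n. 1 / (2 * s ^ j))) (at s)"
proof -
  have "(green_profile n has_real_derivative 1 / (2 * s) + (\<Sum>j = 1..n - 1. 1 / (2 * s ^ Suc j))) (at s)"
  proof -
    have "((\<lambda>s. 1 / (2 * real j * s ^ j)) has_real_derivative - (1 / (2 * s ^ Suc j))) (at s)" if "j \<in> {1..n - 1}" for j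
    proof -
      have "j \<ge> 1" using that by simp
      then have "s ^ j = s * s ^ (j - 1)" by (cases j) auto
      then show ?thesis using assms(1) \<open>j \<ge> 1\<close>
        by (auto intro!: derivative_eq_intros simp: field_simps power2_eq_square)
    qed
    then have "((\<lambda>s. \<Sum>j = 1..n - 1. 1 / (2 * real j * s ^ j)) has_real_derivative (\<Sum>j = 1..n - 1. - (1 / (2 * s ^ Suc j)))) (at s)"
      by (rule DERIV_sum)
    moreover have "((\<lambda>s. ln s / 2) has_real_derivative 1 / (2 * s)) (at s)"
      using assms(1) by (auto intro!: derivative_eq_intros)
    ultimately show ?thesis
      unfolding green_profile_def[abs_def]
      by (intro DERIV_cong[OF DERIV_diff]) (auto simp: sum_negf)
  qed
  moreover have "1 / (2 * s) + (\<Sum>j = 1..n - 1. 1 / (2 * s ^ Suc j)) = (\<Sum>j = 1..n. 1 / (2 * s ^ j))"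
  proof -
    obtain m where n: "n = Suc m" using assms(2) by (cases n) auto
    show ?thesis unfolding n
      using sum.atLeast_Suc_atMost[of 1 "Suc m" "\<lambda>j. 1 / (2 * s ^ j)"]
        sum.shift_bounds_cl_Suc_ivl[of "\<lambda>j. 1 / (2 * s ^ j)" 1 m] by simp
  qed
  ultimately show ?thesis by simp
qed

text \<open>The two sums are the second and first derivatives in t of the profile at u = 1 + eps -
  t. Substituting t = 1 + eps - u, the part free of an explicit eps telescopes in c j = (n - j) /
  u^j, from 0 at j = n down to n at j = 0. All else carries the factor eps and has nonnegative
  summands for t in [0, 1].\<close>

lemma green_profile_ode:
  fixes t \<epsilon> :: real
  defines "u \<equiv> 1 + \<epsilon> - t"
  assumes u: "u > 0"
  shows "4 * (t * (1 - t) * (\<Sum>j = 1..n. - real j / (2 * u ^ Suc j)) + (1 - real (Suc n) * t) * (\<Sum>j = 1..n. - 1 / (2 * u ^ j)))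
    = - 2 * real n + 2 * \<epsilon> * (\<Sum>j = 1..n. real (n + 1 - j) / u ^ j + real j * t / u ^ Suc j)"
proof -
  define c where "c j = (real n - real j) / u ^ j" for j
  have t: "t = 1 + \<epsilon> - u" by (simp add: u_def)
  have "4 * (t * (1 - t) * (- real j / (2 * u ^ Suc j)) + (1 - real (Suc n) * t) * (- 1 / (2 * u ^ j)))
      = 2 * (c j - c (j - 1)) + 2 * \<epsilon> * (real (n + 1 - j) / u ^ j + real j * t / u ^ Suc j)" if jn: "j \<in> {1..n}" for j
  proof -
    obtain i where j: "j = Suc i" using jn by (cases j) auto
    have r: "real (n - i) = real n - real i" using jn j by (simp add: of_nat_diff)
    define w where "w = 1 / u ^ Suc j"
    have w: "- real j / (2 * u ^ Suc j) = - real j * w / 2" "- 1 / (2 * u ^ j) = - u * w / 2"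
      "c j = (real n - real j) * (u * w)" "c (j - 1) = (real n - real i) * (u * u * w)"
      "real (n + 1 - j) / u ^ j = (real n - real i) * (u * w)" "real j * t / u ^ Suc j = real j * t * w"
      using u by (simp_all add: w_def c_def j r)
    show ?thesis unfolding w unfolding t j by (simp add: algebra_simps add_divide_distrib diff_divide_distrib)
  qed
  then have "4 * (t * (1 - t) * (\<Sum>j = 1..n. - real j / (2 * u ^ Suc j)) + (1 - real (Suc n) * t) * (\<Sum>j = 1..n. - 1 / (2 * u ^ j)))
    = (\<Sum>j = 1..n. 2 * (c j - c (j - 1)) + 2 * \<epsilon> * (real (n + 1 - j) / u ^ j + real j * t / u ^ Suc j))"
    unfolding sum_distrib_left sum.distrib[symmetric] by (intro sum.cong refl) (simp only: distrib_left)
  also have "\<dots> = 2 * (\<Sum>j = 1..n. c j - c (j - 1)) + 2 * \<epsilon> * (\<Sum>j = 1..n. real (n + 1 - j) / u ^ j + real j * t / u ^ Suc j)"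
    by (simp only: sum.distrib sum_distrib_left[symmetric])
  also have "(\<Sum>j = 1..n. c j - c (j - 1)) = c n - c 0"
    using sum_telescope''[of 0 n c] by simp
  finally show ?thesis by (simp add: c_def)
qed

section \<open>The Fubini--Study measure\<close>

definition fs_measure :: "(real^('n::finite \<times> bool)) measure" where
  "fs_measure = density lborel (\<lambda>x. ennreal (vol_density x))"

lemma sets_fs_measure [measurable_cong, simp]: "sets fs_measure = sets borel"
  by (simp add: fs_measure_def)

lemma space_fs_measure [simp]: "space fs_measure = UNIV"
  by (simp add: fs_measure_def)

lemma vol_density_nonneg: "0 \<le> vol_density x"
  using vol_density_pos[of x] by simp

lemma integrable_fs_measure:
  fixes g :: "real^('n::finite \<times> bool) \<Rightarrow> real"
  assumes [measurable]: "g \<in> borel_measurable borel"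
  shows "integrable fs_measure g \<longleftrightarrow> integrable lborel (\<lambda>x. g x * vol_density x)"
  unfolding fs_measure_def by (subst integrable_real_density) (auto simp: vol_density_nonneg mult.commute)

lemma integral_fs_measure:
  fixes g :: "real^('n::finite \<times> bool) \<Rightarrow> real"
  assumes [measurable]: "g \<in> borel_measurable borel"
  shows "(\<integral>x. g x \<partial>fs_measure) = (\<integral>x. g x * vol_density x \<partial>lborel)"
  unfolding fs_measure_def by (subst integral_real_density) (auto simp: vol_density_nonneg mult.commute)

lemma finite_measure_fs: "finite_measure (fs_measure :: (real^('n::finite \<times> bool)) measure)"
proof
  have "integrable lborel (\<lambda>x::real^('n \<times> bool). 1 * vol_density x)"
    by (rule integral_lift(1)) auto
  then have "integrable (fs_measure :: (real^('n \<times> bool)) measure) (\<lambda>x. 1 :: real)"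
    by (subst integrable_fs_measure) auto
  then show "emeasure (fs_measure :: (real^('n \<times> bool)) measure) (space fs_measure) \<noteq> \<infinity>"
    by (simp add: integrable_iff_bounded less_top)
qed

interpretation fs: finite_measure "fs_measure :: (real^('n::finite \<times> bool)) measure"
  by (rule finite_measure_fs)

lemma fs_integral_eq:
  fixes f :: "complex^('n::finite option) \<Rightarrow> real"
  assumes "(\<lambda>x. f (chart x)) \<in> borel_measurable borel"
  shows "fs_integral f = (\<integral>x. f (chart x) \<partial>fs_measure)"
  using integral_fs_measure[OF assms] by (simp add: fs_integral_def)

lemma fs_vol_eq: "fs_vol TYPE('n::finite) = measure (fs_measure :: (real^('n \<times> bool)) measure) UNIV"
proof -
  have "fs_vol TYPE('n) = (\<integral>x. 1 \<partial>(fs_measure :: (real^('n \<times> bool)) measure))"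
    unfolding fs_vol_def by (subst fs_integral_eq) auto
  then show ?thesis by simp
qed

lemma AE_fs_measure: "AE x in lborel. P x \<Longrightarrow> AE x in fs_measure. P x"
  unfolding fs_measure_def by (subst AE_density) auto

lemma fs_vol_pos: "fs_vol TYPE('n::finite) > 0"
proof (rule ccontr)
  assume "\<not> fs_vol TYPE('n) > 0"
  then have "emeasure (fs_measure :: (real^('n \<times> bool)) measure) UNIV = 0"
    using fs_vol_eq[where 'n = 'n] measure_nonneg[of "fs_measure :: (real^('n \<times> bool)) measure" UNIV]
    by (simp add: fs.emeasure_eq_measure)
  then have "(\<integral>\<^sup>+x. ennreal (vol_density (x :: real^('n \<times> bool))) \<partial>lborel) = 0"
    by (simp add: fs_measure_def emeasure_density)
  then have "AE x in lborel. ennreal (vol_density (x :: real^('n \<times> bool))) = 0"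
    by (subst (asm) nn_integral_0_iff_AE) auto
  then have "AE x in (lborel :: (real^('n \<times> bool)) measure). False"
  proof (rule eventually_mono)
    show False if "ennreal (vol_density x) = 0" for x :: "real^('n \<times> bool)"
      using that vol_density_pos[of x] by (simp add: ennreal_eq_0_iff)
  qed
  then have "UNIV \<in> null_sets (lborel :: (real^('n \<times> bool)) measure)"
    by (subst AE_iff_null_sets) auto
  then show False by (simp add: null_sets_def emeasure_lborel_UNIV)
qed

section \<open>Invariant functions: global bounds and behaviour near a pole\<close>

lemma projective_bounded:
  fixes F :: "complex^'k \<Rightarrow> real"
  assumes "continuous_on (- {0}) F" and "\<And>\<xi> c. \<xi> \<noteq> 0 \<Longrightarrow> c \<noteq> 0 \<Longrightarrow> F (c *s \<xi>) = F \<xi>"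
  obtains B where "B \<ge> 0" "\<And>\<xi>. \<xi> \<noteq> 0 \<Longrightarrow> \<bar>F \<xi>\<bar> \<le> B"
proof -
  have "compact (F ` sphere 0 1)"
    by (intro compact_continuous_image continuous_on_subset[OF assms(1)]) auto
  then obtain B where B: "\<And>\<xi>. norm \<xi> = 1 \<Longrightarrow> \<bar>F \<xi>\<bar> \<le> B"
    using compact_imp_bounded by (fastforce simp: bounded_iff)
  have "\<bar>F \<xi>\<bar> \<le> \<bar>B\<bar>" if "\<xi> \<noteq> 0" for \<xi>
  proof -
    have "norm (of_real (1 / norm \<xi>) *s \<xi>) = 1" using that by (simp add: norm_scale_complex norm_divide)
    then have "\<bar>F (of_real (1 / norm \<xi>) *s \<xi>)\<bar> \<le> B" by (rule B)
    then show ?thesis using assms(2)[OF that, of "of_real (1 / norm \<xi>)"] that by simp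
  qed
  then show ?thesis using that[of "\<bar>B\<bar>"] by simp
qed

text \<open>Continuity at the vector \<open>p\<close> has to become continuity in the overlap t.
  Scale xi to unit length with the phase that makes its product with \<open>p\<close> equal to sqrt
  t; its squared distance to \<open>p\<close> is then 2 - 2 sqrt t, at most 2 (1 - t).\<close>

lemma projective_near:
  fixes p :: "complex^'k" and f :: "complex^'k \<Rightarrow> real"
  assumes p: "norm p = 1" and f: "isCont f p" and \<eta>: "\<eta> > 0"
    and inv: "\<And>\<xi> c. \<xi> \<noteq> 0 \<Longrightarrow> c \<noteq> 0 \<Longrightarrow> f (c *s \<xi>) = f \<xi>"
  obtains \<delta> where "\<delta> > 0" "\<And>\<xi>. \<xi> \<noteq> 0 \<Longrightarrow> overlap p \<xi> > 1 - \<delta> \<Longrightarrow> \<bar>f \<xi> - f p\<bar> < \<eta>"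
proof -
  obtain d where d: "d > 0" "\<And>x. dist x p < d \<Longrightarrow> dist (f x) (f p) < \<eta>"
    using f \<eta> unfolding continuous_at_eps_delta by (metis dist_commute)
  \<comment> \<open>The bound d^2/2 matches the estimate 2 (1 - t) < d^2. The bound 1 forces t > 0,
    so that the Hermitian product is nonzero and its phase can be divided out.\<close>
  define \<delta> where "\<delta> = min 1 (d\<^sup>2 / 2)"
  have "\<bar>f \<xi> - f p\<bar> < \<eta>" if \<xi>: "\<xi> \<noteq> 0" and o: "overlap p \<xi> > 1 - \<delta>" for \<xi>
  proof -
    define h where "h = herm \<xi> p"
    define c where "c = cnj h / of_real (cmod h * norm \<xi>)"
    have oh: "overlap p \<xi> = (cmod h / norm \<xi>)\<^sup>2"
      using p by (simp add: overlap_def h_def herm_commute[of p \<xi>])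
    have "overlap p \<xi> > 0" using o by (simp add: \<delta>_def min_def split: if_splits)
    then have h: "h \<noteq> 0" by (auto simp: oh)
    have c: "c \<noteq> 0" "cmod c = 1 / norm \<xi>" using h \<xi> by (auto simp: c_def norm_divide norm_mult)
    have n1: "norm (c *s \<xi>) = 1" using \<xi> by (simp add: norm_scale_complex c)
    have "herm (c *s \<xi>) p = of_real (cmod h / norm \<xi>)"
      using h \<xi> unfolding herm_scale_left h_def[symmetric] c_def
      by (simp add: complex_norm_square[symmetric] mult.commute[of "cnj h"] power2_eq_square)
    then have ip: "(c *s \<xi>) \<bullet> p = cmod h / norm \<xi>" by (simp add: inner_eq_Re_herm)
    have "cmod h / norm \<xi> \<le> 1"
      using overlap_le_1[of p \<xi>] unfolding oh by (simp add: power_le_one_iff abs_square_le_1)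
    then have "overlap p \<xi> \<le> cmod h / norm \<xi>"
      unfolding oh power2_eq_square using mult_right_mono[of "cmod h / norm \<xi>" 1 "cmod h / norm \<xi>"] by simp
    moreover have "1 - overlap p \<xi> < d\<^sup>2 / 2" using o by (simp add: \<delta>_def min_def split: if_splits)
    moreover have "(dist v p)\<^sup>2 = 2 - 2 * (v \<bullet> p)" if "norm v = 1" for v
      using that p unfolding dist_norm power2_norm_eq_inner norm_eq_1
      by (simp add: inner_diff_left inner_diff_right inner_commute[of p v])
    ultimately have "(dist (c *s \<xi>) p)\<^sup>2 < d\<^sup>2" using n1 ip by simp
    then have "dist (c *s \<xi>) p < d" using d(1) by (simp add: power_less_imp_less_base)
    then show ?thesis using d(2)[of "c *s \<xi>"] inv[OF \<xi> c(1)] by (simp add: dist_real_def)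
  qed
  moreover have "\<delta> > 0" using d by (simp add: \<delta>_def)
  ultimately show ?thesis using that by blast
qed

lemma projective_C2_const: "projective_C2 (\<lambda>_. c) (\<lambda>_ _. 0) (\<lambda>_ _ _. 0)"
  by unfold_locales auto

section \<open>Regularization of the Green function\<close>

lemma integrable_projective:
  fixes F :: "complex^('n::finite option) \<Rightarrow> real"
  assumes "continuous_on (- {0}) F" and "\<And>\<xi> c. \<xi> \<noteq> 0 \<Longrightarrow> c \<noteq> 0 \<Longrightarrow> F (c *s \<xi>) = F \<xi>"
  shows "integrable fs_measure (\<lambda>x. F (chart x))"
proof -
  have [measurable]: "(\<lambda>x. F (chart x)) \<in> borel_measurable borel"
    by (intro borel_measurable_continuous_onI continuous_on_compose2[OF assms(1) continuous_on_chart])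
      (auto simp: chart_nonzero)
  show ?thesis using integral_lift(1)[OF assms] by (subst integrable_fs_measure) auto
qed

definition regularized :: "nat \<Rightarrow> real \<Rightarrow> real \<Rightarrow> real" where
  "regularized n \<epsilon> t = green_profile n (1 + \<epsilon> - t)"

definition green_kernel :: "nat \<Rightarrow> real \<Rightarrow> real \<Rightarrow> real" where
  "green_kernel n \<epsilon> t = 2 * \<epsilon> * (\<Sum>j = 1..n. real (n + 1 - j) / (1 + \<epsilon> - t) ^ j + real j * t / (1 + \<epsilon> - t) ^ Suc j)"

lemma green_kernel_nonneg: "0 < \<epsilon> \<Longrightarrow> t \<in> {0..1} \<Longrightarrow> 0 \<le> green_kernel n \<epsilon> t"
  unfolding green_kernel_def by (intro mult_nonneg_nonneg sum_nonneg add_nonneg_nonneg divide_nonneg_nonneg) auto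

text \<open>Concentration at the pole: where t is at most 1 - delta, all denominators are bounded
  below by powers of delta, and the prefactor makes the kernel O(eps).\<close>

lemma green_kernel_le:
  assumes "0 < \<epsilon>" "t \<in> {0..1}" "0 < \<delta>" "t \<le> 1 - \<delta>"
  shows "green_kernel n \<epsilon> t \<le> \<epsilon> * (2 * (\<Sum>j = 1..n. real (n + 1 - j) / \<delta> ^ j + real j / \<delta> ^ Suc j))"
proof -
  have "\<delta> \<le> 1 + \<epsilon> - t" using assms by simp
  then have pw: "\<delta> ^ j \<le> (1 + \<epsilon> - t) ^ j" for j using assms(3) by (intro power_mono) auto
  have le: "real (n + 1 - j) / (1 + \<epsilon> - t) ^ j + real j * t / (1 + \<epsilon> - t) ^ Suc j
      \<le> real (n + 1 - j) / \<delta> ^ j + real j / \<delta> ^ Suc j" for j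
    using assms pw[of j] pw[of "Suc j"] by (intro add_mono frac_le) (auto simp: mult_left_le)
  have "green_kernel n \<epsilon> t \<le> 2 * \<epsilon> * (\<Sum>j = 1..n. real (n + 1 - j) / \<delta> ^ j + real j / \<delta> ^ Suc j)"
    unfolding green_kernel_def using assms(1) by (intro mult_left_mono sum_mono le) simp
  then show ?thesis by (simp add: mult_ac)
qed

lemma continuous_on_green_kernel: "0 < \<epsilon> \<Longrightarrow> continuous_on {0..1} (green_kernel n \<epsilon>)"
  unfolding green_kernel_def by (intro continuous_intros) auto

lemma green_profile_mono:
  assumes "n \<ge> 1" "0 < a" "a \<le> b" shows "green_profile n a \<le> green_profile n b"
proof (rule DERIV_nonneg_imp_nondecreasing[OF assms(3)])
  fix x assume "a \<le> x" "x \<le> b"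
  then have "(green_profile n has_real_derivative (\<Sum>j = 1..n. 1 / (2 * x ^ j))) (at x)"
    using assms by (intro has_derivative_green_profile) auto
  moreover have "0 \<le> (\<Sum>j = 1..n. 1 / (2 * x ^ j))"
    using \<open>a \<le> x\<close> assms by (intro sum_nonneg) auto
  ultimately show "\<exists>y. (green_profile n has_real_derivative y) (at x) \<and> 0 \<le> y" by blast
qed

text \<open>The profile is increasing, so for eps at most 1 every regularization lies between the
  singular profile and a constant. This sandwich provides the majorant for dominated convergence and
  the sign for monotone convergence.\<close>

lemma regularized_bounds:
  assumes "n \<ge> 1" "0 < \<epsilon>" "\<epsilon> \<le> 1" "t \<in> {0..1}"
  shows "regularized n \<epsilon> t \<le> green_profile n 2" "t < 1 \<Longrightarrow> green_profile n (1 - t) \<le> regularized n \<epsilon> t"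
  unfolding regularized_def using assms by (auto intro!: green_profile_mono)

lemma has_derivative_regularized:
  assumes "n \<ge> 1" "0 < \<epsilon>" "t \<in> {0..1}"
  shows "(regularized n \<epsilon> has_real_derivative (\<Sum>j = 1..n. - 1 / (2 * (1 + \<epsilon> - t) ^ j))) (at t)"
    "((\<lambda>t. \<Sum>j = 1..n. - 1 / (2 * (1 + \<epsilon> - t) ^ j)) has_real_derivative
      (\<Sum>j = 1..n. - real j / (2 * (1 + \<epsilon> - t) ^ Suc j))) (at t)"
proof -
  have u: "1 + \<epsilon> - t > 0" using assms by simp
  have d: "((\<lambda>t. 1 + \<epsilon> - t) has_real_derivative -1) (at t)" by (auto intro!: derivative_eq_intros)
  show "(regularized n \<epsilon> has_real_derivative (\<Sum>j = 1..n. - 1 / (2 * (1 + \<epsilon> - t) ^ j))) (at t)"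
    unfolding regularized_def[abs_def]
    by (rule DERIV_cong[OF DERIV_chain2[OF has_derivative_green_profile[OF u assms(1)] d]])
      (simp add: sum_negf)
  show "((\<lambda>t. \<Sum>j = 1..n. - 1 / (2 * (1 + \<epsilon> - t) ^ j)) has_real_derivative
      (\<Sum>j = 1..n. - real j / (2 * (1 + \<epsilon> - t) ^ Suc j))) (at t)"
  proof (rule DERIV_sum)
    fix j assume "j \<in> {1..n}"
    then obtain i where j: "j = Suc i" by (cases j) auto
    have e: "real i * (s ^ (i - Suc 0) * s) = real i * s ^ i" for s :: real
      by (cases i) auto
    have "((\<lambda>s. - 1 / (2 * s ^ j)) has_real_derivative real j / (2 * s ^ Suc j)) (at s)" if "s > 0" for s :: real
      using that unfolding j by (auto intro!: derivative_eq_intros simp: divide_simps e distrib_right)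
    note this[OF u]
    from DERIV_chain2[OF this d]
    show "((\<lambda>t. - 1 / (2 * (1 + \<epsilon> - t) ^ j)) has_real_derivative - real j / (2 * (1 + \<epsilon> - t) ^ Suc j)) (at t)"
      by simp
  qed
qed

lemma continuous_on_regularized: "n \<ge> 1 \<Longrightarrow> 0 < \<epsilon> \<Longrightarrow> continuous_on {0..1} (regularized n \<epsilon>)"
  by (rule DERIV_continuous_on[OF has_field_derivative_at_within[OF has_derivative_regularized(1)]])

context
  fixes p :: "complex^('n::finite option)"
  assumes p: "norm p = 1"
begin

lemma overlap_mem: "overlap p \<xi> \<in> {0..1}"
  using overlap_nonneg overlap_le_1 by auto

lemma continuous_on_overlap_compose:
  fixes g :: "real \<Rightarrow> real"
  assumes "continuous_on {0..1} g" shows "continuous_on (- {0}) (\<lambda>\<xi>. g (overlap p \<xi>))"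
  by (rule continuous_on_compose2[OF assms continuous_on_overlap[OF p]]) (use overlap_mem in auto)

lemma integrable_overlap:
  fixes g :: "real \<Rightarrow> real"
  assumes "continuous_on {0..1} g" shows "integrable fs_measure (\<lambda>x. g (overlap p (chart x)))"
  by (rule integrable_projective[of "\<lambda>\<xi>. g (overlap p \<xi>)"])
    (auto simp: overlap_scale intro!: continuous_on_overlap_compose assms)

lemma integrable_overlap_mult:
  fixes g :: "real \<Rightarrow> real"
  assumes "continuous_on {0..1} g" and F: "continuous_on (- {0}) F" "\<And>\<xi> c. \<xi> \<noteq> 0 \<Longrightarrow> c \<noteq> 0 \<Longrightarrow> F (c *s \<xi>) = F \<xi>"
  shows "integrable fs_measure (\<lambda>x. g (overlap p (chart x)) * F (chart x))"
  by (rule integrable_projective[of "\<lambda>\<xi>. g (overlap p \<xi>) * F \<xi>"])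
    (auto simp: overlap_scale F(2) intro!: continuous_on_mult continuous_on_overlap_compose assms F)

lemma measurable_overlap_chart [measurable]: "(\<lambda>x. overlap p (chart x)) \<in> borel_measurable borel"
  by (intro borel_measurable_continuous_onI continuous_on_compose2[OF continuous_on_overlap[OF p] continuous_on_chart])
    (auto simp: chart_nonzero)

lemma green_overlap:
  fixes F F' F'' :: "real \<Rightarrow> real"
  assumes F: "\<And>t. t \<in> {0..1} \<Longrightarrow> (F has_real_derivative F' t) (at t)"
    and F': "\<And>t. t \<in> {0..1} \<Longrightarrow> (F' has_real_derivative F'' t) (at t)"
    and F'': "continuous_on {0..1} F''"
    and f: "projective_C2 f D H"
  shows "(\<integral>x. F (overlap p (chart x)) * projective_C2.lap H (chart x) \<partial>fs_measure)
    = (\<integral>x. f (chart x) * (4 * (overlap p (chart x) * (1 - overlap p (chart x)) * F'' (overlap p (chart x))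
        + (1 - real (Suc CARD('n)) * overlap p (chart x)) * F' (overlap p (chart x)))) \<partial>fs_measure)"
proof -
  interpret f: projective_C2 f D H by fact
  note P = projective_C2_overlap[OF p F F' F'']
  have cF: "continuous_on {0..1} F"
    by (rule DERIV_continuous_on[OF has_field_derivative_at_within[OF F]])
  have cF': "continuous_on {0..1} F'"
    by (rule DERIV_continuous_on[OF has_field_derivative_at_within[OF F']])
  have card: "CARD('n option) = Suc CARD('n)" by simp
  let ?L = "\<lambda>t. 4 * (t * (1 - t) * F'' t + (1 - real (Suc CARD('n)) * t) * F' t)"
  have cL: "continuous_on {0..1} ?L" by (intro continuous_intros cF cF' F'')
  have m1: "(\<lambda>x. F (overlap p (chart x)) * f.lap (chart x)) \<in> borel_measurable borel"
    using integrable_overlap_mult[OF cF f.continuous_on_lap f.lap_scale]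
    by (auto dest!: borel_measurable_integrable)
  have m2: "(\<lambda>x. ?L (overlap p (chart x)) * f (chart x)) \<in> borel_measurable borel"
    using integrable_overlap_mult[OF cL f.continuous_on_f f.invariant]
    by (auto dest!: borel_measurable_integrable)
  have "(\<integral>x. F (overlap p (chart x)) * f.lap (chart x) \<partial>fs_measure) =
     (\<integral>x. F (overlap p (chart x)) * f.lap (chart x) * vol_density x \<partial>lborel)"
    by (rule integral_fs_measure[OF m1])
  also have "\<dots> = (\<integral>x. f (chart x) * ?L (overlap p (chart x)) * vol_density x \<partial>lborel)"
    using green_symmetric[OF P(1) f] P(2)[OF _ _ chart_nonzero] unfolding card by simp
  also have "\<dots> = (\<integral>x. f (chart x) * ?L (overlap p (chart x)) \<partial>fs_measure)"
    using integral_fs_measure[OF m2] by (simp only: mult.commute[of "f _"])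
  finally show ?thesis .
qed

lemma green_regularized:
  assumes "0 < \<epsilon>" and f: "projective_C2 f D H"
  shows "(\<integral>x. regularized CARD('n) \<epsilon> (overlap p (chart x)) * projective_C2.lap H (chart x) \<partial>fs_measure)
    = (\<integral>x. green_kernel CARD('n) \<epsilon> (overlap p (chart x)) * f (chart x) \<partial>fs_measure)
      - 2 * real CARD('n) * (\<integral>x. f (chart x) \<partial>fs_measure)"
proof -
  interpret f: projective_C2 f D H by fact
  let ?n = "CARD('n)"
  have n: "?n \<ge> 1" by (simp add: Suc_leI)
  have ode: "4 * (t * (1 - t) * (\<Sum>j = 1..?n. - real j / (2 * (1 + \<epsilon> - t) ^ Suc j))
      + (1 - real (Suc ?n) * t) * (\<Sum>j = 1..?n. - 1 / (2 * (1 + \<epsilon> - t) ^ j))) = green_kernel ?n \<epsilon> t - 2 * real ?n"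
    if "t \<in> {0..1}" for t
    using green_profile_ode[of \<epsilon> t ?n] that assms(1) by (simp only: green_kernel_def) simp
  have "(\<integral>x. regularized ?n \<epsilon> (overlap p (chart x)) * f.lap (chart x) \<partial>fs_measure)
    = (\<integral>x. f (chart x) * (green_kernel ?n \<epsilon> (overlap p (chart x)) - 2 * real ?n) \<partial>fs_measure)"
    unfolding ode[OF overlap_mem, symmetric]
  proof (rule green_overlap[OF _ _ _ f])
    show "continuous_on {0..1} (\<lambda>t. \<Sum>j = 1..?n. - real j / (2 * (1 + \<epsilon> - t) ^ Suc j))"
      using assms(1) by (intro continuous_intros) auto
  qed (use has_derivative_regularized[OF n assms(1)] in auto)
  also have "\<dots> = (\<integral>x. green_kernel ?n \<epsilon> (overlap p (chart x)) * f (chart x) - 2 * real ?n * f (chart x) \<partial>fs_measure)"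
    by (simp add: algebra_simps)
  also have "\<dots> = (\<integral>x. green_kernel ?n \<epsilon> (overlap p (chart x)) * f (chart x) \<partial>fs_measure)
      - 2 * real ?n * (\<integral>x. f (chart x) \<partial>fs_measure)"
    using integrable_overlap_mult[OF continuous_on_green_kernel[OF assms(1)] f.continuous_on_f f.invariant, of ?n]
      integrable_projective[OF f.continuous_on_f f.invariant]
    by (subst Bochner_Integration.integral_diff) auto
  finally show ?thesis .
qed

lemma integral_green_kernel:
  assumes "0 < \<epsilon>"
  shows "(\<integral>x. green_kernel CARD('n) \<epsilon> (overlap p (chart x)) \<partial>fs_measure) = 2 * real CARD('n) * fs_vol TYPE('n)"
  using green_regularized[OF assms projective_C2_const[of 1]]
  by (simp add: projective_C2.lap_def[OF projective_C2_const[of 1]] fs_vol_eq)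

end

section \<open>Removing the regularization\<close>

lemma inj_chart: "inj chart"
proof (rule injI)
  fix x y :: "real^('n::finite \<times> bool)"
  assume "chart x = chart y"
  then have "lift (0, x - y) = 0"
    by (simp add: chart_eq lift_def linear_diff[OF linear_chart_lin])
  then show "x = y" by (simp add: lift_eq_0_iff zero_prod_def)
qed

lemma regularized_antimono:
  assumes "n \<ge> 1" "0 < \<epsilon>" "\<epsilon> \<le> \<epsilon>'" "t \<in> {0..1}"
  shows "regularized n \<epsilon> t \<le> regularized n \<epsilon>' t"
  unfolding regularized_def using assms by (auto intro!: green_profile_mono)

lemma regularized_tendsto:
  assumes "n \<ge> 1" "t < 1"
  shows "(\<lambda>m. regularized n (1 / real (Suc m)) t) \<longlonglongrightarrow> green_profile n (1 - t)"
proof -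
  have "isCont (green_profile n) (1 - t)"
    using has_derivative_green_profile[of "1 - t" n] assms DERIV_isCont by auto
  moreover have "(\<lambda>m. 1 + 1 / real (Suc m) - t) \<longlonglongrightarrow> 1 + 0 - t"
    using LIMSEQ_Suc[OF lim_1_over_n] by (intro tendsto_intros) simp
  ultimately show ?thesis
    unfolding regularized_def using isCont_tendsto_compose by fastforce
qed

lemma measurable_green_profile [measurable]: "green_profile n \<in> borel_measurable borel"
  unfolding green_profile_def[abs_def] by measurable

context
  fixes p :: "complex^('n::finite option)"
  assumes p: "norm p = 1"
begin

text \<open>Overlap 1 means proportional to \<open>p\<close>, and the normalization of the
  coordinate \<open>None\<close> to 1 fixes the scalar, so the chart meets the pole in at most one
  point.\<close>

lemma AE_overlap_lt_1: "AE x in fs_measure. overlap p (chart x) < 1"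
proof -
  have pnz: "p \<noteq> 0" using p by auto
  have "x = y" if xy: "overlap p (chart x) = 1" "overlap p (chart y) = 1" for x y
  proof -
    obtain c where c: "chart x = c *s p" using overlap_eq_1D[OF pnz chart_nonzero xy(1)] .
    obtain d where d: "chart y = d *s p" using overlap_eq_1D[OF pnz chart_nonzero xy(2)] .
    have "c * p $ None = 1" "d * p $ None = 1"
      using arg_cong[OF c, of "\<lambda>v. v $ None"] arg_cong[OF d, of "\<lambda>v. v $ None"] by (simp_all add: chart_def)
    then have "c = d" by (metis mult_cancel_right mult_zero_right zero_neq_one)
    then have "chart x = chart y" using c d by simp
    then show ?thesis by (rule injD[OF inj_chart])
  qed
  then obtain x0 where "\<And>x. overlap p (chart x) = 1 \<Longrightarrow> x = x0" by metis
  moreover have "AE x in lborel. x \<noteq> x0" by (rule AE_lborel_singleton)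
  ultimately have "AE x in lborel. overlap p (chart x) \<noteq> 1" by (auto elim!: eventually_mono)
  then have "AE x in fs_measure. overlap p (chart x) \<noteq> 1" by (rule AE_fs_measure)
  then show ?thesis
    using overlap_le_1[of p] by (auto elim!: eventually_mono simp: less_le)
qed

text \<open>Testing the regularized identity with the overlap \<open>t\<close> itself bounds the integral of the
  regularized profile against \<open>(n + 1) * t - 1\<close>, uniformly in the regularization; this factor is
  positive near the pole, so monotone convergence applies.\<close>
lemma integrable_green_profile_overlap:
  "integrable fs_measure (\<lambda>x. green_profile CARD('n) (1 - overlap p (chart x)))"
proof -
  let ?n = "CARD('n)" and ?V = "fs_vol TYPE('n)"
  let ?T = "\<lambda>x::real^('n \<times> bool). overlap p (chart x)"
  have n: "?n \<ge> 1" by (simp add: Suc_leI)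
  \<comment> \<open>An upper bound of all regularizations used, since 1 + eps - t is at most 2; thus
    \<open>Q\<close> is nonnegative and increases with \<open>m\<close>.\<close>
  define K where "K = green_profile ?n 2"
  define \<epsilon> where "\<epsilon> m = 1 / real (Suc m)" for m
  have \<epsilon>: "0 < \<epsilon> m" "\<epsilon> m \<le> 1" "\<epsilon> (Suc m) \<le> \<epsilon> m" for m by (auto simp: \<epsilon>_def field_simps)
  define Q where "Q m x = K - regularized ?n (\<epsilon> m) (?T x)" for m x
  \<comment> \<open>The threshold is t = 5/8. Above it 4 ((n+1) t - 1) is at least 4 (2 * 5/8 - 1) =
    1 because n is at least 1; below it 1 - t exceeds 3/8 and \<open>Q\<close> is at most
    \<open>D\<close>. The 5 in \<open>boundQ\<close> comes from 1 - 4 ((n+1) t - 1) being at most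
    5.\<close>
  define D where "D = K - green_profile ?n (3/8)"
  have D: "D \<ge> 0" unfolding D_def K_def using n by (simp add: green_profile_mono)
  note T = overlap_mem[OF p]
  have Q0: "0 \<le> Q m x" for m x
    using regularized_bounds(1)[OF n \<epsilon>(1,2) T] by (simp add: Q_def K_def)
  note creg = continuous_on_regularized[OF n \<epsilon>(1)]
  have intQ: "integrable fs_measure (Q m)" for m
    unfolding Q_def using integrable_overlap[OF p creg] by (intro Bochner_Integration.integrable_diff) auto
  have monoQ: "mono (\<lambda>m. Q m x)" for x
    unfolding mono_iff_le_Suc Q_def using regularized_antimono[OF n \<epsilon>(1,3) T] by simp
  let ?g = "\<lambda>x. real (Suc ?n) * ?T x - 1"
  have intg: "integrable fs_measure ?g"
    by (rule integrable_overlap[OF p, of "\<lambda>t. real (Suc ?n) * t - 1"]) (intro continuous_intros)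
  have intQg: "integrable fs_measure (\<lambda>x. Q m x * ?g x)" for m
    unfolding Q_def
    by (rule integrable_overlap[OF p, of "\<lambda>t. (K - regularized ?n (\<epsilon> m) t) * (real (Suc ?n) * t - 1)"])
      (intro continuous_intros creg n)
  have pT: "projective_C2 (\<lambda>\<xi>. overlap p \<xi>) (\<lambda>\<xi> v. 1 * overlap_deriv p \<xi> v)
      (\<lambda>\<xi> v w. 0 * overlap_deriv p \<xi> w * overlap_deriv p \<xi> v + 1 * overlap_deriv2 p \<xi> v w)"
    by (rule projective_C2_overlap(1)[OF p, of "\<lambda>t. t" "\<lambda>_. 1" "\<lambda>_. 0"]) (auto intro!: derivative_eq_intros)
  have lapT: "projective_C2.lap (\<lambda>\<xi> v w. 0 * overlap_deriv p \<xi> w * overlap_deriv p \<xi> v + 1 * overlap_deriv2 p \<xi> v w) (chart x)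
      = - 4 * ?g x" for x
    by (subst projective_C2_overlap(2)[OF p, of "\<lambda>t. t" "\<lambda>_. 1" "\<lambda>_. 0"])
      (auto intro!: derivative_eq_intros simp: chart_nonzero)
  \<comment> \<open>Symmetry against the constant 1: the Laplacian of t has mean zero. This
    eliminates the constant \<open>K\<close> in the next bound.\<close>
  have g0: "(\<integral>x. ?g x \<partial>fs_measure) = 0"
  proof -
    have "(\<integral>x. ?T x * projective_C2.lap (\<lambda>_ _ _. 0) (chart x) \<partial>fs_measure)
      = (\<integral>x. 1 * (4 * (?T x * (1 - ?T x) * 0 + (1 - real (Suc ?n) * ?T x) * 1)) \<partial>fs_measure)"
      by (rule green_overlap[where F = "\<lambda>t. t" and F' = "\<lambda>_. 1" and F'' = "\<lambda>_. 0", OF p _ _ _ projective_C2_const])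
        (auto intro!: derivative_eq_intros)
    then have "0 = (\<integral>x. - 4 * ?g x \<partial>fs_measure)"
      by (simp add: projective_C2.lap_def[OF projective_C2_const[of 1]])
    also have "\<dots> = - 4 * (\<integral>x. ?g x \<partial>fs_measure)" by (rule integral_mult_right_zero)
    finally show ?thesis by simp
  qed
  \<comment> \<open>With t as test function the kernel term is at most the total mass 2n vol and the
    remaining term has a favourable sign; the 4 in \<open>lapT\<close> turns 2n into n/2.\<close>
  have boundQg: "(\<integral>x. Q m x * ?g x \<partial>fs_measure) \<le> real ?n / 2 * ?V" for m
  proof -
    have intT: "integrable fs_measure ?T" using integrable_overlap[OF p, of "\<lambda>t. t"] by simp
    have intk: "integrable fs_measure (\<lambda>x. green_kernel ?n (\<epsilon> m) (?T x))"
      using integrable_overlap[OF p continuous_on_green_kernel[OF \<epsilon>(1)]] .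
    have intkT: "integrable fs_measure (\<lambda>x. green_kernel ?n (\<epsilon> m) (?T x) * ?T x)"
      using integrable_overlap_mult[OF p continuous_on_green_kernel[OF \<epsilon>(1)] continuous_on_overlap[OF p]] by (simp add: overlap_scale)
    have "(\<integral>x. regularized ?n (\<epsilon> m) (?T x) * (- 4 * ?g x) \<partial>fs_measure)
        = (\<integral>x. green_kernel ?n (\<epsilon> m) (?T x) * ?T x \<partial>fs_measure) - 2 * real ?n * (\<integral>x. ?T x \<partial>fs_measure)"
      using green_regularized[OF p \<epsilon>(1) pT] unfolding lapT .
    also have "\<dots> \<le> 2 * real ?n * ?V"
    proof -
      have "(\<integral>x. green_kernel ?n (\<epsilon> m) (?T x) * ?T x \<partial>fs_measure) \<le> (\<integral>x. green_kernel ?n (\<epsilon> m) (?T x) \<partial>fs_measure)"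
        using green_kernel_nonneg[OF \<epsilon>(1) T] overlap_le_1[of p]
        by (intro integral_mono intk intkT) (auto simp: mult_left_le)
      moreover have "0 \<le> (\<integral>x. ?T x \<partial>fs_measure)" by (simp add: overlap_nonneg)
      then have "0 \<le> 2 * real ?n * (\<integral>x. ?T x \<partial>fs_measure)" by simp
      ultimately show ?thesis unfolding integral_green_kernel[OF p \<epsilon>(1)] by linarith
    qed
    finally have "(\<integral>x. regularized ?n (\<epsilon> m) (?T x) * (- 4 * ?g x) \<partial>fs_measure) \<le> 2 * real ?n * ?V" .
    moreover have "(\<integral>x. 4 * (Q m x * ?g x) \<partial>fs_measure)
        = (\<integral>x. 4 * K * ?g x + regularized ?n (\<epsilon> m) (?T x) * (- 4 * ?g x) \<partial>fs_measure)"
      by (rule Bochner_Integration.integral_cong) (simp_all add: Q_def algebra_simps)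
    moreover have "integrable fs_measure (\<lambda>x. regularized ?n (\<epsilon> m) (?T x) * (- 4 * ?g x))"
      by (rule integrable_overlap[OF p, of "\<lambda>t. regularized ?n (\<epsilon> m) t * (- 4 * (real (Suc ?n) * t - 1))"])
        (intro continuous_intros creg n)
    then have "(\<integral>x. 4 * K * ?g x + regularized ?n (\<epsilon> m) (?T x) * (- 4 * ?g x) \<partial>fs_measure) = 4 * K * (\<integral>x. ?g x \<partial>fs_measure) + (\<integral>x. regularized ?n (\<epsilon> m) (?T x) * (- 4 * ?g x) \<partial>fs_measure)"
      using intg by (subst Bochner_Integration.integral_add) auto
    ultimately show ?thesis using g0 by simp
  qed
  have boundQ: "(\<integral>x. Q m x \<partial>fs_measure) \<le> 2 * real ?n * ?V + 5 * D * ?V" for m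
  proof -
    have "Q m x \<le> 4 * (Q m x * ?g x) + 5 * D" for x
    proof (cases "?T x \<ge> 5/8")
      case True
      have "real (Suc ?n) * ?T x \<ge> 2 * (5/8)" using True n by (intro mult_mono) auto
      then have "1 \<le> 4 * ?g x" by simp
      then have "Q m x * 1 \<le> Q m x * (4 * ?g x)" by (intro mult_left_mono Q0)
      moreover have "Q m x * (4 * ?g x) = 4 * (Q m x * ?g x)" by (simp only: mult.left_commute)
      ultimately show ?thesis using D by linarith
    next
      case False
      have "green_profile ?n (3/8) \<le> regularized ?n (\<epsilon> m) (?T x)"
        unfolding regularized_def using False \<epsilon>[of m] n by (intro green_profile_mono) auto
      then have QD: "Q m x \<le> D" by (simp add: Q_def D_def)
      have "1 - 4 * ?g x \<le> 5" using overlap_nonneg[of p "chart x"] by simp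
      then have "Q m x * (1 - 4 * ?g x) \<le> Q m x * 5" by (intro mult_left_mono Q0)
      then show ?thesis using QD by (simp add: algebra_simps)
    qed
    then have "(\<integral>x. Q m x \<partial>fs_measure) \<le> (\<integral>x. 4 * (Q m x * ?g x) + 5 * D \<partial>fs_measure)"
      using intQg by (intro integral_mono intQ Bochner_Integration.integrable_add integrable_mult_right) auto
    also have "\<dots> = 4 * (\<integral>x. Q m x * ?g x \<partial>fs_measure) + 5 * D * ?V"
      using intQg[of m] by (subst Bochner_Integration.integral_add) (auto simp: fs_vol_eq)
    finally show ?thesis using boundQg[of m] by simp
  qed
  have "incseq (\<lambda>m. \<integral>x. Q m x \<partial>fs_measure)"
    using monoQ by (intro incseq_SucI integral_mono intQ) (auto simp: mono_iff_le_Suc)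
  then obtain L where L: "(\<lambda>m. \<integral>x. Q m x \<partial>fs_measure) \<longlonglongrightarrow> L"
    using incseq_convergent boundQ by metis
  have "integrable fs_measure (\<lambda>x. K - green_profile ?n (1 - ?T x))"
  proof (rule integral_monotone_convergence_nonneg(1)[OF intQ _ _ _ L])
    show "AE x in fs_measure. (\<lambda>m. Q m x) \<longlonglongrightarrow> K - green_profile ?n (1 - ?T x)"
      using AE_overlap_lt_1
      unfolding Q_def \<epsilon>_def by eventually_elim (intro tendsto_intros regularized_tendsto[OF n])
    show "(\<lambda>x. K - green_profile ?n (1 - ?T x)) \<in> borel_measurable fs_measure"
      using measurable_overlap_chart[OF p] by measurable
  qed (use monoQ Q0 in auto)
  then have "integrable fs_measure (\<lambda>x. K - (K - green_profile ?n (1 - ?T x)))"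
    by (rule Bochner_Integration.integrable_diff[rotated]) simp
  then show ?thesis by simp
qed

text \<open>By \<open>regularized_bounds\<close> each regularization is at most |P(1-t)| + |P(2)| in
  absolute value, and \<open>F\<close> is bounded by compactness. This majorant is integrable and
  independent of \<open>m\<close>.\<close>

lemma integral_green_profile_mult:
  fixes F :: "complex^('n option) \<Rightarrow> real"
  assumes F: "continuous_on (- {0}) F" "\<And>\<xi> c. \<xi> \<noteq> 0 \<Longrightarrow> c \<noteq> 0 \<Longrightarrow> F (c *s \<xi>) = F \<xi>"
  shows "integrable fs_measure (\<lambda>x. green_profile CARD('n) (1 - overlap p (chart x)) * F (chart x))"
    and "(\<lambda>m. \<integral>x. regularized CARD('n) (1 / real (Suc m)) (overlap p (chart x)) * F (chart x) \<partial>fs_measure)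
      \<longlonglongrightarrow> (\<integral>x. green_profile CARD('n) (1 - overlap p (chart x)) * F (chart x) \<partial>fs_measure)"
proof -
  let ?n = "CARD('n)" and ?T = "\<lambda>x::real^('n \<times> bool). overlap p (chart x)"
  have n: "?n \<ge> 1" by (simp add: Suc_leI)
  obtain B where B: "B \<ge> 0" "\<And>\<xi>. \<xi> \<noteq> 0 \<Longrightarrow> \<bar>F \<xi>\<bar> \<le> B" using projective_bounded[OF F] by blast
  define K where "K = green_profile ?n 2"
  let ?w = "\<lambda>x. (\<bar>green_profile ?n (1 - ?T x)\<bar> + \<bar>K\<bar>) * B"
  have w: "integrable fs_measure ?w"
    using integrable_green_profile_overlap
    by (intro integrable_mult_left Bochner_Integration.integrable_add integrable_abs) auto
  have meas: "(\<lambda>x. F (chart x)) \<in> borel_measurable fs_measure"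
    using integrable_projective[OF F] by (rule borel_measurable_integrable)
  have m1: "(\<lambda>x. green_profile ?n (1 - ?T x) * F (chart x)) \<in> borel_measurable fs_measure"
    using borel_measurable_integrable[OF integrable_green_profile_overlap] meas by (rule borel_measurable_times)
  have m2: "(\<lambda>x. regularized ?n (1 / real (Suc m)) (?T x) * F (chart x)) \<in> borel_measurable fs_measure" for m
    using integrable_overlap_mult[OF p continuous_on_regularized[OF n, of "1 / real (Suc m)"] F]
    by (intro borel_measurable_integrable) simp
  have lim: "AE x in fs_measure. (\<lambda>m. regularized ?n (1 / real (Suc m)) (?T x) * F (chart x))
      \<longlonglongrightarrow> green_profile ?n (1 - ?T x) * F (chart x)"
    using AE_overlap_lt_1 by eventually_elim (intro tendsto_intros regularized_tendsto[OF n])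
  have bound: "AE x in fs_measure. norm (regularized ?n (1 / real (Suc m)) (?T x) * F (chart x)) \<le> ?w x" for m
    using AE_overlap_lt_1
  proof eventually_elim
    case (elim x)
    have "regularized ?n (1 / real (Suc m)) (?T x) \<le> K" "green_profile ?n (1 - ?T x) \<le> regularized ?n (1 / real (Suc m)) (?T x)"
      using regularized_bounds[OF n, of "1 / real (Suc m)" "?T x"] overlap_mem[OF p, of "chart x"] elim
      by (simp_all add: K_def)
    then have "\<bar>regularized ?n (1 / real (Suc m)) (?T x)\<bar> \<le> \<bar>green_profile ?n (1 - ?T x)\<bar> + \<bar>K\<bar>" by linarith
    then show ?case unfolding real_norm_def abs_mult using B chart_nonzero by (intro mult_mono) auto
  qed
  show "integrable fs_measure (\<lambda>x. green_profile ?n (1 - ?T x) * F (chart x))"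
    by (rule integrable_dominated_convergence[OF m1 m2 w lim bound])
  show "(\<lambda>m. \<integral>x. regularized ?n (1 / real (Suc m)) (?T x) * F (chart x) \<partial>fs_measure)
      \<longlonglongrightarrow> (\<integral>x. green_profile ?n (1 - ?T x) * F (chart x) \<partial>fs_measure)"
    by (rule integral_dominated_convergence[OF m1 m2 w lim bound])
qed

end

section \<open>The representation formula\<close>

context
  fixes p :: "complex^('n::finite option)"
  assumes p: "norm p = 1"
begin

text \<open>The kernels form an approximate identity: nonnegative, of constant mass, and O(eps) away
  from the pole. Subtracting \<open>F p\<close> is exact because the mass does not depend on
  eps.\<close>

lemma integral_green_kernel_tendsto:
  fixes F :: "complex^('n option) \<Rightarrow> real"
  assumes F: "continuous_on (- {0}) F" "\<And>\<xi> c. \<xi> \<noteq> 0 \<Longrightarrow> c \<noteq> 0 \<Longrightarrow> F (c *s \<xi>) = F \<xi>"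
  shows "(\<lambda>m. \<integral>x. green_kernel CARD('n) (1 / real (Suc m)) (overlap p (chart x)) * F (chart x) \<partial>fs_measure)
    \<longlonglongrightarrow> 2 * real CARD('n) * fs_vol TYPE('n) * F p"
proof -
  let ?n = "CARD('n)" and ?V = "fs_vol TYPE('n)" and ?T = "\<lambda>x::real^('n \<times> bool). overlap p (chart x)"
  define \<epsilon> where "\<epsilon> m = 1 / real (Suc m)" for m
  have \<epsilon>: "0 < \<epsilon> m" for m by (simp add: \<epsilon>_def)
  have pnz: "p \<noteq> 0" using p by auto
  let ?k = "\<lambda>m x. green_kernel ?n (\<epsilon> m) (?T x)"
  define A where "A = 2 * real ?n * ?V"
  have A: "A \<ge> 0" using fs_vol_pos[where 'n = 'n] by (simp add: A_def)
  obtain B where B: "B \<ge> 0" "\<And>\<xi>. \<xi> \<noteq> 0 \<Longrightarrow> \<bar>F \<xi>\<bar> \<le> B" using projective_bounded[OF F] by blast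
  have isc: "isCont F p" using F(1) pnz by (simp add: continuous_on_eq_continuous_at open_Compl)
  have ik: "integrable fs_measure (?k m)" for m
    using integrable_overlap[OF p continuous_on_green_kernel[OF \<epsilon>]] .
  have ikF: "integrable fs_measure (\<lambda>x. ?k m x * F (chart x))" for m
    using integrable_overlap_mult[OF p continuous_on_green_kernel[OF \<epsilon>] F] .
  have iX: "integrable fs_measure (\<lambda>x. ?k m x * (F (chart x) - F p))" for m
    unfolding right_diff_distrib by (intro Bochner_Integration.integrable_diff ikF integrable_mult_left ik)
  define X where "X m = (\<integral>x. ?k m x * (F (chart x) - F p) \<partial>fs_measure)" for m
  have X: "(\<integral>x. ?k m x * F (chart x) \<partial>fs_measure) = X m + A * F p" for m
    using ik[of m] ikF[of m] integral_green_kernel[OF p \<epsilon>]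
    by (simp add: X_def A_def right_diff_distrib)
  have "X \<longlonglongrightarrow> 0"
  proof (rule LIMSEQ_I)
    fix r :: real assume r: "0 < r"
    \<comment> \<open>Half of \<open>r\<close> pays for the neighbourhood of the pole, which carries
      at most the mass \<open>A\<close>; the added 1 keeps the denominator positive.\<close>
    define \<eta> where "\<eta> = r / (2 * (A + 1))"
    have \<eta>: "\<eta> > 0" "\<eta> * A < r / 2" using r A by (auto simp: \<eta>_def field_simps)
    obtain \<delta> where \<delta>: "\<delta> > 0" "\<And>\<xi>. \<xi> \<noteq> 0 \<Longrightarrow> overlap p \<xi> > 1 - \<delta> \<Longrightarrow> \<bar>F \<xi> - F p\<bar> < \<eta>"
      using projective_near[OF p isc \<eta>(1) F(2)] by blast
    define C where "C = 2 * (\<Sum>j = 1..?n. real (?n + 1 - j) / \<delta> ^ j + real j / \<delta> ^ Suc j)"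
    have C: "C \<ge> 0" unfolding C_def using \<delta>(1) by (intro mult_nonneg_nonneg sum_nonneg add_nonneg_nonneg) auto
    have pw: "\<bar>?k m x * (F (chart x) - F p)\<bar> \<le> \<eta> * ?k m x + \<epsilon> m * (C * (2 * B))" for m x
    proof -
      have k: "0 \<le> ?k m x" by (rule green_kernel_nonneg[OF \<epsilon> overlap_mem[OF p]])
      have abs: "\<bar>?k m x * (F (chart x) - F p)\<bar> = ?k m x * \<bar>F (chart x) - F p\<bar>"
        using k by (simp add: abs_mult)
      show ?thesis
      proof (cases "?T x > 1 - \<delta>")
        case True
        have "?k m x * \<bar>F (chart x) - F p\<bar> \<le> \<eta> * ?k m x"
          unfolding mult.commute[of \<eta>] using \<delta>(2)[OF chart_nonzero True] by (intro mult_left_mono k) simp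
        moreover have "0 \<le> \<epsilon> m * (C * (2 * B))" using \<epsilon>[of m] B(1) C by simp
        ultimately show ?thesis unfolding abs by linarith
      next
        case False
        have "?k m x \<le> \<epsilon> m * C"
          unfolding C_def using False \<delta>(1) by (intro green_kernel_le[OF \<epsilon> overlap_mem[OF p]]) auto
        moreover have "\<bar>F (chart x) - F p\<bar> \<le> 2 * B"
          using B(2)[OF chart_nonzero, of x] B(2)[OF pnz] by linarith
        ultimately have "?k m x * \<bar>F (chart x) - F p\<bar> \<le> (\<epsilon> m * C) * (2 * B)"
          using k by (intro mult_mono) auto
        moreover have "0 \<le> \<eta> * ?k m x" using k \<eta> by simp
        ultimately show ?thesis unfolding abs mult.assoc by linarith
      qed
    qed
    have "\<bar>X m\<bar> \<le> \<eta> * A + \<epsilon> m * (C * (2 * B) * ?V)" for m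
    proof -
      have "\<bar>X m\<bar> \<le> (\<integral>x. \<bar>?k m x * (F (chart x) - F p)\<bar> \<partial>fs_measure)"
        unfolding X_def by (rule integral_abs_bound)
      also have "\<dots> \<le> (\<integral>x. \<eta> * ?k m x + \<epsilon> m * (C * (2 * B)) \<partial>fs_measure)"
        using ik[of m] by (intro integral_mono integrable_abs iX pw Bochner_Integration.integrable_add integrable_mult_right) auto
      also have "\<dots> = \<eta> * A + \<epsilon> m * (C * (2 * B) * ?V)"
        using ik[of m] integral_green_kernel[OF p \<epsilon>]
        by (subst Bochner_Integration.integral_add) (auto simp: A_def fs_vol_eq mult_ac)
      finally show ?thesis .
    qed
    moreover have "(\<lambda>m. \<epsilon> m * (C * (2 * B) * ?V)) \<longlonglongrightarrow> 0"
      unfolding \<epsilon>_def using LIMSEQ_Suc[OF lim_1_over_n] by (intro tendsto_mult_left_zero) simp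
    then have "\<forall>\<^sub>F m in sequentially. \<epsilon> m * (C * (2 * B) * ?V) < r / 2"
      using r by (intro order_tendstoD(2)) auto
    then obtain M where "\<And>m. m \<ge> M \<Longrightarrow> \<epsilon> m * (C * (2 * B) * ?V) < r / 2"
      by (auto simp: eventually_sequentially)
    ultimately have "\<forall>m\<ge>M. norm (X m - 0) < r"
      using \<eta>(2) by (smt (verit) diff_zero field_sum_of_halves real_norm_def)
    then show "\<exists>M. \<forall>m\<ge>M. norm (X m - 0) < r" by blast
  qed
  then have "(\<lambda>m. X m + A * F p) \<longlonglongrightarrow> 0 + A * F p" by (intro tendsto_intros)
  then show ?thesis unfolding \<epsilon>_def[symmetric] X by (simp add: A_def)
qed

lemma green_formula:
  assumes f: "projective_C2 f D H"
  shows "(\<integral>x. green_profile CARD('n) (1 - overlap p (chart x)) * projective_C2.lap H (chart x) \<partial>fs_measure)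
    = 2 * real CARD('n) * fs_vol TYPE('n) * f p - 2 * real CARD('n) * (\<integral>x. f (chart x) \<partial>fs_measure)"
proof -
  interpret f: projective_C2 f D H by fact
  have "(\<lambda>m. \<integral>x. regularized CARD('n) (1 / real (Suc m)) (overlap p (chart x)) * f.lap (chart x) \<partial>fs_measure)
      \<longlonglongrightarrow> (\<integral>x. green_profile CARD('n) (1 - overlap p (chart x)) * f.lap (chart x) \<partial>fs_measure)"
    by (rule integral_green_profile_mult(2)[OF p f.continuous_on_lap f.lap_scale])
  moreover have "(\<lambda>m. \<integral>x. regularized CARD('n) (1 / real (Suc m)) (overlap p (chart x)) * f.lap (chart x) \<partial>fs_measure)
      \<longlonglongrightarrow> 2 * real CARD('n) * fs_vol TYPE('n) * f p - 2 * real CARD('n) * (\<integral>x. f (chart x) \<partial>fs_measure)"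
  proof -
    have pos: "0 < 1 / real (Suc m)" for m by simp
    show ?thesis
      unfolding green_regularized[OF p pos f]
      by (intro tendsto_intros integral_green_kernel_tendsto f.continuous_on_f f.invariant)
  qed
  ultimately show ?thesis by (rule LIMSEQ_unique)
qed

text \<open>The Laplacian of t^(k+1) is 4 (k+1) ((k+1) t^k - (k+1+n) t^(k+1)), and its integral
  vanishes by symmetry against the constant 1.\<close>

lemma overlap_moment_Suc:
  "(real k + 1 + real CARD('n)) * (\<integral>x. overlap p (chart x) ^ Suc k \<partial>fs_measure)
    = (real k + 1) * (\<integral>x. overlap p (chart x) ^ k \<partial>fs_measure)"
proof -
  let ?T = "\<lambda>x::real^('n \<times> bool). overlap p (chart x)" and ?n = "real CARD('n)"
  have int: "integrable fs_measure (\<lambda>x. ?T x ^ j)" for j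
    by (rule integrable_overlap[OF p, of "\<lambda>t. t ^ j"]) (intro continuous_intros)
  \<comment> \<open>At k = 0 the truncated exponent is 0 instead of -1, but the factor
    \<open>real k\<close> removes the term.\<close>
  have kt: "real k * t ^ (k - Suc 0) * t = real k * t ^ k" for t :: real by (cases k) auto
  have "(\<integral>x. ?T x ^ Suc k * projective_C2.lap (\<lambda>_ _ _. 0) (chart x) \<partial>fs_measure)
      = (\<integral>x. 1 * (4 * (?T x * (1 - ?T x) * ((real k + 1) * (real k * ?T x ^ (k - 1)))
        + (1 - real (Suc CARD('n)) * ?T x) * ((real k + 1) * ?T x ^ k))) \<partial>fs_measure)"
    by (rule green_overlap[where F = "\<lambda>t. t ^ Suc k" and F' = "\<lambda>t. (real k + 1) * t ^ k"
        and F'' = "\<lambda>t. (real k + 1) * (real k * t ^ (k - 1))", OF p _ _ _ projective_C2_const])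
      (auto intro!: derivative_eq_intros continuous_intros simp: kt distrib_right)
  also have "(\<lambda>x. 1 * (4 * (?T x * (1 - ?T x) * ((real k + 1) * (real k * ?T x ^ (k - 1)))
        + (1 - real (Suc CARD('n)) * ?T x) * ((real k + 1) * ?T x ^ k))))
      = (\<lambda>x. 4 * (real k + 1) * ((real k + 1) * ?T x ^ k - (real k + 1 + ?n) * ?T x ^ Suc k))"
  proof
    fix x
    have "?T x * (1 - ?T x) * ((real k + 1) * (real k * ?T x ^ (k - 1))) = (1 - ?T x) * ((real k + 1) * (real k * ?T x ^ k))"
      unfolding kt[of "?T x", symmetric] by (simp add: mult_ac)
    then show "1 * (4 * (?T x * (1 - ?T x) * ((real k + 1) * (real k * ?T x ^ (k - 1)))
        + (1 - real (Suc CARD('n)) * ?T x) * ((real k + 1) * ?T x ^ k)))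
      = 4 * (real k + 1) * ((real k + 1) * ?T x ^ k - (real k + 1 + ?n) * ?T x ^ Suc k)"
      by (simp only:) (simp add: algebra_simps)
  qed
  finally have "0 = (\<integral>x. 4 * (real k + 1) * ((real k + 1) * ?T x ^ k - (real k + 1 + ?n) * ?T x ^ Suc k) \<partial>fs_measure)"
    by (simp only: projective_C2.lap_def[OF projective_C2_const[of 1]]) simp
  also have "\<dots> = 4 * (real k + 1) * (\<integral>x. (real k + 1) * ?T x ^ k - (real k + 1 + ?n) * ?T x ^ Suc k \<partial>fs_measure)"
    by (rule integral_mult_right_zero)
  also have "(\<integral>x. (real k + 1) * ?T x ^ k - (real k + 1 + ?n) * ?T x ^ Suc k \<partial>fs_measure)
    = (real k + 1) * (\<integral>x. ?T x ^ k \<partial>fs_measure) - (real k + 1 + ?n) * (\<integral>x. ?T x ^ Suc k \<partial>fs_measure)"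
    by (subst Bochner_Integration.integral_diff; (intro integrable_mult_right int)?)
      (simp only: integral_mult_right_zero)
  finally show ?thesis by simp
qed

end

text \<open>The moments of the overlap do not depend on the base point; by density of the Bernstein
  polynomials neither does its distribution, so unitary invariance of the measure is not needed.\<close>
lemma overlap_distribution_eq:
  fixes p q :: "complex^('n::finite option)" and g :: "real \<Rightarrow> real"
  assumes p: "norm p = 1" and q: "norm q = 1" and g: "continuous_on {0..1} g"
  shows "(\<integral>x. g (overlap p (chart x)) \<partial>fs_measure) = (\<integral>x. g (overlap q (chart x)) \<partial>fs_measure)"
proof -
  let ?I = "\<lambda>p h. (\<integral>x. h (overlap p (chart x)) \<partial>(fs_measure :: (real^('n \<times> bool)) measure)) :: real"
  let ?V = "fs_vol TYPE('n)"
  have mom: "?I p (\<lambda>t. t ^ k) = ?I q (\<lambda>t. t ^ k)" for k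
  proof (induction k)
    case (Suc k)
    have "(real k + 1 + real CARD('n)) * ?I p (\<lambda>t. t ^ Suc k) = (real k + 1 + real CARD('n)) * ?I q (\<lambda>t. t ^ Suc k)"
      using overlap_moment_Suc[OF p, of k] overlap_moment_Suc[OF q, of k] Suc by simp
    moreover have "real k + 1 + real CARD('n) \<noteq> 0" by linarith
    ultimately show ?case by (simp only: mult_cancel_left simp_thms)
  qed simp
  \<comment> \<open>Up to binomial factors these are the Bernstein polynomials. They reduce to
    moments via t^k (1-t)^(m+1) = t^k (1-t)^m - t^(k+1) (1-t)^m.\<close>
  have mono: "?I p (\<lambda>t. t ^ k * (1 - t) ^ m) = ?I q (\<lambda>t. t ^ k * (1 - t) ^ m)" for k m
  proof (induction m arbitrary: k)
    case 0
    show ?case using mom by simp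
  next
    case (Suc m)
    have "?I r (\<lambda>t. t ^ k * (1 - t) ^ Suc m) = ?I r (\<lambda>t. t ^ k * (1 - t) ^ m) - ?I r (\<lambda>t. t ^ Suc k * (1 - t) ^ m)"
      if r: "norm r = 1" for r
    proof -
      have int: "integrable fs_measure (\<lambda>x. overlap r (chart x) ^ j * (1 - overlap r (chart x)) ^ m)" for j
        by (rule integrable_overlap[OF r, of "\<lambda>t. t ^ j * (1 - t) ^ m"]) (intro continuous_intros)
      show ?thesis
        by (subst Bochner_Integration.integral_diff[symmetric, OF int int]) (simp add: algebra_simps)
    qed
    from this[OF p] this[OF q] show ?case by (simp only: Suc)
  qed
  have close: "\<bar>?I p g - ?I q g\<bar> \<le> e * (2 * ?V)" if e: "e > 0" for e
  proof -
    obtain N where N: "\<And>t. t \<in> {0..1} \<Longrightarrow> \<bar>g t - (\<Sum>k\<le>N. g (k / N) * Bernstein N k t)\<bar> < e"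
      using Bernstein_Weierstrass[OF g e] by blast
    let ?b = "\<lambda>t. \<Sum>k\<le>N. g (k / N) * Bernstein N k t"
    have cb: "continuous_on {0..1} ?b" unfolding Bernstein_def by (intro continuous_intros)
    have 1: "\<bar>?I r g - ?I r ?b\<bar> \<le> e * ?V" if r: "norm r = 1" for r
    proof -
      note int = integrable_overlap[OF r g] integrable_overlap[OF r cb]
      have "\<bar>?I r g - ?I r ?b\<bar> = \<bar>?I r (\<lambda>t. g t - ?b t)\<bar>"
        by (subst Bochner_Integration.integral_diff[OF int]) simp
      also have "\<dots> \<le> (\<integral>x. \<bar>g (overlap r (chart x)) - ?b (overlap r (chart x))\<bar> \<partial>(fs_measure :: (real^('n \<times> bool)) measure))"
        by (rule integral_abs_bound)
      also have "\<dots> \<le> (\<integral>x. e \<partial>(fs_measure :: (real^('n \<times> bool)) measure))"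
        by (intro integral_mono integrable_abs Bochner_Integration.integrable_diff int less_imp_le[OF N] overlap_mem[OF r]) simp
      also have "\<dots> = e * ?V" by (simp add: fs_vol_eq)
      finally show ?thesis .
    qed
    have 2: "?I p ?b = ?I q ?b"
    proof -
      have "?I r ?b = (\<Sum>k\<le>N. g (k / N) * (real (N choose k) * ?I r (\<lambda>t. t ^ k * (1 - t) ^ (N - k))))"
        if r: "norm r = 1" for r
      proof -
        have int: "integrable fs_measure (\<lambda>x. g (k / N) * Bernstein N k (overlap r (chart x)))" for k
          unfolding Bernstein_def
          by (rule integrable_overlap[OF r, of "\<lambda>t. g (k / N) * (real (N choose k) * t ^ k * (1 - t) ^ (N - k))"])
            (intro continuous_intros)
        have "?I r ?b = (\<Sum>k\<le>N. \<integral>x. g (k / N) * Bernstein N k (overlap r (chart x)) \<partial>fs_measure)"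
          by (rule Bochner_Integration.integral_sum) (rule int)
        then show ?thesis by (simp add: Bernstein_def mult.assoc)
      qed
      from this[OF p] this[OF q] show ?thesis by (simp only: mono)
    qed
    show ?thesis using 1[OF p] 1[OF q] unfolding 2 by linarith
  qed
  have "\<bar>?I p g - ?I q g\<bar> \<le> 0"
  proof (rule field_le_epsilon)
    fix e :: real assume "e > 0"
    then show "\<bar>?I p g - ?I q g\<bar> \<le> 0 + e"
      using close[of "e / (2 * ?V)"] fs_vol_pos[where 'n = 'n] by simp
  qed
  then show ?thesis by simp
qed

text \<open>Equality in distribution was tested on continuous functions only, while the profile is
  unbounded near t = 1. The regularizations are continuous, and their integrals converge to those of
  the profile.\<close>

lemma integral_green_profile_eq:
  fixes p q :: "complex^('n::finite option)"
  assumes p: "norm p = 1" and q: "norm q = 1"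
  shows "(\<integral>x. green_profile CARD('n) (1 - overlap p (chart x)) \<partial>fs_measure)
    = (\<integral>x. green_profile CARD('n) (1 - overlap q (chart x)) \<partial>fs_measure)"
proof -
  have n: "CARD('n) \<ge> 1" by (simp add: Suc_leI)
  have lim: "(\<lambda>m. \<integral>x. regularized CARD('n) (1 / real (Suc m)) (overlap r (chart x)) \<partial>fs_measure)
      \<longlonglongrightarrow> (\<integral>x. green_profile CARD('n) (1 - overlap r (chart x)) \<partial>fs_measure)"
    if "norm r = 1" for r :: "complex^('n option)"
    using integral_green_profile_mult(2)[OF that, of "\<lambda>_. 1"] by simp
  have "(\<integral>x. regularized CARD('n) (1 / real (Suc m)) (overlap p (chart x)) \<partial>fs_measure)
    = (\<integral>x. regularized CARD('n) (1 / real (Suc m)) (overlap q (chart x)) \<partial>fs_measure)" for m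
    by (rule overlap_distribution_eq[OF p q continuous_on_regularized[OF n]]) simp
  then show ?thesis using lim[OF p] lim[OF q] LIMSEQ_unique by (simp only:)
qed

section \<open>The Green function\<close>

theorem theorem5p5:
  shows "is_green_FS (\<lambda>(\<xi>::complex^('n::finite option)) \<eta>.
     - 1 / (2 * real CARD('n) * fs_vol TYPE('n)) *
       (ln (sin (fs_dist \<xi> \<eta>))
        - (\<Sum>j = 1..CARD('n) - 1. 1 / (2 * real j * sin (fs_dist \<xi> \<eta>) ^ (2 * j)))))"
proof -
  \<comment> \<open>The minus sign accounts for \<open>fs_lap_at\<close> being the negative of
    \<open>lap\<close>; the denominator is the mass of the kernel, so the value at the pole is
    recovered with coefficient 1.\<close>
  define a where "a = - 1 / (2 * real CARD('n) * fs_vol TYPE('n))"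
  define g where "g s = green_profile CARD('n) s" for s
  \<comment> \<open>A reference pole, so that the common value of the integrals can be named before
    p is given.\<close>
  define p0 where "p0 = (axis None 1 :: complex^('n option))"
  have p0: "norm p0 = 1" by (simp add: p0_def norm_eq_sqrt_inner inner_axis_axis)
  have V: "fs_vol TYPE('n) > 0" by (rule fs_vol_pos)
  have a: "a * (2 * real CARD('n) * fs_vol TYPE('n)) = - 1" using V by (simp add: a_def)
  \<comment> \<open>The analysis assumes unit representatives, the definition of a Green function
    any nonzero ones. Overlaps and invariant functions do not see the difference.\<close>
  have unit: "\<exists>p'. norm p' = 1 \<and> (\<forall>\<xi>. overlap p \<xi> = overlap p' \<xi>) \<and> (\<exists>c. c \<noteq> 0 \<and> p = c *s p')"
    if "p \<noteq> 0" for p :: "complex^('n option)"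
  proof (intro exI conjI allI)
    let ?c = "complex_of_real (1 / norm p)"
    have c: "?c \<noteq> 0" using that by simp
    show "norm (?c *s p) = 1" using that by (simp add: norm_scale_complex norm_divide)
    show "overlap p \<xi> = overlap (?c *s p) \<xi>" for \<xi> by (rule overlap_scale(1)[OF c, symmetric])
    show "complex_of_real (norm p) \<noteq> 0" "p = complex_of_real (norm p) *s (?c *s p)"
      using that by (simp_all add: vector_smult_assoc)
  qed
  have "is_green_FS (\<lambda>(\<xi>::complex^('n option)) \<eta>. a * g (1 - overlap \<xi> \<eta>))"
    unfolding is_green_FS_def
  proof (intro conjI allI impI)
    fix p q :: "complex^('n option)" and c d :: complex
    assume "(p, q) \<in> offdiag \<and> c \<noteq> 0 \<and> d \<noteq> 0"
    then show "a * g (1 - overlap (c *s p) (d *s q)) = a * g (1 - overlap p q)"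
      by (simp add: overlap_scale)
  next
    show "Ck k offdiag (\<lambda>(p :: complex^('n option), q). a * g (1 - overlap p q))" for k
      using Ck_cmult[OF open_offdiag Ck_green_profile_overlap] by (simp add: g_def case_prod_unfold)
  next
    show "a * g (1 - overlap p q) = a * g (1 - overlap q p)" for p q :: "complex^('n option)"
      by (simp add: overlap_commute[of p])
  next
    show "\<exists>C. \<forall>p :: complex^('n option). p \<noteq> 0 \<longrightarrow> fs_integrable (\<lambda>q. a * g (1 - overlap p q))
        \<and> fs_integral (\<lambda>q. a * g (1 - overlap p q)) = C"
    proof (intro exI allI impI)
      fix p :: "complex^('n option)" assume "p \<noteq> 0"
      then obtain p' where p': "norm p' = 1" "\<And>\<xi>. overlap p \<xi> = overlap p' \<xi>" using unit by blast
      have int: "integrable fs_measure (\<lambda>x. a * g (1 - overlap p' (chart x)))"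
        unfolding g_def by (intro integrable_mult_right integrable_green_profile_overlap p')
      have meas: "(\<lambda>x. a * g (1 - overlap p' (chart x))) \<in> borel_measurable borel"
        using borel_measurable_integrable[OF int] by simp
      have "fs_integral (\<lambda>q. a * g (1 - overlap p q)) = a * (\<integral>x. g (1 - overlap p' (chart x)) \<partial>fs_measure)"
        unfolding p'(2) fs_integral_eq[OF meas] by simp
      also have "\<dots> = a * (\<integral>x. g (1 - overlap p0 (chart x)) \<partial>fs_measure)"
        unfolding g_def integral_green_profile_eq[OF p'(1) p0] ..
      moreover have "fs_integrable (\<lambda>q. a * g (1 - overlap p q))"
        using int unfolding p'(2) fs_integrable_def integrable_fs_measure[OF meas] .
      ultimately show "fs_integrable (\<lambda>q. a * g (1 - overlap p q)) \<and> fs_integral (\<lambda>q. a * g (1 - overlap p q))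
          = a * (\<integral>x. g (1 - overlap p0 (chart x)) \<partial>fs_measure)" by simp
    qed
  next
    fix \<phi> :: "complex^('n option) \<Rightarrow> real" and p :: "complex^('n option)"
    assume \<phi>: "fs_C2 \<phi>" and "p \<noteq> 0"
    then obtain p' c where p': "norm p' = 1" "\<And>\<xi>. overlap p \<xi> = overlap p' \<xi>" and c: "c \<noteq> 0" "p = c *s p'"
      using unit by blast
    note P = projective_C2_frechet[OF \<phi>]
    interpret \<phi>: projective_C2 \<phi> "\<lambda>\<xi>. frechet_derivative \<phi> (at \<xi>)"
      "\<lambda>\<xi> v. frechet_derivative (\<lambda>\<eta>. frechet_derivative \<phi> (at \<eta>) v) (at \<xi>)"
      by (rule P)
    have lap: "fs_lap_at \<phi> x = - \<phi>.lap (chart x)" for x by (rule fs_lap_at_eq[OF P])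
    have int: "integrable fs_measure (\<lambda>x. g (1 - overlap p' (chart x)) * \<phi>.lap (chart x))"
      unfolding g_def by (rule integral_green_profile_mult(1)[OF p'(1) \<phi>.continuous_on_lap \<phi>.lap_scale])
    then have meas: "(\<lambda>x. g (1 - overlap p' (chart x)) * \<phi>.lap (chart x)) \<in> borel_measurable borel"
      using borel_measurable_integrable[OF int] by simp
    have eq: "a * g (1 - overlap p (chart x)) * fs_lap_at \<phi> x * vol_density x
        = - a * ((g (1 - overlap p' (chart x)) * \<phi>.lap (chart x)) * vol_density x)" for x
      by (simp add: lap p'(2))
    show "integrable lborel (\<lambda>x. a * g (1 - overlap p (chart x)) * fs_lap_at \<phi> x * vol_density x)"
      unfolding eq using int by (intro integrable_mult_right) (simp add: integrable_fs_measure[OF meas])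
    have "p' \<noteq> 0" using p'(1) by auto
    then have \<phi>p: "\<phi> p = \<phi> p'" using c \<phi>.invariant by simp
    have "(\<integral>x. a * g (1 - overlap p (chart x)) * fs_lap_at \<phi> x * vol_density x \<partial>lborel)
        = - a * (\<integral>x. g (1 - overlap p' (chart x)) * \<phi>.lap (chart x) \<partial>fs_measure)"
      unfolding eq integral_fs_measure[OF meas] by (rule integral_mult_right_zero)
    also have "\<dots> = - a * (2 * real CARD('n) * fs_vol TYPE('n)) * \<phi> p' + a * 2 * real CARD('n) * (\<integral>x. \<phi> (chart x) \<partial>fs_measure)"
      unfolding g_def green_formula[OF p'(1) P] by (simp add: algebra_simps)
    also have "\<dots> = \<phi> p - fs_integral \<phi> / fs_vol TYPE('n)"
    proof -
      have "fs_integral \<phi> = (\<integral>x. \<phi> (chart x) \<partial>fs_measure)"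
        using borel_measurable_integrable[OF integrable_projective[OF \<phi>.continuous_on_f \<phi>.invariant]]
        by (intro fs_integral_eq) simp
      moreover have "a * 2 * real CARD('n) = - 1 / fs_vol TYPE('n)" using V by (simp add: a_def)
      ultimately show ?thesis unfolding \<phi>p using a V by (simp add: algebra_simps)
    qed
    finally show "\<phi> p = fs_integral \<phi> / fs_vol TYPE('n)
        + (\<integral>x. a * g (1 - overlap p (chart x)) * fs_lap_at \<phi> x * vol_density x \<partial>lborel)"
      by simp
  qed
  then show ?thesis
    unfolding green_profile_sin a_def g_def .
qed

end
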